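(* Let $\mathbb{K}$ be a local field, $p>1$ and $V=\mathbb{K}^d$. Let $\mu$ be a Borel probability measure on the group $G:=\mathrm{GL}(V)$ such that the $p$-th moment $\int_G(\log N(g))^p\,\mathrm{d}\mu(g)$ is finite, and let $\lambda_1$ be its first Lyapunov exponent. Then, for every $\varepsilon>0$, there exist constants $C_n=C_n(p,\varepsilon,\mu)$, $n\ge1$, such that $\sum_{n\ge1}n^{p-2}C_n<\infty$ and, for all $n\ge1$, $$\mu^{*n}\left(\left\{g\in G:\ \bigl|\log\|g\|-n\lambda_1\bigr|\ge\varepsilon n\right\}\right)\le C_n .$$ Moreover, if $\Gamma_\mu$ acts irreducibly on $V$, then (with constants $C_n$ not depending on $v$) for any $v\in V\setminus\{0\}$ and $n\ge1$ one has $$\mu^{*n}\left(\left\{g\in G:\ \left|\log\frac{\|gv\|}{\|v\|}-n\lambda_1\right|\ge\varepsilon n\right\}\right)\le C_n .$$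
   Context: A local field is a nondiscrete locally compact field, equipped with an absolute value $|\cdot|$ defining its topology (the usual one for $\mathbb{R}$, $\mathbb{C}$). $V=\mathbb{K}^d$ has a fixed basis $e_1,\dots,e_d$ and norm: for $v=\sum v_ie_i$, $\|v\|=(\sum|v_i|^2)^{1/2}$ if $\mathbb{K}=\mathbb{R}$ or $\mathbb{C}$, and $\|v\|=\max|v_i|$ otherwise; $\|g\|$ is the operator norm and $N(g)=\max(\|g\|,\|g^{-1}\|)$. $\mu^{*n}$ is the $n$-th convolution power of $\mu$, $\Gamma_\mu$ is the sub-semigroup of $G$ generated by the support of $\mu$, and $\lambda_1=\lim_{n\to\infty}\frac1n\int_G\log\|g\|\,\mathrm{d}\mu^{*n}(g)$. *)

theory Defs
  imports "HOL-Probability.Probability"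
begin

class field_with_topology = field + topological_space
begin

text \<open>For a bijection, the last conjunct says that it is a homeomorphism.\<close>
definition topological_field_iso :: "('b::{field,topological_space} \<Rightarrow> 'a) \<Rightarrow> bool" where
  "topological_field_iso \<phi> \<longleftrightarrow>
     bij \<phi> \<and> (\<forall>x y. \<phi> (x + y) = \<phi> x + \<phi> y) \<and> (\<forall>x y. \<phi> (x * y) = \<phi> x * \<phi> y) \<and>
     (\<forall>S. open (\<phi> -` S) \<longleftrightarrow> open S)"

end

text \<open>
  The axiom \<open>dist_absval\<close> and those of \<open>metric_space\<close> say that \<open>absval\<close> is definite, satisfies the
  triangle inequality and defines the topology. The last two axioms fix its normalisation on \<open>\<real>\<close>
  and \<open>\<complex>\<close>, ruling out for instance the square root of the usual absolute value. (The library
  constant \<open>norm\<close> is constrained to real normed vector spaces, so it is not available here.)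
\<close>
class local_field = field_with_topology + metric_space +
  fixes absval :: "'a \<Rightarrow> real"
  assumes dist_absval: "dist x y = absval (x - y)"
    and absval_mult: "absval (x * y) = absval x * absval y"
    and nondiscrete: "\<exists>S::'a set. \<not> open S"
    and locally_compact: "\<exists>U K. open U \<and> compact K \<and> x \<in> U \<and> U \<subseteq> K"
    and usual_absval_real: "topological_field_iso (\<phi> :: real \<Rightarrow> 'a) \<Longrightarrow> absval (\<phi> r) = \<bar>r\<bar>"
    and usual_absval_complex: "topological_field_iso (\<psi> :: complex \<Rightarrow> 'a) \<Longrightarrow> absval (\<psi> z) = cmod z"

text \<open>
  The instances for \<open>\<real>\<close> and \<open>\<complex>\<close> below confirm that the normalisation axioms hold for the usual
  absolute values.
\<close>

lemma continuous_additive_real: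
  fixes f :: "real \<Rightarrow> 'b::real_normed_vector"
  assumes add: "\<And>x y. f (x + y) = f x + f y" and cont: "continuous_on UNIV f"
  shows "f r = r *\<^sub>R f 1"
proof -
  interpret additive f by standard (rule add)
  have nat: "f (of_nat n * x) = of_nat n *\<^sub>R f x" for n x
    by (induction n) (auto simp: zero add algebra_simps)
  have int: "f (of_int k * x) = of_int k *\<^sub>R f x" for k x
    by (cases k rule: int_cases2) (auto simp: minus nat)
  have rat: "f q = q *\<^sub>R f 1" if q_Rats: "q \<in> \<rat>" for q
  proof -
    obtain a b :: int where q: "q = of_int a / of_int b" "b \<noteq> 0"
      using q_Rats unfolding Rats_eq_int_div_int by blast
    have "of_int b *\<^sub>R f q = f (of_int b * q)" by (simp only: int)
    also have "\<dots> = f (of_int a * 1)" using q by simp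
    also have "\<dots> = of_int a *\<^sub>R f 1" by (simp only: int)
    also have "\<dots> = of_int b *\<^sub>R (q *\<^sub>R f 1)" using q by simp
    finally show ?thesis using q(2) by (metis of_int_eq_0_iff scaleR_left_imp_eq)
  qed
  have "closed {x. f x = x *\<^sub>R f 1}"
    by (intro closed_Collect_eq cont continuous_intros)
  moreover have "\<rat> \<subseteq> {x. f x = x *\<^sub>R f 1}" using rat by blast
  ultimately have "closure \<rat> \<subseteq> {x. f x = x *\<^sub>R f 1}" by (rule closure_minimal[rotated])
  then show ?thesis unfolding Rats_closure_real by blast
qed

lemma topological_field_iso_1:
  assumes "topological_field_iso \<phi>" shows "\<phi> 1 = 1"
proof -
  obtain x where "\<phi> x = 1" using assms by (metis topological_field_iso_def bij_is_surj surjD)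
  moreover have "\<phi> x = \<phi> x * \<phi> 1" using assms by (metis topological_field_iso_def mult.right_neutral)
  ultimately show ?thesis by simp
qed

lemma topological_field_iso_continuous:
  "topological_field_iso \<phi> \<Longrightarrow> continuous_on UNIV \<phi>"
  by (auto simp: topological_field_iso_def continuous_on_open_vimage)

instance real :: field_with_topology ..

instantiation real :: local_field
begin

definition absval_real :: "real \<Rightarrow> real" where
  "absval_real x = norm x"

instance
proof
  fix x y :: real
  show "dist x y = absval (x - y)" by (simp add: absval_real_def dist_norm)
  show "absval (x * y) = absval x * absval y" by (simp add: absval_real_def abs_mult)
  show "\<exists>S::real set. \<not> open S" using not_open_singleton by blast
  show "\<exists>U K. open U \<and> compact K \<and> x \<in> U \<and> U \<subseteq> K"
    by (rule exI[of _ "ball x 1"], rule exI[of _ "cball x 1"]) auto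
next
  fix \<phi> :: "real \<Rightarrow> real" and r assume iso: "topological_field_iso \<phi>"
  have "\<phi> r = r *\<^sub>R \<phi> 1"
    by (rule continuous_additive_real)
      (use iso topological_field_iso_continuous[OF iso] in \<open>auto simp: topological_field_iso_def\<close>)
  then show "absval (\<phi> r) = \<bar>r\<bar>" using topological_field_iso_1[OF iso] by (simp add: absval_real_def)
next
  fix \<psi> :: "complex \<Rightarrow> real" and z assume iso: "topological_field_iso \<psi>"
  have m: "\<psi> (a * b) = \<psi> a * \<psi> b" and a: "\<psi> (a + b) = \<psi> a + \<psi> b" for a b
    using iso by (auto simp: topological_field_iso_def)
  have "\<psi> \<i> * \<psi> \<i> + 1 = \<psi> (\<i> * \<i> + 1)"
    by (simp only: m a topological_field_iso_1[OF iso])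
  also have "\<dots> = 0" using a[of 0 0] by simp
  finally have False by (smt (verit) zero_le_square)
  then show "absval (\<psi> z) = cmod z" ..
qed

end

instance complex :: field_with_topology ..

instantiation complex :: local_field
begin

definition absval_complex :: "complex \<Rightarrow> real" where
  "absval_complex x = norm x"

instance
proof
  fix x y :: complex
  show "dist x y = absval (x - y)" by (simp add: absval_complex_def dist_norm)
  show "absval (x * y) = absval x * absval y" by (simp add: absval_complex_def norm_mult)
  show "\<exists>S::complex set. \<not> open S" using not_open_singleton by blast
  show "\<exists>U K. open U \<and> compact K \<and> x \<in> U \<and> U \<subseteq> K"
    by (rule exI[of _ "ball x 1"], rule exI[of _ "cball x 1"]) auto
next
  fix \<phi> :: "real \<Rightarrow> complex" and r assume iso: "topological_field_iso \<phi>"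
  have "\<phi> r = r *\<^sub>R \<phi> 1"
    by (rule continuous_additive_real)
      (use iso topological_field_iso_continuous[OF iso] in \<open>auto simp: topological_field_iso_def\<close>)
  then show "absval (\<phi> r) = \<bar>r\<bar>" using topological_field_iso_1[OF iso] by (simp add: absval_complex_def)
next
  fix \<psi> :: "complex \<Rightarrow> complex" and z assume iso: "topological_field_iso \<psi>"
  have m: "\<psi> (a * b) = \<psi> a * \<psi> b" and a: "\<psi> (a + b) = \<psi> a + \<psi> b" for a b
    using iso by (auto simp: topological_field_iso_def)
  have cont: "continuous_on UNIV (\<lambda>r. \<psi> (of_real r))"
    by (intro continuous_on_compose2[OF topological_field_iso_continuous[OF iso]] continuous_intros) auto
  have of_real: "\<psi> (of_real r) = of_real r" for r
    using continuous_additive_real[OF _ cont, of r] topological_field_iso_1[OF iso]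
    by (simp add: a scaleR_conv_of_real)
  have "(\<psi> \<i>)\<^sup>2 = -1"
    using m[of \<i> \<i>] of_real[of "-1"] by (simp add: power2_eq_square)
  then have "\<psi> \<i> = \<i> \<or> \<psi> \<i> = -\<i>" by (metis power2_eq_iff power2_i)
  moreover have "\<psi> z = of_real (Re z) + \<psi> \<i> * of_real (Im z)"
    by (metis a complex_eq m of_real)
  ultimately show "absval (\<psi> z) = cmod z" by (auto simp: absval_complex_def cmod_def)
qed

end

definition real_or_complex :: "'k::local_field itself \<Rightarrow> bool" where
  "real_or_complex _ \<longleftrightarrow>
     (\<exists>\<phi> :: real \<Rightarrow> 'k. topological_field_iso \<phi>) \<or> (\<exists>\<psi> :: complex \<Rightarrow> 'k. topological_field_iso \<psi>)"

text \<open>The space \<open>V\<close> is \<open>'k^'d\<close>; the library norm on it needs \<open>'k\<close> to be a real normed space.\<close>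

definition vnorm :: "'k::local_field^'d \<Rightarrow> real" where
  "vnorm v = (if real_or_complex TYPE('k) then sqrt (\<Sum>i\<in>UNIV. (absval (v $ i))\<^sup>2)
              else Max (range (\<lambda>i. absval (v $ i))))"

text \<open>The vector \<open>v = 0\<close> contributes \<open>0 / 0 = 0\<close> to this supremum.\<close>
definition opnorm :: "'k::local_field^'d^'d \<Rightarrow> real" where
  "opnorm g = (SUP v. vnorm (g *v v) / vnorm v)"

definition Nsize :: "'k::local_field^'d^'d \<Rightarrow> real" where
  "Nsize g = max (opnorm g) (opnorm (matrix_inv g))"

definition GL :: "('k::local_field^'d^'d) set" where
  "GL = {g. invertible g}"

definition borel_GL :: "('k::local_field^'d^'d) measure" where
  "borel_GL = restrict_space borel GL"

definition mult_convolution ::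
    "('k::local_field^'d^'d) measure \<Rightarrow> ('k^'d^'d) measure \<Rightarrow> ('k^'d^'d) measure" where
  "mult_convolution M N = distr (M \<Otimes>\<^sub>M N) borel_GL (\<lambda>(g, h). g ** h)"

primrec conv_power ::
    "('k::local_field^'d^'d) measure \<Rightarrow> nat \<Rightarrow> ('k^'d^'d) measure" where
  "conv_power \<mu> 0 = return borel_GL (mat 1)"
| "conv_power \<mu> (Suc n) = mult_convolution \<mu> (conv_power \<mu> n)"

definition lyapunov1 :: "('k::local_field^'d^'d) measure \<Rightarrow> real" where
  "lyapunov1 \<mu> = lim (\<lambda>n. 1 / real n * (\<integral>g. ln (opnorm g) \<partial>conv_power \<mu> n))"

definition supp :: "('k::local_field^'d^'d) measure \<Rightarrow> ('k^'d^'d) set" where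
  "supp \<mu> = {g \<in> GL. \<forall>U. open U \<and> g \<in> U \<longrightarrow> 0 < emeasure \<mu> (U \<inter> GL)}"

inductive_set generated_semigroup :: "('k::local_field^'d^'d) measure \<Rightarrow> ('k^'d^'d) set" for \<mu> where
  supp: "g \<in> supp \<mu> \<Longrightarrow> g \<in> generated_semigroup \<mu>"
| mult: "g \<in> generated_semigroup \<mu> \<Longrightarrow> h \<in> generated_semigroup \<mu> \<Longrightarrow> g ** h \<in> generated_semigroup \<mu>"

definition acts_irreducibly :: "('k::local_field^'d^'d) set \<Rightarrow> bool" where
  "acts_irreducibly \<Gamma> \<longleftrightarrow>
     (\<forall>W. vec.subspace W \<and> (\<forall>g\<in>\<Gamma>. \<forall>w\<in>W. g *v w \<in> W) \<longrightarrow> W = {0} \<or> W = UNIV)"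

end

theory Submission
  imports Defs
begin

text \<open>
  The heart of the matter is a large deviation bound for a function \<open>f\<close> along the walk \<open>v \<mapsto> g *v v\<close>
  (\<open>lower_deviation\<close>): if \<open>f\<close> changes by at most \<open>lnN g\<close> plus a constant in each step and if, for some
  \<open>m\<close>, its mean increase over \<open>m\<close> steps is at least \<open>m * b\<close> from every starting point of an invariant
  set, then the probability that \<open>f\<close> has increased by less than \<open>(b - \<epsilon>) * n\<close> after \<open>n\<close> steps is at
  most \<open>C n\<close> with \<open>\<Sum>n. n powr (p - 2) * C n < \<infinity>\<close>. This is a Fuk-Nagaev inequality. Either some step has
  \<open>lnN g > \<delta> * n\<close>, which has probability at most \<open>n * P (lnN > \<delta> * n)\<close>, a summable contribution by the
  moment assumption; or all steps are at most \<open>\<delta> * n\<close>, and an exponential moment with parameter of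
  order \<open>ln n / n\<close> gives any power of \<open>1 / n\<close> that is wanted.

  The upper deviations follow from this bound for \<open>f = - ln vnorm\<close>, because the mean of
  \<open>ln (opnorm g)\<close> over \<open>m\<close> steps is at most \<open>m * (lyapunov1 \<mu> + \<epsilon>)\<close> for large \<open>m\<close>; the operator norm
  is compared with the images of the standard basis.

  For the lower deviations one needs vectors along which the drift of \<open>ln vnorm\<close> is at least
  \<open>m * (lyapunov1 \<mu> - \<epsilon>)\<close>, uniformly. They exist in a quotient of the space (\<open>exists_fast_quotient\<close>). Call an
  invariant subspace slow if all its vectors grow at a rate less than \<open>lyapunov1 \<mu>\<close>, and let \<open>U\<close> be a
  slow subspace of largest dimension; it is proper because the whole space does not grow slowly. Let \<open>a\<close> be the least drift per step on the quotient
  by \<open>U\<close>. If \<open>a\<close> were less than \<open>lyapunov1 \<mu>\<close>, then averaging along the trajectory of an almost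
  minimising vector, and compactness of the projective space, would yield a vector outside \<open>U\<close> whose
  growth rate modulo \<open>U\<close> is at most \<open>a\<close>, up to summable errors, along a sequence of times. The
  vectors with that property form an invariant subspace \<open>W\<close> (\<open>slow_extension\<close>), and \<open>W\<close>, being an extension of slow by slow, is slow
  (\<open>slow_at_extension\<close>), which contradicts the choice of \<open>U\<close>. So the lower deviation bound holds on the
  quotient by \<open>U\<close>, hence for the operator norm, which dominates the norms of vectors in a quotient.
  If the action is irreducible, then \<open>U\<close> is zero and the bound holds for every nonzero vector.
\<close>

section \<open>Local fields\<close>

lemma absval_0 [simp]: "absval (0::'k::local_field) = 0"
  using dist_absval[of "0::'k" 0] by simp

lemma absval_eq_0 [simp]: "absval (x::'k::local_field) = 0 \<longleftrightarrow> x = 0"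
  using dist_absval[of x 0] by auto

lemma absval_nonneg [simp]: "absval (x::'k::local_field) \<ge> 0"
  using dist_absval[of x 0] zero_le_dist[of x 0] by simp

lemma absval_pos [simp]: "absval (x::'k::local_field) > 0 \<longleftrightarrow> x \<noteq> 0"
  by (auto simp: less_le)

lemma absval_minus [simp]: "absval (- x) = absval (x::'k::local_field)"
  using dist_absval[of 0 x] dist_absval[of x 0] by (simp add: dist_commute)

lemma absval_add_le: "absval (x + y) \<le> absval x + absval (y::'k::local_field)"
  using dist_triangle[of x "-y" 0] dist_absval[of x "-y"] dist_absval[of x 0] dist_absval[of 0 "-y"]
  by simp

lemma absval_1 [simp]: "absval (1::'k::local_field) = 1"
  using absval_mult[of "1::'k" 1] by simp

lemma absval_inverse: "absval (inverse x) = inverse (absval (x::'k::local_field))"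
proof (cases "x = 0")
  case False
  then have "absval x * absval (inverse x) = 1" by (simp flip: absval_mult)
  then show ?thesis by (metis inverse_unique)
qed simp

lemma absval_power: "absval (x ^ n) = absval (x::'k::local_field) ^ n"
  by (induction n) (auto simp: absval_mult)

lemma absval_sum_le: "absval (\<Sum>i\<in>A. f i :: 'k::local_field) \<le> (\<Sum>i\<in>A. absval (f i))"
  by (induction A rule: infinite_finite_induct) (auto intro: order_trans[OF absval_add_le])

instance local_field < topological_ab_group_add
proof
  fix a b :: 'a
  show "LIM x (nhds a \<times>\<^sub>F nhds b). fst x + snd x :> nhds (a + b)"
  proof (rule metric_tendsto_imp_tendsto)
    show "((\<lambda>x. dist (fst x) a + dist (snd x) b) \<longlongrightarrow> 0) (nhds a \<times>\<^sub>F nhds b)"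
    proof -
      have "((\<lambda>x. dist (fst x) a) \<longlongrightarrow> dist a a) (nhds a \<times>\<^sub>F nhds b)"
        by (intro tendsto_dist tendsto_const filterlim_fst)
      moreover have "((\<lambda>x. dist (snd x) b) \<longlongrightarrow> dist b b) (nhds a \<times>\<^sub>F nhds b)"
        by (intro tendsto_dist tendsto_const filterlim_snd)
      ultimately show ?thesis using tendsto_add by fastforce
    qed
    show "\<forall>\<^sub>F x in nhds a \<times>\<^sub>F nhds b. dist (fst x + snd x) (a + b) \<le> dist (dist (fst x) a + dist (snd x) b) 0"
    proof (rule always_eventually, rule allI)
      fix x :: "'a \<times> 'a"
      have "dist (fst x + snd x) (a + b) = absval ((fst x - a) + (snd x - b))"
        by (simp add: dist_absval algebra_simps)
      also have "\<dots> \<le> dist (fst x) a + dist (snd x) b"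
        unfolding dist_absval[of "fst x"] dist_absval[of "snd x"] by (rule absval_add_le)
      finally show "dist (fst x + snd x) (a + b) \<le> dist (dist (fst x) a + dist (snd x) b) 0"
        by (simp add: dist_real_def)
    qed
  qed
  show "(uminus \<longlongrightarrow> - a) (nhds a)"
  proof (rule metric_tendsto_imp_tendsto)
    show "((\<lambda>x. x) \<longlongrightarrow> a) (nhds a)" by (rule filterlim_ident)
    have "dist (- x) (- a) = dist x a" for x
    proof -
      have "- x - - a = - (x - a)" by simp
      then show ?thesis unfolding dist_absval by (simp only: absval_minus)
    qed
    then show "\<forall>\<^sub>F x in nhds a. dist (- x) (- a) \<le> dist x a" by simp
  qed
qed

instance local_field < topological_semigroup_mult
proof
  fix a b :: 'a
  show "LIM x (nhds a \<times>\<^sub>F nhds b). fst x * snd x :> nhds (a * b)"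
  proof (rule metric_tendsto_imp_tendsto)
    let ?F = "nhds a \<times>\<^sub>F nhds b"
    have 1: "((\<lambda>x. dist (fst x) a) \<longlongrightarrow> 0) ?F"
      using tendsto_dist[OF filterlim_fst[of "nhds a" "nhds b"] tendsto_const[of a]] by simp
    have 2: "((\<lambda>x. dist (snd x) b) \<longlongrightarrow> 0) ?F"
      using tendsto_dist[OF filterlim_snd[of "nhds b" "nhds a"] tendsto_const[of b]] by simp
    show "((\<lambda>x. dist (fst x) a * dist (snd x) b + absval a * dist (snd x) b + dist (fst x) a * absval b) \<longlongrightarrow> 0) ?F"
      using tendsto_add[OF tendsto_add[OF tendsto_mult[OF 1 2] tendsto_mult[OF tendsto_const 2]]
          tendsto_mult[OF 1 tendsto_const]] by simp
    show "\<forall>\<^sub>F x in ?F. dist (fst x * snd x) (a * b) \<le>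
       dist (dist (fst x) a * dist (snd x) b + absval a * dist (snd x) b + dist (fst x) a * absval b) 0"
    proof (rule always_eventually, rule allI)
      fix x :: "'a \<times> 'a"
      have "fst x * snd x - a * b = (fst x - a) * (snd x - b) + a * (snd x - b) + (fst x - a) * b"
        by (simp add: algebra_simps)
      then have "dist (fst x * snd x) (a * b) \<le>
         absval ((fst x - a) * (snd x - b)) + absval (a * (snd x - b)) + absval ((fst x - a) * b)"
        unfolding dist_absval by (metis absval_add_le add_right_mono order_trans)
      then show "dist (fst x * snd x) (a * b) \<le>
         dist (dist (fst x) a * dist (snd x) b + absval a * dist (snd x) b + dist (fst x) a * absval b) 0"
        by (simp add: dist_real_def absval_mult dist_absval)
    qed
  qed
qed

lemma continuous_on_absval [continuous_intros]:
  fixes f :: "'b::topological_space \<Rightarrow> 'k::local_field"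
  assumes "continuous_on S f" shows "continuous_on S (\<lambda>x. absval (f x))"
proof -
  have "continuous_on S (\<lambda>x. dist (f x) 0)" using assms by (intro continuous_intros)
  then show ?thesis by (simp add: dist_absval)
qed

lemma exists_absval_between_0_1: "\<exists>x::'k::local_field. 0 < absval x \<and> absval x < 1"
proof (rule ccontr)
  assume *: "\<not> ?thesis"
  have far: "absval x \<ge> 1" if "x \<noteq> 0" for x :: 'k using * that by force
  have "open S" for S :: "'k set"
    unfolding open_dist
  proof (intro ballI exI[of _ 1] conjI allI impI)
    fix x y :: 'k assume "x \<in> S" and "dist y x < 1"
    then have "y - x = 0" using far[of "y - x"] by (simp only: dist_absval) argo
    then show "y \<in> S" using \<open>x \<in> S\<close> by simp
  qed simp
  then show False using nondiscrete by blast
qed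

text \<open>Multiplying by a large power of an element of absolute value greater than \<open>1\<close> blows a
  compact neighbourhood of \<open>0\<close> up to contain any given bounded set.\<close>
lemma compact_cball_0: "compact (cball (0::'k::local_field) R)"
proof -
  obtain x :: 'k where x: "0 < absval x" "absval x < 1" using exists_absval_between_0_1 by blast
  then have x0: "x \<noteq> 0" by auto
  obtain U K where UK: "open U" "compact K" "(0::'k) \<in> U" "U \<subseteq> K" using locally_compact by blast
  then obtain e where e: "e > 0" "ball 0 e \<subseteq> K" by (meson open_contains_ball subset_trans)
  obtain n where n: "absval x ^ n * (\<bar>R\<bar> + 1) < e"
  proof -
    have "(\<lambda>n. absval x ^ n * (\<bar>R\<bar> + 1)) \<longlonglongrightarrow> 0 * (\<bar>R\<bar> + 1)"
      using x by (intro tendsto_mult tendsto_const LIMSEQ_power_zero) simp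
    from order_tendstoD(2)[OF this, of e] have "eventually (\<lambda>n. absval x ^ n * (\<bar>R\<bar> + 1) < e) sequentially"
      using e(1) by simp
    then show ?thesis using that by (auto simp: eventually_sequentially)
  qed
  let ?f = "\<lambda>y. inverse (x ^ n) * y"
  have "cball 0 R \<subseteq> ?f ` K"
  proof
    fix y assume y: "y \<in> cball (0::'k) R"
    then have yR: "absval y \<le> R" using dist_absval[of y 0] by (simp add: dist_commute)
    have "absval (x ^ n * y) \<le> absval x ^ n * (\<bar>R\<bar> + 1)"
      using yR x by (auto simp: absval_mult absval_power intro!: mult_left_mono)
    then have "absval (x ^ n * y) < e" using n by simp
    then have "dist (x ^ n * y) 0 < e" unfolding dist_absval by simp
    then have "x ^ n * y \<in> K" using e by (auto simp: dist_commute)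
    moreover have "y = ?f (x ^ n * y)" using x0 by (simp add: field_simps)
    ultimately show "y \<in> ?f ` K" by blast
  qed
  moreover have "compact (?f ` K)"
    using UK(2) by (intro compact_continuous_image continuous_on_mult continuous_intros)
  ultimately show ?thesis using closed_cball compact_Int_closed[of "?f ` K" "cball 0 R"]
    by (simp add: Int_absorb1)
qed

instance local_field < heine_borel
proof
  fix f :: "nat \<Rightarrow> 'a" assume "bounded (range f)"
  then obtain R where "\<forall>y\<in>range f. dist 0 y \<le> R"
    using bounded_any_center[of "range f" 0] by blast
  then have "f n \<in> cball 0 R" for n by simp
  then obtain l r where "strict_mono (r::nat\<Rightarrow>nat)" "(f \<circ> r) \<longlonglongrightarrow> l"
    using seq_compactE[OF compact_imp_seq_compact[OF compact_cball_0[of R]], of f] by blast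
  then show "\<exists>l r. strict_mono (r::nat\<Rightarrow>nat) \<and> ((f \<circ> r) \<longlonglongrightarrow> l)" by blast
qed

text \<open>Bounded closed sets being compact, the space is a countable union of compact, hence separable,
  sets.\<close>
instance heine_borel < second_countable_topology
proof
  obtain x :: 'a where True by simp
  have "\<exists>D. countable D \<and> (\<forall>y\<in>cball x (real n). \<forall>e>0. \<exists>d\<in>D. dist y d < e)" for n
  proof -
    have c: "compact (cball x (real n))" by (simp add: compact_eq_bounded_closed)
    have "\<exists>k. finite k \<and> cball x (real n) \<subseteq> (\<Union>z\<in>k. ball z (inverse (real (Suc m))))" for m
      using seq_compact_imp_totally_bounded[of "cball x (real n)"] c compact_imp_seq_compact
      by (metis inverse_positive_iff_positive of_nat_0_less_iff zero_less_Suc)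
    then obtain k where k: "\<And>m. finite (k m)" "\<And>m. cball x (real n) \<subseteq> (\<Union>z\<in>k m. ball z (inverse (real (Suc m))))"
      by metis
    show ?thesis
    proof (intro exI[of _ "\<Union>m. k m"] conjI ballI allI impI)
      show "countable (\<Union>m. k m)" using k(1) by (auto intro: countable_finite)
      fix y and e :: real assume y: "y \<in> cball x (real n)" and "e > 0"
      then obtain m where m: "inverse (real (Suc m)) < e" using reals_Archimedean by blast
      obtain z where "z \<in> k m" "dist z y < inverse (real (Suc m))" using k(2)[of m] y by auto
      then have "z \<in> (\<Union>m. k m)" "dist y z < e" using m by (auto simp: dist_commute[of z y])
      then show "\<exists>d\<in>\<Union>m. k m. dist y d < e" by blast
    qed
  qed
  then obtain D where D: "\<And>n. countable (D n)" "\<And>n y e. y \<in> cball x (real n) \<Longrightarrow> e > 0 \<Longrightarrow> \<exists>d\<in>D n. dist y d < e"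
    by metis
  define E where "E = (\<Union>n. D n)"
  have E: "countable E" "\<exists>d\<in>E. dist y d < e" if "e > 0" for y :: 'a and e
  proof -
    show "countable E" using D(1) by (auto simp: E_def)
    obtain n where "dist x y \<le> real n" using real_arch_simple by blast
    then show "\<exists>d\<in>E. dist y d < e" using D(2)[of y n e] that by (auto simp: E_def)
  qed
  let ?B = "(\<lambda>(d, m). ball d (inverse (real (Suc m)))) ` (E \<times> UNIV)"
  have "topological_basis ?B"
  proof (rule topological_basisI)
    show "\<And>B'. B' \<in> ?B \<Longrightarrow> open B'" by auto
    fix O' :: "'a set" and y assume "open O'" "y \<in> O'"
    then obtain e where e: "e > 0" "ball y e \<subseteq> O'" using open_contains_ball by blast
    obtain m where m: "inverse (real (Suc m)) < e / 2" using reals_Archimedean[of "e/2"] e by auto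
    obtain d where d: "d \<in> E" "dist y d < inverse (real (Suc m))"
      using E(2)[of "inverse (real (Suc m))" y] by auto
    have "ball d (inverse (real (Suc m))) \<subseteq> ball y e"
    proof
      fix z assume "z \<in> ball d (inverse (real (Suc m)))"
      then show "z \<in> ball y e" using m d(2) dist_triangle[of y z d] by auto
    qed
    then show "\<exists>B'\<in>?B. y \<in> B' \<and> B' \<subseteq> O'"
      using d e by (intro bexI[of _ "ball d (inverse (real (Suc m)))"]) (auto simp: dist_commute[of d y])
  qed
  moreover have "countable ?B" using E(1)[of 1] by auto
  ultimately show "\<exists>B::'a set set. countable B \<and> open = generate_topology B"
    using topological_basis_imp_subbasis by blast
qed

lemma continuous_on_matrix_vector_mult [continuous_intros]:
  fixes f :: "'b::topological_space \<Rightarrow> 'k::local_field^'n^'m"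
  assumes "continuous_on S f" "continuous_on S g"
  shows "continuous_on S (\<lambda>x. f x *v g x)"
  unfolding matrix_vector_mult_def using assms by (intro continuous_intros)

lemma continuous_on_matrix_mult [continuous_intros]:
  fixes f :: "'b::topological_space \<Rightarrow> 'k::local_field^'n^'m"
  assumes "continuous_on S f" "continuous_on S g"
  shows "continuous_on S (\<lambda>x. f x ** g x)"
  unfolding matrix_matrix_mult_def using assms by (intro continuous_intros)

section \<open>Norms\<close>

lemma vnorm_ge_coord: "absval (v $ i) \<le> vnorm (v::'k::local_field^'d)"
proof (cases "real_or_complex TYPE('k)")
  case True
  have "(absval (v $ i))\<^sup>2 \<le> (\<Sum>i\<in>UNIV. (absval (v $ i))\<^sup>2)"
    by (rule member_le_sum) auto
  then show ?thesis using True by (simp add: vnorm_def real_le_rsqrt)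
qed (simp add: vnorm_def)

lemma vnorm_le_sum: "vnorm (v::'k::local_field^'d) \<le> (\<Sum>i\<in>UNIV. absval (v $ i))"
proof (cases "real_or_complex TYPE('k)")
  case True
  then show ?thesis by (simp add: vnorm_def L2_set_le_sum flip: L2_set_def)
next
  case False
  have "absval (v $ j) \<le> (\<Sum>i\<in>UNIV. absval (v $ i))" for j
    by (rule member_le_sum) auto
  then show ?thesis using False by (simp add: vnorm_def)
qed

lemma vnorm_nonneg [simp]: "vnorm (v::'k::local_field^'d) \<ge> 0"
  using vnorm_ge_coord[of v undefined] absval_nonneg[of "v $ undefined"] by linarith

lemma vnorm_0 [simp]: "vnorm (0::'k::local_field^'d) = 0"
  using vnorm_le_sum[of "0::'k^'d"] vnorm_nonneg[of "0::'k^'d"] by simp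

lemma vnorm_pos [simp]: "vnorm (v::'k::local_field^'d) > 0 \<longleftrightarrow> v \<noteq> 0"
proof
  assume "v \<noteq> 0"
  then obtain i where "v $ i \<noteq> 0" by (auto simp: vec_eq_iff)
  then show "vnorm v > 0" using vnorm_ge_coord[of v i] absval_pos[of "v $ i"] by linarith
qed auto

lemma vnorm_eq_0 [simp]: "vnorm (v::'k::local_field^'d) = 0 \<longleftrightarrow> v = 0"
  using vnorm_pos[of v] vnorm_nonneg[of v] by (auto simp del: vnorm_pos)

lemma vnorm_scale: "vnorm (c *s v) = absval c * vnorm (v::'k::local_field^'d)"
proof (cases "real_or_complex TYPE('k)")
  case True
  then show ?thesis
    by (simp add: vnorm_def absval_mult power_mult_distrib real_sqrt_mult flip: sum_distrib_left)
next
  case False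
  have "mono ((*) (absval c))" by (auto intro!: monoI mult_left_mono)
  then have "absval c * Max (range (\<lambda>i. absval (v $ i))) = Max ((*) (absval c) ` range (\<lambda>i. absval (v $ i)))"
    by (intro mono_Max_commute) auto
  then show ?thesis using False by (simp add: vnorm_def absval_mult image_image)
qed

text \<open>A triangle inequality up to a constant serves for all local fields at once. Such constants disappear
  after taking logarithms and dividing by the number of steps.\<close>
lemma vnorm_add_le: "vnorm (v + w) \<le> real CARD('d) * (vnorm v + vnorm (w::'k::local_field^'d))"
proof -
  have "vnorm (v + w) \<le> (\<Sum>i\<in>UNIV. absval (v $ i + w $ i))"
    using vnorm_le_sum[of "v + w"] by simp
  also have "\<dots> \<le> (\<Sum>i\<in>(UNIV::'d set). vnorm v + vnorm w)"
    by (intro sum_mono order_trans[OF absval_add_le] add_mono vnorm_ge_coord)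
  finally show ?thesis by simp
qed

lemma continuous_on_vnorm [continuous_intros]:
  fixes f :: "'b::topological_space \<Rightarrow> 'k::local_field^'d"
  assumes "continuous_on S f" shows "continuous_on S (\<lambda>x. vnorm (f x))"
proof (cases "real_or_complex TYPE('k)")
  case True
  then show ?thesis unfolding vnorm_def using assms by (simp, intro continuous_intros)
next
  case False
  have "continuous_on S (\<lambda>x. Max ((\<lambda>i. absval (f x $ i)) ` A))" if "finite A" "A \<noteq> {}" for A :: "'d set"
    using that
  proof (induction A rule: finite_ne_induct)
    case (singleton i)
    then show ?case using assms by (auto intro!: continuous_intros)
  next
    case (insert i A)
    have "continuous_on S (\<lambda>x. max (absval (f x $ i)) (Max ((\<lambda>i. absval (f x $ i)) ` A)))"
      using insert assms by (intro continuous_intros) auto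
    then show ?case using insert by simp
  qed
  from this[of UNIV] show ?thesis using False by (simp add: vnorm_def)
qed

text \<open>The standard vectors \<open>axis i 1\<close> recover the size of a matrix up to a constant depending only on
  the dimension. This turns bounds for the finitely many orbits of basis vectors into bounds for the
  operator norm.\<close>
lemma vnorm_mult_le_basis:
  fixes A :: "'k::local_field^'d^'d"
  shows "vnorm (A *v v) \<le> real CARD('d) * (\<Sum>i\<in>UNIV. vnorm (A *v axis i 1)) * vnorm v"
proof -
  have *: "absval ((A *v v) $ j) \<le> (\<Sum>i\<in>UNIV. vnorm (A *v axis i 1)) * vnorm v" for j
  proof -
    have "(A *v v) $ j = (\<Sum>i\<in>UNIV. v $ i * (A *v axis i 1) $ j)"
      by (rule linear_componentwise) (rule matrix_vector_mul_linear_gen)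
    also have "absval \<dots> \<le> (\<Sum>i\<in>UNIV. absval (v $ i * (A *v axis i 1) $ j))" by (rule absval_sum_le)
    also have "\<dots> \<le> (\<Sum>i\<in>UNIV. vnorm v * vnorm (A *v axis i 1))"
      unfolding absval_mult by (intro sum_mono mult_mono vnorm_ge_coord) auto
    finally show ?thesis by (simp add: sum_distrib_left mult.commute)
  qed
  have "vnorm (A *v v) \<le> (\<Sum>j\<in>(UNIV::'d set). (\<Sum>i\<in>UNIV. vnorm (A *v axis i 1)) * vnorm v)"
    by (rule order_trans[OF vnorm_le_sum sum_mono]) (rule *)
  then show ?thesis by (simp add: mult.assoc)
qed

lemma vnorm_axis_1: "vnorm (axis i 1 :: 'k::local_field^'d) \<le> real CARD('d)"
proof -
  have "vnorm (axis i 1 :: 'k^'d) \<le> (\<Sum>j\<in>(UNIV::'d set). absval ((axis i 1 :: 'k^'d) $ j))"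
    by (rule vnorm_le_sum)
  also have "\<dots> \<le> (\<Sum>j\<in>(UNIV::'d set). 1)" by (intro sum_mono) (auto simp: axis_def)
  finally show ?thesis by simp
qed

lemma
  fixes g :: "'k::local_field^'d^'d"
  shows vnorm_le_opnorm: "vnorm (g *v v) \<le> opnorm g * vnorm v"
    and opnorm_nonneg [simp]: "opnorm g \<ge> 0"
    and opnorm_ge_ratio: "vnorm (g *v v) / vnorm v \<le> opnorm g"
    and opnorm_le_basis: "opnorm g \<le> real CARD('d) * (\<Sum>i\<in>UNIV. vnorm (g *v axis i 1))"
proof -
  let ?C = "real CARD('d) * (\<Sum>i\<in>UNIV. vnorm (g *v axis i 1))"
  have C: "?C \<ge> 0" by (intro mult_nonneg_nonneg sum_nonneg) auto
  have b: "vnorm (g *v v) / vnorm v \<le> ?C" for v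
  proof (cases "v = 0")
    case False
    then show ?thesis using vnorm_mult_le_basis[of g v] by (simp add: divide_simps less_le)
  qed (use C in simp)
  then have bdd: "bdd_above (range (\<lambda>v. vnorm (g *v v) / vnorm v))" by (auto intro!: bdd_aboveI)
  show r: "vnorm (g *v v) / vnorm v \<le> opnorm g" for v
    unfolding opnorm_def by (rule cSUP_upper[OF _ bdd]) simp
  show "opnorm g \<le> ?C" unfolding opnorm_def by (rule cSUP_least) (use b in auto)
  show "opnorm g \<ge> 0" using r[of 0] by simp
  show "vnorm (g *v v) \<le> opnorm g * vnorm v"
  proof (cases "v = 0")
    case False
    then have "vnorm v > 0" by simp
    then show ?thesis using r[of v] by (simp add: divide_simps)
  qed simp
qed

lemma opnorm_leI:
  fixes g :: "'k::local_field^'d^'d"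
  assumes "\<And>v. vnorm (g *v v) \<le> c * vnorm v" "c \<ge> 0" shows "opnorm g \<le> c"
  unfolding opnorm_def
proof (rule cSUP_least)
  fix v :: "'k^'d"
  show "vnorm (g *v v) / vnorm v \<le> c"
  proof (cases "v = 0")
    case False
    then have "vnorm v > 0" by simp
    then show ?thesis using assms(1)[of v] by (simp add: divide_simps)
  qed (use assms in simp)
qed simp

lemma opnorm_mult: "opnorm (g ** h) \<le> opnorm g * opnorm (h::'k::local_field^'d^'d)"
proof (rule opnorm_leI)
  fix v :: "'k^'d"
  have "vnorm ((g ** h) *v v) \<le> opnorm g * vnorm (h *v v)"
    by (metis matrix_vector_mul_assoc vnorm_le_opnorm)
  also have "\<dots> \<le> opnorm g * (opnorm h * vnorm v)" by (intro mult_left_mono vnorm_le_opnorm) simp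
  finally show "vnorm ((g ** h) *v v) \<le> opnorm g * opnorm h * vnorm v" by (simp add: mult.assoc)
qed simp

lemma opnorm_id: "opnorm (mat 1 :: 'k::local_field^'d^'d) = 1"
proof (rule antisym)
  show "opnorm (mat 1 :: 'k^'d^'d) \<le> 1" by (rule opnorm_leI) auto
  have "axis undefined 1 \<noteq> (0::'k^'d)" by (simp add: axis_eq_0_iff)
  then show "1 \<le> opnorm (mat 1 :: 'k^'d^'d)"
    using opnorm_ge_ratio[of "mat 1" "axis undefined 1 :: 'k^'d"] by simp
qed

lemma invertible_matrix_inv:
  fixes g :: "'k::field^'d^'d"
  assumes "invertible g" shows "g ** matrix_inv g = mat 1" "matrix_inv g ** g = mat 1"
  using someI_ex[OF assms[unfolded invertible_def]] by (auto simp: matrix_inv_def)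

lemma matrix_inv_eqI:
  fixes g :: "'k::field^'d^'d"
  assumes "g ** h = mat 1" "h ** g = mat 1" shows "matrix_inv g = h"
  by (metis assms invertible_def invertible_matrix_inv(1) matrix_mul_assoc matrix_mul_lid matrix_mul_rid)

lemma GL_mult: "g \<in> GL \<Longrightarrow> h \<in> GL \<Longrightarrow> g ** h \<in> GL"
  by (simp add: GL_def invertible_mult)

lemma GL_id [simp]: "mat 1 \<in> (GL :: ('k::local_field^'d^'d) set)"
  by (auto simp: GL_def invertible_def)

lemma GL_inv: "g \<in> GL \<Longrightarrow> matrix_inv g \<in> GL"
  unfolding GL_def by (metis invertible_def invertible_matrix_inv mem_Collect_eq)

lemma GL_mult_inv:
  assumes "g \<in> GL" shows "matrix_inv g *v (g *v v) = v" "g *v (matrix_inv g *v v) = v"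
  using assms by (simp_all add: GL_def matrix_vector_mul_assoc invertible_matrix_inv)

lemma GL_mult_eq_0: "g \<in> GL \<Longrightarrow> g *v v = 0 \<longleftrightarrow> v = 0"
  by (metis GL_mult_inv(1) matrix_vector_mult_0_right)

lemma matrix_inv_mult:
  assumes "g \<in> GL" "h \<in> GL" shows "matrix_inv (g ** h) = matrix_inv h ** matrix_inv g"
proof (rule matrix_inv_eqI)
  have g: "g ** matrix_inv g = mat 1" "matrix_inv g ** g = mat 1"
    and h: "h ** matrix_inv h = mat 1" "matrix_inv h ** h = mat 1"
    using assms by (auto simp: GL_def invertible_matrix_inv)
  have "g ** h ** (matrix_inv h ** matrix_inv g) = g ** (h ** matrix_inv h) ** matrix_inv g"
    by (simp add: matrix_mul_assoc)
  then show "g ** h ** (matrix_inv h ** matrix_inv g) = mat 1" by (simp add: g h)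
  have "matrix_inv h ** matrix_inv g ** (g ** h) = matrix_inv h ** (matrix_inv g ** g) ** h"
    by (simp add: matrix_mul_assoc)
  then show "matrix_inv h ** matrix_inv g ** (g ** h) = mat 1" by (simp add: g h)
qed

lemma Nsize_mult: 
  assumes "g \<in> GL" "h \<in> GL" shows "Nsize (g ** h) \<le> Nsize g * Nsize h"
proof -
  have "opnorm (g ** h) \<le> Nsize g * Nsize h"
    by (rule order_trans[OF opnorm_mult mult_mono]) (auto simp: Nsize_def le_max_iff_disj)
  moreover have "opnorm (matrix_inv (g ** h)) \<le> Nsize h * Nsize g"
    unfolding matrix_inv_mult[OF assms]
    by (rule order_trans[OF opnorm_mult mult_mono]) (auto simp: Nsize_def le_max_iff_disj)
  ultimately show ?thesis by (simp add: Nsize_def mult.commute)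
qed

lemma opnorm_mult_inv_ge_1:
  assumes "g \<in> (GL :: ('k::local_field^'d^'d) set)" shows "1 \<le> opnorm g * opnorm (matrix_inv g)"
  using opnorm_mult[of g "matrix_inv g"] assms by (simp add: GL_def invertible_matrix_inv opnorm_id)

lemma opnorm_pos:
  assumes "g \<in> (GL :: ('k::local_field^'d^'d) set)" shows "0 < opnorm g"
proof -
  have "opnorm g \<noteq> 0" using opnorm_mult_inv_ge_1[OF assms] by auto
  then show ?thesis using opnorm_nonneg[of g] by linarith
qed

lemma Nsize_ge_1:
  assumes "g \<in> (GL :: ('k::local_field^'d^'d) set)" shows "1 \<le> Nsize g"
proof (rule ccontr)
  assume "\<not> ?thesis"
  then have "opnorm g < 1" "opnorm (matrix_inv g) < 1" by (auto simp: Nsize_def)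
  then have "opnorm g * opnorm (matrix_inv g) < 1 * 1" by (intro mult_strict_mono) auto
  then show False using opnorm_mult_inv_ge_1[OF assms] by simp
qed

lemma Nsize_id: "Nsize (mat 1 :: 'k::local_field^'d^'d) = 1"
  using matrix_inv_eqI[of "mat 1 :: 'k^'d^'d" "mat 1"] by (simp add: Nsize_def opnorm_id)

definition lnN :: "'k::local_field^'d^'d \<Rightarrow> real" where "lnN g = ln (Nsize g)"

lemma lnN_nonneg: "g \<in> GL \<Longrightarrow> 0 \<le> lnN g"
  using Nsize_ge_1[of g] by (simp add: lnN_def)

lemma lnN_id [simp]: "lnN (mat 1) = 0" by (simp add: lnN_def Nsize_id)

lemma lnN_mult: "g \<in> GL \<Longrightarrow> h \<in> GL \<Longrightarrow> lnN (g ** h) \<le> lnN g + lnN h"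
  using Nsize_mult[of g h] Nsize_ge_1[of g] Nsize_ge_1[of h] Nsize_ge_1[of "g ** h"] GL_mult[of g h]
  by (simp add: lnN_def flip: ln_mult_pos)

lemma vnorm_le_Nsize: "vnorm (g *v v) \<le> exp (lnN g) * vnorm v" if "g \<in> GL"
proof -
  have "opnorm g \<le> exp (lnN g)" using Nsize_ge_1[OF that] by (simp add: lnN_def Nsize_def)
  then show ?thesis by (rule order_trans[OF vnorm_le_opnorm mult_right_mono]) simp
qed

lemma abs_ln_opnorm: "\<bar>ln (opnorm g)\<bar> \<le> lnN g" if "g \<in> GL"
proof -
  have "ln (opnorm g) \<le> lnN g" using opnorm_pos[OF that] Nsize_ge_1[OF that]
    by (simp add: lnN_def Nsize_def)
  moreover have "ln (opnorm (matrix_inv g)) \<le> lnN g"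
    using opnorm_pos[OF GL_inv[OF that]] Nsize_ge_1[OF that] by (simp add: lnN_def Nsize_def)
  moreover have "0 \<le> ln (opnorm g) + ln (opnorm (matrix_inv g))"
    using opnorm_mult_inv_ge_1[OF that] opnorm_pos[OF that] opnorm_pos[OF GL_inv[OF that]]
    by (simp flip: ln_mult_pos)
  ultimately show ?thesis by linarith
qed

section \<open>Convolution powers\<close>

lemma space_borel_GL [simp]: "space borel_GL = GL" by (simp add: borel_GL_def space_restrict_space)

lemma sets_GL_Collect: "Measurable.pred borel_GL A \<Longrightarrow> {g\<in>GL. A g} \<in> sets borel_GL"
  by (drule predE) simp

lemma measurable_borel_GL [measurable (raw)]: "f \<in> borel_measurable borel \<Longrightarrow> f \<in> borel_measurable borel_GL"
  unfolding borel_GL_def by (rule measurable_restrict_space1)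

lemma measurable_id_borel_GL: "(\<lambda>g. g) \<in> borel_GL \<rightarrow>\<^sub>M borel"
  by (rule measurable_borel_GL) simp

lemma measurable_matrix_mult [measurable (raw)]:
  fixes f g :: "'a \<Rightarrow> 'k::local_field^'d^'d"
  assumes "f \<in> M \<rightarrow>\<^sub>M borel_GL" "g \<in> M \<rightarrow>\<^sub>M borel_GL"
  shows "(\<lambda>x. f x ** g x) \<in> M \<rightarrow>\<^sub>M borel_GL"
proof -
  have fg: "f \<in> borel_measurable M" "g \<in> borel_measurable M"
    using assms[THEN measurable_compose[OF _ measurable_id_borel_GL]] by auto
  have "(\<lambda>x. f x ** g x) \<in> borel_measurable M"
    using fg by (rule borel_measurable_continuous_Pair) (intro continuous_intros)
  then show ?thesis
    unfolding borel_GL_def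
    by (rule measurable_restrict_space2[rotated])
      (use assms[THEN measurable_space] in \<open>auto intro: GL_mult\<close>)
qed

lemma measurable_matrix_vector_mult [measurable (raw)]:
  fixes f :: "'a \<Rightarrow> 'k::local_field^'d^'d"
  assumes "f \<in> M \<rightarrow>\<^sub>M borel_GL" "g \<in> borel_measurable M"
  shows "(\<lambda>x. f x *v g x) \<in> borel_measurable M"
proof -
  have f: "f \<in> borel_measurable M"
    using assms(1)[THEN measurable_compose[OF _ measurable_id_borel_GL]] by auto
  show ?thesis
    using f assms(2) by (rule borel_measurable_continuous_Pair) (intro continuous_intros)
qed

lemma borel_measurable_vnorm [measurable]: "vnorm \<in> borel_measurable borel"
  by (intro borel_measurable_continuous_onI continuous_intros)

text \<open>As a supremum of continuous functions, the operator norm is lower semicontinuous.\<close>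
lemma borel_measurable_opnorm [measurable]: "opnorm \<in> borel_measurable (borel :: ('k::local_field^'d^'d) measure)"
proof (rule borel_measurableI_greater)
  fix a
  have "open {g :: 'k^'d^'d. \<exists>v. vnorm (g *v v) / vnorm v > a}"
  proof -
    have "open {g :: 'k^'d^'d. vnorm (g *v v) / vnorm v > a}" for v
    proof (cases "v = 0")
      case False
      then show ?thesis by (intro open_Collect_less continuous_intros) auto
    qed simp
    then have "open (\<Union>v. {g :: 'k^'d^'d. vnorm (g *v v) / vnorm v > a})" by blast
    then show ?thesis by (simp add: Collect_ex_eq)
  qed
  moreover have "opnorm g > a \<longleftrightarrow> (\<exists>v. vnorm (g *v v) / vnorm v > a)" for g :: "'k^'d^'d"
  proof
    show "\<exists>v. vnorm (g *v v) / vnorm v > a" if "opnorm g > a"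
    proof (rule ccontr)
      assume "\<not> ?thesis"
      then have "opnorm g \<le> a" unfolding opnorm_def by (intro cSUP_least) (auto simp: not_less)
      then show False using that by simp
    qed
    show "opnorm g > a" if "\<exists>v. vnorm (g *v v) / vnorm v > a"
      using that opnorm_ge_ratio[of g] by (auto intro: less_le_trans)
  qed
  ultimately show "{x \<in> space borel. a < opnorm (x :: 'k^'d^'d)} \<in> sets borel" by simp
qed

lemma sets_mult_convolution [simp, measurable_cong]: "sets (mult_convolution M N) = sets borel_GL"
  by (simp add: mult_convolution_def)

lemma measurable_mult_pair:
  fixes M N :: "('k::local_field^'d^'d) measure"
  assumes [measurable_cong]: "sets M = sets borel_GL" "sets N = sets borel_GL"
  shows "(\<lambda>(g, h). g ** h) \<in> M \<Otimes>\<^sub>M N \<rightarrow>\<^sub>M borel_GL"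
  by measurable

lemma prob_space_mult_convolution:
  fixes M N :: "('k::local_field^'d^'d) measure"
  assumes "sets M = sets borel_GL" "sets N = sets borel_GL" "prob_space M" "prob_space N"
  shows "prob_space (mult_convolution M N)"
proof -
  interpret pair_prob_space M N by (simp add: pair_prob_space_def assms pair_sigma_finite_def prob_space_imp_sigma_finite)
  show ?thesis unfolding mult_convolution_def by (rule prob_space_distr) (rule measurable_mult_pair[OF assms(1,2)])
qed

lemma nn_integral_mult_convolution:
  fixes M N :: "('k::local_field^'d^'d) measure"
  assumes [measurable_cong]: "sets M = sets borel_GL" "sets N = sets borel_GL" and "prob_space M" "prob_space N"
    and [measurable]: "F \<in> borel_measurable borel_GL"
  shows "(\<integral>\<^sup>+x. F x \<partial>mult_convolution M N) = (\<integral>\<^sup>+g. \<integral>\<^sup>+h. F (g ** h) \<partial>N \<partial>M)"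
    and "(\<integral>\<^sup>+x. F x \<partial>mult_convolution M N) = (\<integral>\<^sup>+h. \<integral>\<^sup>+g. F (g ** h) \<partial>M \<partial>N)"
proof -
  interpret pair_prob_space M N by (simp add: pair_prob_space_def assms pair_sigma_finite_def prob_space_imp_sigma_finite)
  have "(\<integral>\<^sup>+x. F x \<partial>mult_convolution M N) = (\<integral>\<^sup>+x. F (fst x ** snd x) \<partial>(M \<Otimes>\<^sub>M N))"
    unfolding mult_convolution_def by (subst nn_integral_distr) (auto simp: case_prod_beta')
  then show "(\<integral>\<^sup>+x. F x \<partial>mult_convolution M N) = (\<integral>\<^sup>+g. \<integral>\<^sup>+h. F (g ** h) \<partial>N \<partial>M)"
    by (subst (asm) M2.nn_integral_fst[symmetric]) auto
  then show "(\<integral>\<^sup>+x. F x \<partial>mult_convolution M N) = (\<integral>\<^sup>+h. \<integral>\<^sup>+g. F (g ** h) \<partial>M \<partial>N)"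
    by (subst Fubini') auto
qed

lemma mult_convolution_assoc:
  fixes L M N :: "('k::local_field^'d^'d) measure"
  assumes [measurable_cong]: "sets L = sets borel_GL" "sets M = sets borel_GL" "sets N = sets borel_GL"
    and ps: "prob_space L" "prob_space M" "prob_space N"
  shows "mult_convolution L (mult_convolution M N) = mult_convolution (mult_convolution L M) N"
proof (rule measure_eqI)
  fix A assume "A \<in> sets (mult_convolution L (mult_convolution M N))"
  then have [measurable]: "A \<in> sets borel_GL" by simp
  interpret N: prob_space N by fact
  note * = nn_integral_mult_convolution(1) prob_space_mult_convolution assms
  have space [simp]: "space L = GL" using sets_eq_imp_space_eq[OF assms(1)] by simp
  have [measurable]: "(\<lambda>h. g ** h) \<in> borel_GL \<rightarrow>\<^sub>M borel_GL" if "g \<in> GL" for g :: "'k^'d^'d"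
    by (rule measurable_matrix_mult) (auto simp: that)
  have "emeasure (mult_convolution L (mult_convolution M N)) A
      = (\<integral>\<^sup>+x. indicator A x \<partial>mult_convolution L (mult_convolution M N))" by simp
  also have "\<dots> = (\<integral>\<^sup>+g. \<integral>\<^sup>+x. indicator A (g ** x) \<partial>mult_convolution M N \<partial>L)"
    by (rule nn_integral_mult_convolution(1)) (auto simp: assms prob_space_mult_convolution)
  also have "\<dots> = (\<integral>\<^sup>+g. \<integral>\<^sup>+h. \<integral>\<^sup>+k. indicator A (g ** (h ** k)) \<partial>N \<partial>M \<partial>L)"
  proof (rule nn_integral_cong)
    fix g assume "g \<in> space L"
    then have g: "g \<in> GL" by simp
    then have "(\<lambda>x. indicator A (g ** x) :: ennreal) \<in> borel_measurable borel_GL" by measurable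
    then show "(\<integral>\<^sup>+x. indicator A (g ** x) \<partial>mult_convolution M N) =
        (\<integral>\<^sup>+h. \<integral>\<^sup>+k. indicator A (g ** (h ** k)) \<partial>N \<partial>M)"
      by (intro nn_integral_mult_convolution(1) assms)
  qed
  also have "\<dots> = (\<integral>\<^sup>+g. \<integral>\<^sup>+h. \<integral>\<^sup>+k. indicator A (g ** h ** k) \<partial>N \<partial>M \<partial>L)"
    by (simp add: matrix_mul_assoc)
  also have "\<dots> = (\<integral>\<^sup>+g. \<integral>\<^sup>+k. indicator A (g ** k) \<partial>N \<partial>mult_convolution L M)"
  proof (rule nn_integral_mult_convolution(1)[symmetric])
    show "(\<lambda>g. \<integral>\<^sup>+k. indicator A (g ** k) \<partial>N) \<in> borel_measurable borel_GL" by measurable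
  qed (auto simp: assms)
  also have "\<dots> = (\<integral>\<^sup>+x. indicator A x \<partial>mult_convolution (mult_convolution L M) N)"
    by (rule nn_integral_mult_convolution(1)[symmetric]) (auto simp: assms prob_space_mult_convolution)
  finally show "emeasure (mult_convolution L (mult_convolution M N)) A =
      emeasure (mult_convolution (mult_convolution L M) N) A" by simp
qed simp

lemma mult_convolution_return:
  fixes N :: "('k::local_field^'d^'d) measure"
  assumes [measurable_cong]: "sets N = sets borel_GL" and "prob_space N"
  shows "mult_convolution (return borel_GL (mat 1)) N = N"
proof (rule measure_eqI)
  fix A assume "A \<in> sets (mult_convolution (return borel_GL (mat 1)) N)"
  then have [measurable]: "A \<in> sets borel_GL" by simp
  interpret N: prob_space N by fact
  have "emeasure (mult_convolution (return borel_GL (mat 1)) N) A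
      = (\<integral>\<^sup>+x. indicator A x \<partial>mult_convolution (return borel_GL (mat 1)) N)" by simp
  also have "\<dots> = (\<integral>\<^sup>+g. \<integral>\<^sup>+h. indicator A (g ** h) \<partial>N \<partial>return borel_GL (mat 1))"
    by (rule nn_integral_mult_convolution(1)) (auto simp: assms prob_space_return)
  also have "\<dots> = (\<integral>\<^sup>+h. indicator A (mat 1 ** h) \<partial>N)"
    by (rule nn_integral_return) (simp, measurable)
  also have "\<dots> = emeasure N A" by (simp add: assms)
  finally show "emeasure (mult_convolution (return borel_GL (mat 1)) N) A = emeasure N A" .
qed (simp add: assms)

lemma mult_convolution_return_right:
  fixes N :: "('k::local_field^'d^'d) measure"
  assumes [measurable_cong]: "sets N = sets borel_GL" and "prob_space N"
  shows "mult_convolution N (return borel_GL (mat 1)) = N"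
proof (rule measure_eqI)
  fix A assume "A \<in> sets (mult_convolution N (return borel_GL (mat 1)))"
  then have [measurable]: "A \<in> sets borel_GL" by simp
  have [measurable]: "(\<lambda>g. g ** mat 1) \<in> borel_GL \<rightarrow>\<^sub>M (borel_GL :: ('k^'d^'d) measure)"
    by (rule measurable_matrix_mult) auto
  interpret N: prob_space N by fact
  have "emeasure (mult_convolution N (return borel_GL (mat 1))) A
      = (\<integral>\<^sup>+x. indicator A x \<partial>mult_convolution N (return borel_GL (mat 1)))" by simp
  also have "\<dots> = (\<integral>\<^sup>+h. \<integral>\<^sup>+g. indicator A (g ** h) \<partial>N \<partial>return borel_GL (mat 1))"
    by (rule nn_integral_mult_convolution(2)) (auto simp: assms prob_space_return)
  also have "\<dots> = (\<integral>\<^sup>+g. indicator A (g ** mat 1) \<partial>N)"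
    by (rule nn_integral_return) (simp, measurable)
  also have "\<dots> = emeasure N A" by (simp add: assms)
  finally show "emeasure (mult_convolution N (return borel_GL (mat 1))) A = emeasure N A" .
qed (simp add: assms)

text \<open>The moment assumption also provides the measurability of \<open>lnN\<close>, which its definition through the
  inverse matrix leaves open.\<close>
locale random_walk =
  fixes \<mu> :: "('k::local_field^'d^'d) measure" and p :: real
  assumes p_gt_1: "p > 1" and prob_space_\<mu>: "prob_space \<mu>"
    and sets_\<mu> [simp, measurable_cong]: "sets \<mu> = sets borel_GL"
    and moment: "integrable \<mu> (\<lambda>g. lnN g powr p)"
begin

sublocale \<mu>: prob_space \<mu> by (rule prob_space_\<mu>)

abbreviation M :: "nat \<Rightarrow> ('k^'d^'d) measure" where "M \<equiv> conv_power \<mu>"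

lemma space_\<mu> [simp]: "space \<mu> = GL"
  using sets_eq_imp_space_eq[OF sets_\<mu>] by simp

lemma sets_M [simp, measurable_cong]: "sets (M n) = sets borel_GL"
  by (cases n) auto

lemma space_M [simp]: "space (M n) = GL"
  using sets_eq_imp_space_eq[OF sets_M] by simp

lemma prob_space_M: "prob_space (M n)"
  by (induction n) (auto intro: prob_space_return prob_space_mult_convolution prob_space_\<mu>)

lemma prob_GL [simp]: "measure (M n) GL = 1" "measure \<mu> GL = 1"
  using prob_space.prob_space[OF prob_space_M, of n] \<mu>.prob_space by simp_all

lemma M_1: "M (Suc 0) = \<mu>"
  using prob_space_\<mu> by (simp add: mult_convolution_return_right)

lemma M_add: "M (n + k) = mult_convolution (M n) (M k)"
proof (induction n)
  case 0
  show ?case by (simp add: mult_convolution_return prob_space_M)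
next
  case (Suc n)
  then show ?case by (simp add: mult_convolution_assoc prob_space_M prob_space_\<mu>)
qed

lemma nn_integral_M_add:
  assumes "F \<in> borel_measurable borel_GL"
  shows "(\<integral>\<^sup>+x. F x \<partial>M (n + k)) = (\<integral>\<^sup>+h. \<integral>\<^sup>+g. F (g ** h) \<partial>M n \<partial>M k)"
  unfolding M_add using assms by (intro nn_integral_mult_convolution) (auto simp: prob_space_M)

lemma integrable_M_add:
  fixes F :: "_ \<Rightarrow> real"
  assumes [measurable]: "F \<in> borel_measurable borel_GL"
  shows "integrable (M (n + k)) F \<longleftrightarrow> integrable (M n \<Otimes>\<^sub>M M k) (\<lambda>x. F (fst x ** snd x))"
  unfolding M_add mult_convolution_def
  by (subst integrable_distr_eq) (auto simp: case_prod_beta')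

lemma integral_M_add:
  fixes F :: "_ \<Rightarrow> real"
  assumes F: "integrable (M (n + k)) F"
  shows "(\<integral>x. F x \<partial>M (n + k)) = (\<integral>h. \<integral>g. F (g ** h) \<partial>M n \<partial>M k)"
    and "integrable (M k) (\<lambda>h. \<integral>g. F (g ** h) \<partial>M n)"
proof -
  have [measurable]: "F \<in> borel_measurable borel_GL"
    using borel_measurable_integrable[OF F] by simp
  interpret pair_prob_space "M n" "M k"
    by (simp add: pair_prob_space_def pair_sigma_finite_def prob_space_imp_sigma_finite prob_space_M)
  have int: "integrable (M n \<Otimes>\<^sub>M M k) (\<lambda>x. F (fst x ** snd x))"
    using F integrable_M_add[of F n k] by simp
  have "(\<integral>x. F x \<partial>M (n + k)) = (\<integral>x. F (fst x ** snd x) \<partial>(M n \<Otimes>\<^sub>M M k))"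
    unfolding M_add mult_convolution_def by (subst integral_distr) (auto simp: case_prod_beta')
  then show "(\<integral>x. F x \<partial>M (n + k)) = (\<integral>h. \<integral>g. F (g ** h) \<partial>M n \<partial>M k)"
    using integral_snd[of "\<lambda>g h. F (g ** h)"] int by (simp add: case_prod_beta')
  show "integrable (M k) (\<lambda>h. \<integral>g. F (g ** h) \<partial>M n)"
    using integrable_snd[of "\<lambda>g h. F (g ** h)"] int by (simp add: case_prod_beta')
qed

lemma borel_measurable_lnN [measurable]: "lnN \<in> borel_measurable (borel_GL :: ('k^'d^'d) measure)"
proof -
  have [measurable]: "(\<lambda>g. lnN g powr p) \<in> borel_measurable (borel_GL :: ('k^'d^'d) measure)"
    using borel_measurable_integrable[OF moment] unfolding measurable_cong_sets[OF sets_\<mu> refl] .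
  have "(\<lambda>g. (lnN g powr p) powr (1 / p)) \<in> borel_measurable (borel_GL :: ('k^'d^'d) measure)" by measurable
  then show ?thesis
    by (rule measurable_cong[THEN iffD1, rotated]) (use p_gt_1 in \<open>auto simp: powr_powr lnN_nonneg\<close>)
qed

lemma integrable_lnN_\<mu>: "integrable \<mu> lnN"
proof (rule Bochner_Integration.integrable_bound)
  show "integrable \<mu> (\<lambda>g. 1 + lnN g powr p)" using moment by simp
  show "AE g in \<mu>. norm (lnN g) \<le> norm (1 + lnN g powr p)"
  proof (rule AE_I2)
    fix g assume "g \<in> space \<mu>"
    then have 0: "lnN g \<ge> 0" by (simp add: lnN_nonneg)
    show "norm (lnN g) \<le> norm (1 + lnN g powr p)"
    proof (cases "lnN g \<le> 1")
      case False
      then have "lnN g powr 1 \<le> lnN g powr p" using p_gt_1 by (intro powr_mono) auto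
      then show ?thesis using False by simp
    qed (use 0 in \<open>simp add: add_increasing2\<close>)
  qed
qed simp

text \<open>The positive part of \<open>lnN - n * L\<close> is subadditive along products, so that large values of
  \<open>lnN\<close> contribute at most linearly in \<open>n\<close>.\<close>
lemma nn_integral_lnN_excess:
  "(\<integral>\<^sup>+g. ennreal (lnN g - real n * L) \<partial>M n) \<le> of_nat n * (\<integral>\<^sup>+g. ennreal (lnN g - L) \<partial>\<mu>)"
proof (induction n)
  case 0
  show ?case by (simp add: nn_integral_return)
next
  case (Suc n)
  interpret Mn: prob_space "M n" by (rule prob_space_M)
  have "(\<integral>\<^sup>+g. ennreal (lnN g - real (Suc n) * L) \<partial>M (Suc n))
      = (\<integral>\<^sup>+g. \<integral>\<^sup>+h. ennreal (lnN (g ** h) - real (Suc n) * L) \<partial>M n \<partial>\<mu>)"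
    unfolding conv_power.simps
    by (rule nn_integral_mult_convolution(1)) (auto simp: prob_space_M prob_space_\<mu>)
  also have "\<dots> \<le> (\<integral>\<^sup>+g. \<integral>\<^sup>+h. ennreal (lnN g - L) + ennreal (lnN h - real n * L) \<partial>M n \<partial>\<mu>)"
  proof (intro nn_integral_mono)
    fix g h assume "g \<in> space \<mu>" "h \<in> space (M n)"
    then have "lnN (g ** h) \<le> lnN g + lnN h" by (simp add: lnN_mult)
    then have "ennreal (lnN (g ** h) - real (Suc n) * L) \<le> ennreal (max 0 (lnN g - L) + max 0 (lnN h - real n * L))"
      by (intro ennreal_leI) (auto simp: algebra_simps max_def)
    also have "\<dots> = ennreal (lnN g - L) + ennreal (lnN h - real n * L)"
      by (subst ennreal_plus) (auto simp: max_def ennreal_neg)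
    finally show "ennreal (lnN (g ** h) - real (Suc n) * L) \<le> ennreal (lnN g - L) + ennreal (lnN h - real n * L)" .
  qed
  also have "\<dots> = (\<integral>\<^sup>+g. ennreal (lnN g - L) \<partial>\<mu>) + (\<integral>\<^sup>+h. ennreal (lnN h - real n * L) \<partial>M n)"
    by (simp add: nn_integral_add Mn.emeasure_space_1 \<mu>.emeasure_space_1 del: space_M space_\<mu>)
  also have "\<dots> \<le> (\<integral>\<^sup>+g. ennreal (lnN g - L) \<partial>\<mu>) + of_nat n * (\<integral>\<^sup>+g. ennreal (lnN g - L) \<partial>\<mu>)"
    by (intro add_left_mono Suc)
  finally show ?case by (simp add: algebra_simps)
qed

definition mean_lnN :: real where "mean_lnN = (\<integral>g. lnN g \<partial>\<mu>)"

lemma mean_lnN_nonneg: "mean_lnN \<ge> 0"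
proof -
  have "AE g in \<mu>. 0 \<le> lnN g" by (rule AE_I2) (simp add: lnN_nonneg)
  then show ?thesis unfolding mean_lnN_def by (rule integral_nonneg_AE)
qed

lemma integrable_lnN: "integrable (M n) lnN" and integral_lnN_le: "(\<integral>g. lnN g \<partial>M n) \<le> real n * mean_lnN"
proof -
  have "(\<integral>\<^sup>+g. ennreal (lnN g) \<partial>\<mu>) = ennreal mean_lnN"
    unfolding mean_lnN_def by (rule nn_integral_eq_integral[OF integrable_lnN_\<mu>], rule AE_I2) (simp add: lnN_nonneg)
  then have le: "(\<integral>\<^sup>+g. ennreal (lnN g) \<partial>M n) \<le> ennreal (real n * mean_lnN)"
    using nn_integral_lnN_excess[of n 0] mean_lnN_nonneg by (simp add: ennreal_mult ennreal_of_nat_eq_real_of_nat)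
  show int: "integrable (M n) lnN"
  proof (rule integrableI_bounded)
    have "(\<integral>\<^sup>+g. ennreal (norm (lnN g)) \<partial>M n) = (\<integral>\<^sup>+g. ennreal (lnN g) \<partial>M n)"
      by (intro nn_integral_cong) (simp add: lnN_nonneg)
    also have "\<dots> < \<infinity>" using le by (simp add: le_less_trans)
    finally show "(\<integral>\<^sup>+g. ennreal (norm (lnN g)) \<partial>M n) < \<infinity>" .
  qed simp
  have "(\<integral>\<^sup>+g. ennreal (lnN g) \<partial>M n) = ennreal (\<integral>g. lnN g \<partial>M n)"
    by (rule nn_integral_eq_integral[OF int], rule AE_I2) (simp add: lnN_nonneg)
  then show "(\<integral>g. lnN g \<partial>M n) \<le> real n * mean_lnN"
    using le mean_lnN_nonneg by (simp add: ennreal_le_iff)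
qed

lemma excess_tendsto_0: "(\<lambda>L. \<integral>g. max 0 (lnN g - real L) \<partial>\<mu>) \<longlonglongrightarrow> 0"
proof -
  have "(\<lambda>L. \<integral>g. max 0 (lnN g - real L) \<partial>\<mu>) \<longlonglongrightarrow> (\<integral>g. 0 \<partial>\<mu>)"
  proof (rule integral_dominated_convergence[where w = lnN])
    show "AE g in \<mu>. (\<lambda>L. max 0 (lnN g - real L)) \<longlonglongrightarrow> 0"
    proof (rule AE_I2)
      fix g
      obtain L0 :: nat where "lnN g \<le> real L0" using real_arch_simple by blast
      then have "eventually (\<lambda>L. max 0 (lnN g - real L) = 0) sequentially"
        unfolding eventually_sequentially by (intro exI[of _ L0]) auto
      then show "(\<lambda>L. max 0 (lnN g - real L)) \<longlonglongrightarrow> 0" by (rule tendsto_eventually)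
    qed
    show "AE g in \<mu>. norm (max 0 (lnN g - real L)) \<le> lnN g" for L
      by (rule AE_I2) (auto simp: lnN_nonneg)
  qed (auto simp: integrable_lnN_\<mu>)
  then show ?thesis by simp
qed

text \<open>The functions \<open>lnN / n\<close> are uniformly integrable for the laws \<open>M n\<close>: the part of \<open>lnN\<close> above
  the level \<open>n * L\<close> contributes at most \<open>n\<close> times the one-step excess over \<open>L\<close>. Hence an upper bound
  that holds with probability close to one also bounds the mean.\<close>
lemma mean_le_of_probable_bound:
  fixes a b \<eta> :: real
  assumes "\<eta> > 0"
  shows "\<exists>\<delta>>0. \<forall>n B F c. B \<in> sets borel_GL \<longrightarrow> measure (M n) B \<le> \<delta> \<longrightarrow> integrable (M n) F \<longrightarrow>
      (AE g in M n. F g \<le> a * real n + c + lnN g) \<longrightarrow> (AE g in M n. g \<notin> B \<longrightarrow> F g \<le> b * real n + c) \<longrightarrow>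
      (\<integral>g. F g \<partial>M n) \<le> (b + \<eta>) * real n + c"
proof -
  obtain L where L: "(\<integral>g. max 0 (lnN g - real L) \<partial>\<mu>) < \<eta> / 2"
  proof -
    have "eventually (\<lambda>L. (\<integral>g. max 0 (lnN g - real L) \<partial>\<mu>) < \<eta> / 2) sequentially"
      by (rule order_tendstoD(2)[OF excess_tendsto_0]) (use assms in simp)
    then show ?thesis using that by (auto simp: eventually_sequentially)
  qed
  have intL: "integrable N (\<lambda>g. max 0 (lnN g - c))" if "integrable N lnN" "sets N = sets borel_GL" "c \<ge> 0" for N and c :: real
  proof (rule Bochner_Integration.integrable_bound[OF that(1)])
    show "(\<lambda>g. max 0 (lnN g - c)) \<in> borel_measurable N"
      using borel_measurable_integrable[OF that(1)] by measurable
    have "space N = GL" using sets_eq_imp_space_eq[OF that(2)] by simp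
    then show "AE g in N. norm (max 0 (lnN g - c)) \<le> norm (lnN g)"
      using that(3) by (intro AE_I2) (auto simp: lnN_nonneg)
  qed
  have ennreal_max: "ennreal (max 0 x) = ennreal x" for x by (auto simp: max_def ennreal_neg)
  have excess: "(\<integral>g. max 0 (lnN g - real n * real L) \<partial>M n) \<le> real n * (\<integral>g. max 0 (lnN g - real L) \<partial>\<mu>)" for n
  proof -
    have "ennreal (\<integral>g. max 0 (lnN g - real n * real L) \<partial>M n) = (\<integral>\<^sup>+g. ennreal (lnN g - real n * real L) \<partial>M n)"
      by (subst nn_integral_eq_integral[symmetric]) (auto simp: ennreal_max intro!: intL integrable_lnN)
    also have "\<dots> \<le> of_nat n * (\<integral>\<^sup>+g. ennreal (lnN g - real L) \<partial>\<mu>)" by (rule nn_integral_lnN_excess)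
    also have "(\<integral>\<^sup>+g. ennreal (lnN g - real L) \<partial>\<mu>) = ennreal (\<integral>g. max 0 (lnN g - real L) \<partial>\<mu>)"
      by (subst nn_integral_eq_integral[symmetric]) (auto simp: ennreal_max intro!: intL integrable_lnN_\<mu>)
    also have "of_nat n * \<dots> = ennreal (real n * (\<integral>g. max 0 (lnN g - real L) \<partial>\<mu>))"
      by (simp add: ennreal_mult ennreal_of_nat_eq_real_of_nat)
    finally show ?thesis by (subst (asm) ennreal_le_iff) auto
  qed
  define k where "k = \<bar>a - b + real L\<bar>"
  define \<delta> where "\<delta> = \<eta> / (2 * (k + 1))"
  have k: "k + 1 > 0" by (simp add: k_def add_nonneg_pos)
  show ?thesis
  proof (rule exI[of _ \<delta>], intro conjI allI impI)
    show "\<delta> > 0" using assms k by (simp add: \<delta>_def)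
    fix n B and F :: "'k^'d^'d \<Rightarrow> real" and c
    assume B: "B \<in> sets borel_GL" and PB: "measure (M n) B \<le> \<delta>" and F: "integrable (M n) F"
      and F1: "AE g in M n. F g \<le> a * real n + c + lnN g" and F2: "AE g in M n. g \<notin> B \<longrightarrow> F g \<le> b * real n + c"
    interpret Mn: prob_space "M n" by (rule prob_space_M)
    have [simp]: "B \<inter> GL = B" using sets.sets_into_space[OF B] by auto
    have intB: "integrable (M n) (indicator B :: _ \<Rightarrow> real)"
      using B by (intro integrable_real_indicator) (auto simp: Mn.emeasure_finite simp flip: less_top)
    let ?E = "\<lambda>g. max 0 (lnN g - real n * real L)"
    let ?R = "\<lambda>g. (b * real n + c) + k * real n * indicator B g + ?E g"
    have intE: "integrable (M n) ?E" by (intro intL integrable_lnN) auto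
    have "(\<integral>g. F g \<partial>M n) \<le> (\<integral>g. ?R g \<partial>M n)"
    proof (rule integral_mono_AE[OF F])
      show "integrable (M n) ?R" using intB intE by simp
      have "(a - b + real L) * real n \<le> k * real n" by (intro mult_right_mono) (auto simp: k_def)
      then have *: "a * real n + x \<le> b * real n + k * real n + max 0 (x - real n * real L)" for x
        by (simp add: algebra_simps)
      show "AE g in M n. F g \<le> ?R g"
        using F1 F2
      proof eventually_elim
        case (elim g)
        then show ?case using *[of "lnN g"] by (cases "g \<in> B") auto
      qed
    qed
    also have "\<dots> = b * real n + c + k * real n * measure (M n) B + (\<integral>g. ?E g \<partial>M n)"
      using intB intE by simp
    also have "\<dots> \<le> b * real n + c + \<eta> / 2 * real n + \<eta> / 2 * real n"
    proof (intro add_mono order_refl)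
      have "k * measure (M n) B \<le> (k + 1) * \<delta>" using PB by (intro mult_mono) (auto simp: k_def)
      also have "\<dots> = \<eta> / 2" using k by (simp add: \<delta>_def field_simps)
      finally have "k * measure (M n) B * real n \<le> \<eta> / 2 * real n" by (intro mult_right_mono) auto
      then show "k * real n * measure (M n) B \<le> \<eta> / 2 * real n" by (simp add: algebra_simps)
      have "(\<integral>g. ?E g \<partial>M n) \<le> real n * (\<eta> / 2)"
        using L by (intro order_trans[OF excess] mult_left_mono) auto
      then show "(\<integral>g. ?E g \<partial>M n) \<le> \<eta> / 2 * real n" by (simp add: mult.commute)
    qed
    also have "\<dots> = (b + \<eta>) * real n + c" by (simp add: algebra_simps)
    finally show "(\<integral>g. F g \<partial>M n) \<le> (b + \<eta>) * real n + c" .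
  qed
qed

lemma AE_M:
  assumes "S \<in> sets borel_GL" "mat 1 \<in> S" "\<And>g h. g \<in> S \<Longrightarrow> h \<in> S \<Longrightarrow> g ** h \<in> S" "AE g in \<mu>. g \<in> S"
  shows "AE g in M n. g \<in> S"
proof (induction n)
  case 0
  note [measurable] = assms(1)
  have "Measurable.pred (borel_GL :: ('k^'d^'d) measure) (\<lambda>g. g \<in> S)" by measurable
  then have "AE g in return borel_GL (mat 1). g \<in> S" using assms(2) by (subst AE_return) auto
  then show ?case by (simp only: conv_power.simps)
next
  case (Suc n)
  note [measurable] = assms(1)
  have *: "(\<integral>\<^sup>+h. indicator (- S) (g ** h) \<partial>M n) = (0::ennreal)" if "g \<in> S" "g \<in> GL" for g
  proof -
    have "AE h in M n. indicator (- S) (g ** h) = (0::ennreal)"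
      using Suc by eventually_elim (use assms(3) that in auto)
    then have "(\<integral>\<^sup>+h. indicator (- S) (g ** h) \<partial>M n) = (\<integral>\<^sup>+h. (0::ennreal) \<partial>M n)"
      by (rule nn_integral_cong_AE)
    then show ?thesis by simp
  qed
  have [measurable]: "(indicator (- S) :: _ \<Rightarrow> ennreal) \<in> borel_measurable (borel_GL :: ('k^'d^'d) measure)"
  proof -
    have "(\<lambda>g. 1 - indicator S g :: real) \<in> borel_measurable (borel_GL :: ('k^'d^'d) measure)" by measurable
    then have "(\<lambda>g. ennreal (1 - indicator S g)) \<in> borel_measurable (borel_GL :: ('k^'d^'d) measure)" by measurable
    also have "(\<lambda>g. ennreal (1 - indicator S g)) = indicator (- S)" by (auto simp: indicator_def fun_eq_iff)
    finally show ?thesis .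
  qed
  have "(\<integral>\<^sup>+x. indicator (- S) x \<partial>M (Suc n)) = (\<integral>\<^sup>+g. \<integral>\<^sup>+h. indicator (- S) (g ** h) \<partial>M n \<partial>\<mu>)"
    unfolding conv_power.simps
    by (rule nn_integral_mult_convolution(1)) (auto simp: prob_space_M prob_space_\<mu>)
  also have "\<dots> = (\<integral>\<^sup>+g. 0 \<partial>\<mu>)"
  proof (rule nn_integral_cong_AE)
    show "AE g in \<mu>. (\<integral>\<^sup>+h. indicator (- S) (g ** h) \<partial>M n) = 0"
      using assms(4) AE_space by eventually_elim (use * in auto)
  qed
  finally have "(\<integral>\<^sup>+x. indicator (- S) x \<partial>M (Suc n)) = 0" by simp
  moreover have "(indicator (- S) :: _ \<Rightarrow> ennreal) \<in> borel_measurable (M (Suc n))" by measurable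
  ultimately have "AE x in M (Suc n). indicator (- S) x = (0::ennreal)"
    using nn_integral_0_iff_AE by blast
  then show ?case by eventually_elim (auto simp: indicator_def split: if_splits)
qed

end

section \<open>Summable rates\<close>

text \<open>Convergence to \<open>0\<close> is part of the notion because the weights themselves tend to \<open>0\<close> if \<open>p < 2\<close>.\<close>
definition summable_rate :: "real \<Rightarrow> (nat \<Rightarrow> real) \<Rightarrow> bool" where
  "summable_rate p C \<longleftrightarrow> (\<forall>n. 0 \<le> C n) \<and> summable (\<lambda>n. real n powr (p - 2) * C n) \<and> C \<longlonglongrightarrow> 0"

lemma summable_rate_add:
  "summable_rate p C \<Longrightarrow> summable_rate p C' \<Longrightarrow> summable_rate p (\<lambda>n. C n + C' n)"
  unfolding summable_rate_def using tendsto_add[of C 0 sequentially C' 0]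
  by (auto simp: algebra_simps intro: summable_add)

lemma summable_rate_0: "summable_rate p (\<lambda>n. 0)"
  by (simp add: summable_rate_def)

lemma summable_rate_sum:
  "finite A \<Longrightarrow> (\<And>i. i \<in> A \<Longrightarrow> summable_rate p (C i)) \<Longrightarrow> summable_rate p (\<lambda>n. \<Sum>i\<in>A. C i n)"
  by (induction A rule: finite_induct) (auto intro: summable_rate_add summable_rate_0)

lemma summable_rate_cong_eventually:
  assumes "summable_rate p C"
  shows "summable_rate p (\<lambda>n. if n < n0 then 1 else C n)"
proof -
  have ev: "eventually (\<lambda>n. (if n < n0 then 1 else C n) = C n) sequentially"
    unfolding eventually_sequentially by (intro exI[of _ n0]) auto
  have "eventually (\<lambda>n. real n powr (p - 2) * (if n < n0 then 1 else C n) = real n powr (p - 2) * C n) sequentially"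
    using ev by eventually_elim simp
  then have "summable (\<lambda>n. real n powr (p - 2) * (if n < n0 then 1 else C n))"
    using assms by (subst summable_cong[where g = "\<lambda>n. real n powr (p - 2) * C n"]) (auto simp: summable_rate_def)
  then show ?thesis
    using assms tendsto_cong[OF ev, of 0] by (auto simp: summable_rate_def)
qed

lemma summable_rate_powr: "p > 1 \<Longrightarrow> c \<ge> 0 \<Longrightarrow> summable_rate p (\<lambda>n. c * real n powr (- p))"
proof -
  assume p: "p > 1" and c: "c \<ge> 0"
  have "summable (\<lambda>n. c * real n powr (-2))" by (intro summable_mult) (simp add: summable_real_powr_iff)
  then have "summable (\<lambda>n. real n powr (p - 2) * (c * real n powr (- p)))"
    by (rule summable_cong[THEN iffD1, rotated]) (auto simp: simp flip: powr_add)
  moreover have "(\<lambda>n. c * real n powr (- p)) \<longlonglongrightarrow> c * 0"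
    using p by (intro tendsto_intros tendsto_neg_powr filterlim_real_sequentially) auto
  ultimately show ?thesis using c by (simp add: summable_rate_def)
qed

text \<open>Summing over \<open>n\<close> before integrating: at most \<open>y\<close> of the integers \<open>n \<ge> 1\<close> lie below
  \<open>y = X / \<delta>\<close>, and each of them contributes at most \<open>y powr (p - 1)\<close>.\<close>
lemma (in prob_space) summable_rate_tail:
  fixes X :: "'a \<Rightarrow> real"
  assumes p: "p > 1" and \<delta>: "\<delta> > 0" and [measurable]: "X \<in> borel_measurable M"
    and X: "\<And>x. x \<in> space M \<Longrightarrow> X x \<ge> 0" and int: "integrable M (\<lambda>x. X x powr p)"
  shows "summable_rate p (\<lambda>n. real n * measure M {x \<in> space M. X x > \<delta> * real n})"
proof -
  have y: "(\<Sum>n<N. real n powr (p - 2) * real n * indicator {x \<in> space M. X x > \<delta> * real n} x) \<le> (X x / \<delta>) powr p"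
    if x: "x \<in> space M" for x N
  proof -
    define y where "y = X x / \<delta>"
    have y0: "y \<ge> 0" using X[OF x] \<delta> by (simp add: y_def)
    have "(\<Sum>n<N. real n powr (p - 2) * real n * indicator {x \<in> space M. X x > \<delta> * real n} x)
        = (\<Sum>n\<in>{n. n < N \<and> 1 \<le> n \<and> real n < y}. real n powr (p - 2) * real n)"
      using x \<delta> by (intro sum.mono_neutral_cong_right) (auto simp: y_def field_simps indicator_def)
    also have "\<dots> \<le> (\<Sum>n\<in>{n. n < N \<and> 1 \<le> n \<and> real n < y}. y powr (p - 1))"
    proof (intro sum_mono)
      fix n assume n: "n \<in> {n. n < N \<and> 1 \<le> n \<and> real n < y}"
      have "real n powr (p - 2) * real n powr 1 = real n powr (p - 1)" by (subst powr_add[symmetric]) simp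
      also have "\<dots> \<le> y powr (p - 1)" using n p by (intro powr_mono2) auto
      finally show "real n powr (p - 2) * real n \<le> y powr (p - 1)" using n by simp
    qed
    also have "\<dots> = real (card {n. n < N \<and> 1 \<le> n \<and> real n < y}) * y powr (p - 1)" by simp
    also have "\<dots> \<le> y * y powr (p - 1)"
    proof (rule mult_right_mono)
      have "card {n. n < N \<and> 1 \<le> n \<and> real n < y} \<le> card {1..nat \<lfloor>y\<rfloor>}"
        using y0 by (intro card_mono) (auto simp: le_nat_floor)
      also have "\<dots> = nat \<lfloor>y\<rfloor>" by simp
      finally show "real (card {n. n < N \<and> 1 \<le> n \<and> real n < y}) \<le> y"
        using y0 by linarith
    qed simp
    also have "\<dots> = y powr p"
    proof (cases "y = 0")
      case False
      have "y powr 1 * y powr (p - 1) = y powr p" by (subst powr_add[symmetric]) simp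
      then show ?thesis using y0 False by simp
    qed simp
    finally show ?thesis by (simp add: y_def)
  qed
  have powr_int: "integrable M (\<lambda>x. (X x / \<delta>) powr p)"
  proof -
    have "integrable M (\<lambda>x. X x powr p / \<delta> powr p)" using int by simp
    then show ?thesis
      by (rule Bochner_Integration.integrable_cong[THEN iffD1, rotated 2]) (use X \<delta> in \<open>auto simp: powr_divide\<close>)
  qed
  have "summable (\<lambda>n. real n powr (p - 2) * (real n * measure M {x \<in> space M. X x > \<delta> * real n}))"
  proof (rule summableI_nonneg_bounded)
    fix N
    have "(\<Sum>n<N. real n powr (p - 2) * (real n * measure M {x \<in> space M. X x > \<delta> * real n}))
        = (\<Sum>n<N. \<integral>x. real n powr (p - 2) * real n * indicator {x \<in> space M. X x > \<delta> * real n} x \<partial>M)"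
      by (intro sum.cong refl) (simp add: mult.assoc)
    also have "\<dots> = (\<integral>x. (\<Sum>n<N. real n powr (p - 2) * real n * indicator {x \<in> space M. X x > \<delta> * real n} x) \<partial>M)"
      by (rule Bochner_Integration.integral_sum[symmetric])
        (intro integrable_mult_right integrable_real_indicator, auto simp: emeasure_finite simp flip: less_top)
    also have "\<dots> \<le> (\<integral>x. (X x / \<delta>) powr p \<partial>M)"
      using y by (intro integral_mono powr_int Bochner_Integration.integrable_sum)
        (auto intro!: integrable_real_indicator simp: emeasure_finite simp flip: less_top)
    finally show "(\<Sum>n<N. real n powr (p - 2) * (real n * measure M {x \<in> space M. X x > \<delta> * real n}))
        \<le> (\<integral>x. (X x / \<delta>) powr p \<partial>M)" .
  qed simp
  moreover have "(\<lambda>n. real n * measure M {x \<in> space M. X x > \<delta> * real n}) \<longlonglongrightarrow> 0"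
  proof (rule tendsto_sandwich)
    show "eventually (\<lambda>n. 0 \<le> real n * measure M {x \<in> space M. X x > \<delta> * real n}) sequentially" by simp
    show "eventually (\<lambda>n. real n * measure M {x \<in> space M. X x > \<delta> * real n}
        \<le> (\<integral>x. (X x / \<delta>) powr p \<partial>M) * real n powr (- (p - 1))) sequentially"
      using eventually_gt_at_top[of 0]
    proof eventually_elim
      case (elim n)
      have "real n powr p * measure M {x \<in> space M. X x > \<delta> * real n}
          = (\<integral>x. real n powr p * indicator {x \<in> space M. X x > \<delta> * real n} x \<partial>M)" by simp
      also have "\<dots> \<le> (\<integral>x. (X x / \<delta>) powr p \<partial>M)"
      proof (intro integral_mono powr_int)
        show "integrable M (\<lambda>x. real n powr p * indicator {x \<in> space M. X x > \<delta> * real n} x)"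
          by (intro integrable_mult_right integrable_real_indicator) (auto simp: emeasure_finite simp flip: less_top)
        fix x assume "x \<in> space M"
        then show "real n powr p * indicator {x \<in> space M. X x > \<delta> * real n} x \<le> (X x / \<delta>) powr p"
          using \<delta> p by (auto simp: indicator_def field_simps intro!: powr_mono2)
      qed
      finally have "real n powr p * measure M {x \<in> space M. X x > \<delta> * real n} \<le> (\<integral>x. (X x / \<delta>) powr p \<partial>M)" .
      then have "real n powr (- (p - 1)) * (real n powr p * measure M {x \<in> space M. X x > \<delta> * real n})
          \<le> real n powr (- (p - 1)) * (\<integral>x. (X x / \<delta>) powr p \<partial>M)" by (intro mult_left_mono) auto
      moreover have "real n powr (- (p - 1)) * real n powr p = real n"
        using elim by (simp flip: powr_add)
      ultimately show ?case by (simp add: mult.commute flip: mult.assoc)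
    qed
    show "(\<lambda>n. (\<integral>x. (X x / \<delta>) powr p \<partial>M) * real n powr (- (p - 1))) \<longlonglongrightarrow> 0"
      using p by (intro tendsto_mult_right_zero tendsto_neg_powr filterlim_real_sequentially) auto
  qed simp
  ultimately show ?thesis by (simp add: summable_rate_def)
qed

text \<open>A second order Taylor bound in which the exponent \<open>2\<close> is lowered to \<open>r\<close>, for random variables
  with a finite moment of order \<open>r\<close> only.\<close>
lemma exp_le_powr:
  fixes y r :: real
  assumes r: "1 < r" "r \<le> 2"
  shows "exp y \<le> 1 + y + \<bar>y\<bar> powr r * exp \<bar>y\<bar>"
proof (cases "\<bar>y\<bar> \<le> 1")
  case True
  have "exp y \<le> 1 + y + y\<^sup>2"
  proof (cases "y \<ge> 0")
    case True
    then show ?thesis using exp_bound[of y] \<open>\<bar>y\<bar> \<le> 1\<close> by simp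
  next
    case False
    have "1 - y > 0" using False by simp
    have "1 - y \<le> exp (- y)" using exp_ge_add_one_self[of "- y"] by simp
    then have "exp y \<le> 1 / (1 - y)" using \<open>1 - y > 0\<close> by (simp add: exp_minus field_simps)
    also have "\<dots> \<le> 1 + y + y\<^sup>2"
    proof -
      have "1 \<le> (1 + y + y\<^sup>2) * (1 - y)"
      proof -
        have "(1 + y + y\<^sup>2) * (1 - y) = 1 + y\<^sup>2 * (- y)" by (simp add: algebra_simps power2_eq_square)
        then show ?thesis using False by (simp add: mult_nonneg_nonpos)
      qed
      then show ?thesis using \<open>1 - y > 0\<close> by (simp add: divide_simps)
    qed
    finally show ?thesis .
  qed
  also have "y\<^sup>2 \<le> \<bar>y\<bar> powr r * exp \<bar>y\<bar>"
  proof (cases "y = 0")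
    case False
    have "y\<^sup>2 = \<bar>y\<bar> powr 2" using False by simp
    also have "\<dots> \<le> \<bar>y\<bar> powr r" using True r False by (intro powr_mono') auto
    also have "\<dots> \<le> \<bar>y\<bar> powr r * exp \<bar>y\<bar>" using mult_left_mono[of 1 "exp \<bar>y\<bar>" "\<bar>y\<bar> powr r"] by simp
    finally show ?thesis .
  qed simp
  finally show ?thesis by simp
next
  case False
  then have ge: "\<bar>y\<bar> powr 1 \<le> \<bar>y\<bar> powr r" using r by (intro powr_mono) auto
  show ?thesis
  proof (cases "y \<ge> 0")
    case True
    have "1 * exp y \<le> \<bar>y\<bar> powr r * exp \<bar>y\<bar>" using ge False True by (intro mult_mono) auto
    then have "exp y \<le> \<bar>y\<bar> powr r * exp \<bar>y\<bar>" by simp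
    then show ?thesis using True by linarith
  next
    case neg: False
    have "\<bar>y\<bar> * 1 \<le> \<bar>y\<bar> powr r * exp \<bar>y\<bar>" using ge False by (intro mult_mono) auto
    moreover have "exp y \<le> 1" using neg by simp
    ultimately show ?thesis using neg by linarith
  qed
qed

section \<open>Large deviations below the drift\<close>

text \<open>A function \<open>f\<close> on the set \<open>D\<close> of starting points, which is preserved by a semigroup \<open>S\<close>
  containing almost all matrices. Below, \<open>f\<close> is \<open>\<plusminus> ln q\<close> for a norm \<open>q\<close> on the space, on a subspace or on a quotient.\<close>
locale walk_function = random_walk \<mu> p
  for \<mu> :: "('k::local_field^'d^'d) measure" and p +
  fixes f :: "'k^'d \<Rightarrow> real" and D :: "('k^'d) set" and S :: "('k^'d^'d) set" and c :: real
  assumes f_measurable [measurable]: "f \<in> borel_measurable borel"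
    and S_measurable [measurable]: "S \<in> sets borel_GL"
    and S_id: "mat 1 \<in> S" and S_mult: "\<And>g h. g \<in> S \<Longrightarrow> h \<in> S \<Longrightarrow> g ** h \<in> S"
    and S_AE: "AE g in \<mu>. g \<in> S"
    and D_invariant: "\<And>g v. g \<in> S \<Longrightarrow> v \<in> D \<Longrightarrow> g *v v \<in> D"
    and increment_le: "\<And>g v. g \<in> S \<Longrightarrow> v \<in> D \<Longrightarrow> \<bar>f (g *v v) - f v\<bar> \<le> lnN g + c"
    and c_nonneg: "c \<ge> 0"
begin

definition drift :: "nat \<Rightarrow> 'k^'d \<Rightarrow> real" where
  "drift n v = (\<integral>g. f (g *v v) - f v \<partial>M n)"

lemma S_GL: "g \<in> S \<Longrightarrow> g \<in> GL"
  using sets.sets_into_space[OF S_measurable] by auto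

lemma AE_S: "AE g in M n. g \<in> S"
  by (rule AE_M[OF S_measurable S_id S_mult S_AE])

lemma measurable_increment [measurable]: "(\<lambda>g. f (g *v v) - f v) \<in> borel_measurable borel_GL"
  by measurable

lemma integrable_increment:
  assumes "v \<in> D" shows "integrable (M n) (\<lambda>g. f (g *v v) - f v)"
proof (rule Bochner_Integration.integrable_bound)
  interpret Mn: prob_space "M n" by (rule prob_space_M)
  show "integrable (M n) (\<lambda>g. lnN g + c)" using integrable_lnN[of n] by simp
  show "AE g in M n. norm (f (g *v v) - f v) \<le> norm (lnN g + c)"
    using AE_S[of n] by eventually_elim (use increment_le[OF _ assms] in force)
qed measurable

lemma abs_drift_le:
  assumes "v \<in> D" shows "\<bar>drift n v\<bar> \<le> real n * mean_lnN + c"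
proof -
  interpret Mn: prob_space "M n" by (rule prob_space_M)
  have "\<bar>drift n v\<bar> \<le> (\<integral>g. norm (f (g *v v) - f v) \<partial>M n)"
    unfolding drift_def using integral_norm_bound[of "M n" "\<lambda>g. f (g *v v) - f v"] by simp
  also have "\<dots> \<le> (\<integral>g. lnN g + c \<partial>M n)"
  proof (rule integral_mono_AE)
    show "AE g in M n. norm (f (g *v v) - f v) \<le> lnN g + c"
      using AE_S[of n] by eventually_elim (use increment_le[OF _ assms] in force)
  qed (use integrable_lnN[of n] integrable_increment[OF assms] in auto)
  also have "\<dots> = (\<integral>g. lnN g \<partial>M n) + c"
    using integrable_lnN[of n] Mn.prob_space by simp
  finally show ?thesis using integral_lnN_le[of n] by simp
qed

lemma drift_0 [simp]: "drift 0 v = 0"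
proof -
  have "(\<lambda>g. f (g *v v) - f v) \<in> borel_measurable borel_GL" by measurable
  then show ?thesis by (simp add: drift_def integral_return)
qed

lemma
  assumes "v \<in> D"
  shows drift_add: "drift (n + k) v = drift k v + (\<integral>h. drift n (h *v v) \<partial>M k)"
    and integrable_drift: "integrable (M k) (\<lambda>h. drift n (h *v v))"
proof -
  interpret Mn: prob_space "M n" by (rule prob_space_M)
  have eq: "AE h in M k. (\<integral>g. f ((g ** h) *v v) - f v \<partial>M n) = drift n (h *v v) + (f (h *v v) - f v)"
    using AE_S[of k]
  proof eventually_elim
    case (elim h)
    have "(\<integral>g. f ((g ** h) *v v) - f v \<partial>M n)
        = (\<integral>g. (f (g *v (h *v v)) - f (h *v v)) + (f (h *v v) - f v) \<partial>M n)"
      by (simp add: matrix_vector_mul_assoc)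
    also have "\<dots> = drift n (h *v v) + (f (h *v v) - f v)"
      using integrable_increment[OF D_invariant[OF elim assms], of n] Mn.prob_space
      by (subst Bochner_Integration.integral_add) (auto simp: drift_def)
    finally show ?case .
  qed
  have m: "(\<lambda>h. \<integral>g. f ((g ** h) *v v) - f v \<partial>M n) \<in> borel_measurable (M k)"
    using integral_M_add(2)[where n = n and k = k, OF integrable_increment[OF assms]] by (rule borel_measurable_integrable)
  have m2: "(\<lambda>h. drift n (h *v v)) \<in> borel_measurable (M k)"
  proof -
    have "(\<lambda>h. \<integral>g. f (g *v (h *v v)) - f (h *v v) \<partial>M n) \<in> borel_measurable (M k)" by measurable
    then show ?thesis by (simp add: drift_def)
  qed
  have "integrable (M k) (\<lambda>h. (\<integral>g. f ((g ** h) *v v) - f v \<partial>M n) - (f (h *v v) - f v))"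
    by (intro Bochner_Integration.integrable_diff integral_M_add(2) integrable_increment assms)
  then show int: "integrable (M k) (\<lambda>h. drift n (h *v v))"
    by (rule integrable_cong_AE_imp[OF _ m2]) (use eq in eventually_elim, auto)
  have "drift (n + k) v = (\<integral>h. (\<integral>g. f ((g ** h) *v v) - f v \<partial>M n) \<partial>M k)"
    unfolding drift_def by (rule integral_M_add(1)[OF integrable_increment[OF assms]])
  also have "\<dots> = (\<integral>h. drift n (h *v v) + (f (h *v v) - f v) \<partial>M k)"
    using eq m m2 by (intro integral_cong_AE) auto
  also have "\<dots> = (\<integral>h. drift n (h *v v) \<partial>M k) + drift k v"
    unfolding drift_def[of k] by (intro Bochner_Integration.integral_add int integrable_increment assms)
  finally show "drift (n + k) v = drift k v + (\<integral>h. drift n (h *v v) \<partial>M k)" by simp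
qed

text \<open>Exponential Chebyshev along the walk. Rather than truncating the increments one by one, the
  induction on the number of steps pays \<open>measure \<mu> {Z > L}\<close> for each step at which the
  dominating function \<open>Z\<close> exceeds the level \<open>L\<close>.\<close>
lemma exponential_bound:
  fixes L s \<rho> :: real and Z :: "'k^'d^'d \<Rightarrow> real"
  assumes Z [measurable]: "Z \<in> borel_measurable borel_GL" and s: "s \<ge> 0" and \<rho>: "\<rho> \<ge> 0"
    and step: "\<And>v. v \<in> D \<Longrightarrow>
      (\<integral>\<^sup>+g. ennreal (indicator {g. Z g \<le> L} g * exp (- s * (f (g *v v) - f v))) \<partial>\<mu>) \<le> ennreal \<rho>"
    and v: "v \<in> D"
  shows "emeasure (M n) {g\<in>GL. f (g *v v) - f v \<le> a} \<le>
    of_nat n * emeasure \<mu> {g\<in>GL. Z g > L} + ennreal (exp (s * a) * \<rho> ^ n)"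
  using v
proof (induction n arbitrary: v a)
  case 0
  show ?case
  proof (cases "a \<ge> 0")
    case True
    have "emeasure (M 0) {g\<in>GL. f (g *v v) - f v \<le> a} \<le> ennreal 1"
      using prob_space.emeasure_le_1[OF prob_space_M, of 0] by (simp only: ennreal_1)
    also have "\<dots> \<le> ennreal (exp (s * a))" using s True by (intro ennreal_leI) simp
    finally show ?thesis by simp
  next
    case False
    have "{g\<in>space borel_GL. f (g *v v) - f v \<le> a} \<in> sets borel_GL" by measurable
    then have "emeasure (M 0) {g\<in>GL. f (g *v v) - f v \<le> a} = 0"
      using False by (simp add: emeasure_return)
    then show ?thesis by simp
  qed
next
  case (Suc n)
  define A where "A = {g\<in>GL. f (g *v v) - f v \<le> a}"
  define P where "P = emeasure \<mu> {g\<in>GL. Z g > L}"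
  have A [measurable]: "A \<in> sets borel_GL"
    unfolding A_def by (rule sets_GL_Collect) measurable
  have P_meas [measurable]: "{g\<in>GL. Z g > L} \<in> sets (borel_GL :: ('k^'d^'d) measure)"
    by (rule sets_GL_Collect) measurable
  interpret Mn: prob_space "M n" by (rule prob_space_M)
  define w where "w h = ennreal (indicator {g. Z g \<le> L} h * exp (- s * (f (h *v v) - f v)))" for h
  have w [measurable]: "w \<in> borel_measurable borel_GL"
  proof -
    have "(\<lambda>h. ennreal ((if Z h \<le> L then 1 else 0) * exp (- s * (f (h *v v) - f v)))) \<in> borel_measurable borel_GL"
      by measurable
    also have "(\<lambda>h. ennreal ((if Z h \<le> L then 1 else 0) * exp (- s * (f (h *v v) - f v)))) = w"
      by (auto simp: w_def indicator_def)
    finally show ?thesis .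
  qed
  have inner: "(\<integral>\<^sup>+g. indicator A (g ** h) \<partial>M n)
      \<le> indicator {g\<in>GL. Z g > L} h + (of_nat n * P + ennreal (exp (s * a) * \<rho> ^ n) * w h)"
    if h: "h \<in> S" for h
  proof (cases "Z h > L")
    case True
    have "(\<integral>\<^sup>+g. indicator A (g ** h) \<partial>M n) \<le> (\<integral>\<^sup>+g. 1 \<partial>M n)"
      by (intro nn_integral_mono) (auto simp: indicator_def)
    also have "\<dots> = 1" using Mn.emeasure_space_1 by simp
    also have "1 = (indicator {g\<in>GL. Z g > L} h :: ennreal)" using True S_GL[OF h] by simp
    finally show ?thesis by (rule order_trans) simp
  next
    case False
    let ?x = "f (h *v v) - f v"
    have "(\<integral>\<^sup>+g. indicator A (g ** h) \<partial>M n)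
        = (\<integral>\<^sup>+g. indicator {g\<in>GL. f (g *v (h *v v)) - f (h *v v) \<le> a - ?x} g \<partial>M n)"
    proof (intro nn_integral_cong)
      fix g assume "g \<in> space (M n)"
      then show "indicator A (g ** h) = (indicator {g\<in>GL. f (g *v (h *v v)) - f (h *v v) \<le> a - ?x} g :: ennreal)"
        using GL_mult[of g h] S_GL[OF h] by (auto simp: A_def indicator_def matrix_vector_mul_assoc)
    qed
    also have "\<dots> = emeasure (M n) {g\<in>GL. f (g *v (h *v v)) - f (h *v v) \<le> a - ?x}"
    proof (rule nn_integral_indicator)
      have "{g\<in>space borel_GL. f (g *v (h *v v)) - f (h *v v) \<le> a - ?x} \<in> sets borel_GL" by measurable
      then show "{g\<in>GL. f (g *v (h *v v)) - f (h *v v) \<le> a - ?x} \<in> sets (M n)" by simp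
    qed
    also have "\<dots> \<le> of_nat n * P + ennreal (exp (s * (a - ?x)) * \<rho> ^ n)"
      unfolding P_def by (rule Suc.IH) (rule D_invariant[OF h Suc.prems])
    also have "ennreal (exp (s * (a - ?x)) * \<rho> ^ n) = ennreal (exp (s * a) * \<rho> ^ n) * w h"
    proof -
      have "exp (s * (a - ?x)) = exp (s * a) * exp (- s * ?x)"
        by (simp add: algebra_simps flip: exp_add)
      then show ?thesis using False \<rho>
        by (simp add: w_def algebra_simps flip: ennreal_mult)
    qed
    finally show ?thesis by (rule order_trans) simp
  qed
  have "emeasure (M (Suc n)) A = (\<integral>\<^sup>+x. indicator A x \<partial>M (n + Suc 0))" by simp
  also have "\<dots> = (\<integral>\<^sup>+h. \<integral>\<^sup>+g. indicator A (g ** h) \<partial>M n \<partial>\<mu>)"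
    using nn_integral_M_add[of "indicator A" n "Suc 0"] unfolding M_1 by measurable
  also have "\<dots> \<le> (\<integral>\<^sup>+h. indicator {g\<in>GL. Z g > L} h + (of_nat n * P + ennreal (exp (s * a) * \<rho> ^ n) * w h) \<partial>\<mu>)"
    by (rule nn_integral_mono_AE) (use S_AE in eventually_elim, rule inner)
  also have "\<dots> = P + (of_nat n * P + ennreal (exp (s * a) * \<rho> ^ n) * (\<integral>\<^sup>+h. w h \<partial>\<mu>))"
    by (simp add: nn_integral_add nn_integral_cmult \<mu>.emeasure_space_1 P_def del: space_\<mu>)
  also have "\<dots> \<le> P + (of_nat n * P + ennreal (exp (s * a) * \<rho> ^ n) * ennreal \<rho>)"
    using step[OF Suc.prems] unfolding w_def by (intro add_left_mono mult_left_mono) auto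
  also have "\<dots> = of_nat (Suc n) * P + ennreal (exp (s * a) * \<rho> ^ Suc n)"
    using \<rho> by (simp add: algebra_simps flip: ennreal_mult)
  finally show ?case by (simp add: A_def P_def)
qed

text \<open>Below the level \<open>L\<close>, \<open>exp_le_powr\<close> controls the exponential moment of the centred increment
  \<open>Y\<close>; above it, the truncation changes the mean by at most the tail expectation of \<open>Z\<close>.\<close>
lemma truncated_exponential_moment:
  fixes L s r b :: real and Z :: "'k^'d^'d \<Rightarrow> real"
  defines "Z \<equiv> \<lambda>g. lnN g + c + \<bar>b\<bar>"
  assumes r: "1 < r" "r \<le> 2" and s: "s \<ge> 0" and v: "v \<in> D" and b: "b \<le> drift (Suc 0) v"
    and int: "integrable \<mu> (\<lambda>g. Z g powr r)"
  shows "(\<integral>\<^sup>+g. ennreal (indicator {g. Z g \<le> L} g * exp (- s * (f (g *v v) - f v))) \<partial>\<mu>) \<le>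
    ennreal (exp (- s * b + s * (\<integral>g. Z g * indicator {g. Z g > L} g \<partial>\<mu>)
      + s powr r * exp (s * L) * (\<integral>g. Z g powr r \<partial>\<mu>)))"
proof -
  let ?Y = "\<lambda>g. f (g *v v) - f v - b"
  let ?W = "\<lambda>g. Z g * indicator {g. Z g > L} g"
  let ?T = "\<lambda>g. s powr r * exp (s * L) * Z g powr r"
  have [measurable]: "Z \<in> borel_measurable borel_GL" unfolding Z_def by measurable
  have intZ: "integrable \<mu> Z" unfolding Z_def using integrable_lnN_\<mu> by simp
  have intW: "integrable \<mu> ?W"
  proof (rule Bochner_Integration.integrable_bound[OF intZ])
    have "(\<lambda>g. Z g * (if Z g > L then 1 else 0)) \<in> borel_measurable \<mu>" by measurable
    then show "?W \<in> borel_measurable \<mu>" by (simp add: indicator_def)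
  qed (auto simp: indicator_def)
  have intY: "integrable \<mu> ?Y"
    using integrable_increment[OF v, of "Suc 0"] unfolding M_1 by simp
  have EY: "(\<integral>g. ?Y g \<partial>\<mu>) \<ge> 0"
    using integrable_increment[OF v, of "Suc 0"] b unfolding M_1 drift_def by simp
  have bound: "indicator {g. Z g \<le> L} g * exp (- s * (f (g *v v) - f v))
      \<le> exp (- s * b) * (1 - s * ?Y g + s * ?W g + ?T g)"
      and bound_nonneg: "0 \<le> 1 - s * ?Y g + s * ?W g + ?T g" if g: "g \<in> S" for g
  proof -
    have Z0: "Z g \<ge> 0" using lnN_nonneg[OF S_GL[OF g]] c_nonneg by (simp add: Z_def)
    have Y: "\<bar>?Y g\<bar> \<le> Z g" using increment_le[OF g v] by (simp add: Z_def)
    then have sY: "\<bar>- s * ?Y g\<bar> \<le> s * Z g" using s by (simp add: abs_mult mult_left_mono)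
    have T0: "?T g \<ge> 0" by simp
    have *: "indicator {g. Z g \<le> L} g * exp (- s * ?Y g) \<le> 1 - s * ?Y g + s * ?W g + ?T g"
    proof (cases "Z g \<le> L")
      case True
      have "exp (- s * ?Y g) \<le> 1 + (- s * ?Y g) + \<bar>- s * ?Y g\<bar> powr r * exp \<bar>- s * ?Y g\<bar>"
        by (rule exp_le_powr[OF r])
      also have "\<bar>- s * ?Y g\<bar> powr r * exp \<bar>- s * ?Y g\<bar> \<le> (s * Z g) powr r * exp (s * L)"
      proof (intro mult_mono powr_mono2)
        have "s * Z g \<le> s * L" using True s by (intro mult_left_mono)
        then show "exp \<bar>- s * ?Y g\<bar> \<le> exp (s * L)" using sY by simp
      qed (use sY r in auto)
      also have "(s * Z g) powr r * exp (s * L) = ?T g" using s Z0 by (simp add: powr_mult)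
      finally show ?thesis using True by (simp add: indicator_def)
    next
      case False
      then have "?W g = Z g" by (simp add: indicator_def)
      then show ?thesis using sY T0 False by (simp add: indicator_def)
    qed
    have "indicator {g. Z g \<le> L} g * exp (- s * (f (g *v v) - f v))
        = exp (- s * b) * (indicator {g. Z g \<le> L} g * exp (- s * ?Y g))"
      by (simp add: algebra_simps flip: exp_add)
    also have "\<dots> \<le> exp (- s * b) * (1 - s * ?Y g + s * ?W g + ?T g)"
      using * by (intro mult_left_mono) auto
    finally show "indicator {g. Z g \<le> L} g * exp (- s * (f (g *v v) - f v))
        \<le> exp (- s * b) * (1 - s * ?Y g + s * ?W g + ?T g)" .
    show "0 \<le> 1 - s * ?Y g + s * ?W g + ?T g"
      by (rule order_trans[OF _ *]) simp
  qed
  let ?B = "\<lambda>g. exp (- s * b) * (1 - s * ?Y g + s * ?W g + ?T g)"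
  have intB: "integrable \<mu> ?B" using intY intW int by simp
  have "(\<integral>\<^sup>+g. ennreal (indicator {g. Z g \<le> L} g * exp (- s * (f (g *v v) - f v))) \<partial>\<mu>)
      \<le> (\<integral>\<^sup>+g. ennreal (?B g) \<partial>\<mu>)"
    by (rule nn_integral_mono_AE) (use S_AE in eventually_elim, rule ennreal_leI, rule bound)
  also have "\<dots> = ennreal (\<integral>g. ?B g \<partial>\<mu>)"
    by (rule nn_integral_eq_integral[OF intB]) (use S_AE in eventually_elim, use bound_nonneg in simp)
  also have "(\<integral>g. ?B g \<partial>\<mu>) = exp (- s * b) * (1 - s * (\<integral>g. ?Y g \<partial>\<mu>) + s * (\<integral>g. ?W g \<partial>\<mu>)
      + s powr r * exp (s * L) * (\<integral>g. Z g powr r \<partial>\<mu>))"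
  proof -
    have "integrable \<mu> (\<lambda>g. s * ?Y g)" "integrable \<mu> (\<lambda>g. s * ?W g)" "integrable \<mu> ?T"
      using intY intW int by (auto intro!: integrable_mult_right)
    then have "(\<integral>g. 1 - s * ?Y g + s * ?W g + ?T g \<partial>\<mu>)
        = 1 - s * (\<integral>g. ?Y g \<partial>\<mu>) + s * (\<integral>g. ?W g \<partial>\<mu>) + s powr r * exp (s * L) * (\<integral>g. Z g powr r \<partial>\<mu>)"
      by (subst Bochner_Integration.integral_add Bochner_Integration.integral_diff;
          simp del: space_\<mu> add: \<mu>.prob_space)+
    then show ?thesis by simp
  qed
  also have "ennreal \<dots> \<le> ennreal (exp (- s * b) * exp (s * (\<integral>g. ?W g \<partial>\<mu>) + s powr r * exp (s * L) * (\<integral>g. Z g powr r \<partial>\<mu>)))"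
  proof (intro ennreal_leI mult_left_mono)
    have "1 - s * (\<integral>g. ?Y g \<partial>\<mu>) + s * (\<integral>g. ?W g \<partial>\<mu>) + s powr r * exp (s * L) * (\<integral>g. Z g powr r \<partial>\<mu>)
        \<le> 1 + (s * (\<integral>g. ?W g \<partial>\<mu>) + s powr r * exp (s * L) * (\<integral>g. Z g powr r \<partial>\<mu>))"
      using EY s by simp
    also have "\<dots> \<le> exp (s * (\<integral>g. ?W g \<partial>\<mu>) + s powr r * exp (s * L) * (\<integral>g. Z g powr r \<partial>\<mu>))"
      by (rule exp_ge_add_one_self)
    finally show "1 - s * (\<integral>g. ?Y g \<partial>\<mu>) + s * (\<integral>g. ?W g \<partial>\<mu>) + s powr r * exp (s * L) * (\<integral>g. Z g powr r \<partial>\<mu>)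
        \<le> exp (s * (\<integral>g. ?W g \<partial>\<mu>) + s powr r * exp (s * L) * (\<integral>g. Z g powr r \<partial>\<mu>))" .
  qed simp
  finally show ?thesis by (simp add: algebra_simps flip: exp_add)
qed

lemma integrable_shifted_lnN_powr:
  assumes "a \<ge> 0" shows "integrable \<mu> (\<lambda>g. (lnN g + a) powr p)"
proof (rule Bochner_Integration.integrable_bound)
  show "integrable \<mu> (\<lambda>g. 2 powr p * (lnN g powr p + a powr p))" using moment by simp
  show "AE g in \<mu>. norm ((lnN g + a) powr p) \<le> norm (2 powr p * (lnN g powr p + a powr p))"
  proof (rule AE_I2)
    fix g assume "g \<in> space \<mu>"
    then have 0: "lnN g \<ge> 0" by (simp add: lnN_nonneg)
    have "(lnN g + a) powr p \<le> (2 * max (lnN g) a) powr p"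
      using 0 assms p_gt_1 by (intro powr_mono2) auto
    also have "\<dots> = 2 powr p * max (lnN g) a powr p" using 0 by (simp add: powr_mult)
    also have "\<dots> \<le> 2 powr p * (lnN g powr p + a powr p)"
      by (intro mult_left_mono) (auto simp: max_def)
    finally show "norm ((lnN g + a) powr p) \<le> norm (2 powr p * (lnN g powr p + a powr p))" by simp
  qed
qed simp

text \<open>With the level \<open>L = \<delta> n\<close> and the parameter \<open>s = K ln n / n\<close>, the factor \<open>exp (- s \<epsilon> n)\<close> is a
  power of \<open>n\<close> that can be made as negative as desired, while \<open>exp (s L)\<close> is a power of \<open>n\<close> that is
  too small to spoil the factor \<open>s powr r\<close> if \<open>\<delta>\<close> is small.\<close>
lemma lower_deviation_one_step:
  assumes \<epsilon>: "\<epsilon> > 0" and b: "\<And>v. v \<in> D \<Longrightarrow> b \<le> drift (Suc 0) v"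
  obtains C where "summable_rate p C"
    "\<And>n v. v \<in> D \<Longrightarrow> measure (M n) {g\<in>GL. f (g *v v) - f v \<le> (b - \<epsilon>) * real n} \<le> C n"
proof -
  define Z where "Z = (\<lambda>g :: 'k^'d^'d. lnN g + c + \<bar>b\<bar>)"
  define r where "r = min p 2"
  have r: "1 < r" "r \<le> 2" using p_gt_1 by (auto simp: r_def)
  define Mr where "Mr = (\<integral>g. Z g powr r \<partial>\<mu>)"
  \<comment> \<open>Half of the gain \<open>exp (- K * \<epsilon> * ln n)\<close> is then exactly
    \<open>n powr (- p)\<close>.\<close>
  define K where "K = 2 * p / \<epsilon>"
  have K: "K > 0" using \<epsilon> p_gt_1 by (simp add: K_def)
  \<comment> \<open>So \<open>exp (s * \<delta> * n) = n powr ((r - 1) / 2)\<close>, which undoes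
    only half of the decay of \<open>n * s powr r\<close>.\<close>
  define \<delta> where "\<delta> = (r - 1) / (2 * K)"
  have \<delta>: "\<delta> > 0" using r K by (simp add: \<delta>_def)
  define \<eta> where "\<eta> n = (\<integral>g. Z g * indicator {g. Z g > \<delta> * real n} g \<partial>\<mu>)" for n
  have [measurable]: "Z \<in> borel_measurable borel_GL" unfolding Z_def by measurable
  have Z0: "Z g \<ge> 0" if "g \<in> GL" for g using lnN_nonneg[OF that] c_nonneg by (simp add: Z_def)
  have intZp: "integrable \<mu> (\<lambda>g. Z g powr p)"
    using integrable_shifted_lnN_powr[of "c + \<bar>b\<bar>"] c_nonneg by (simp add: Z_def add.assoc)
  have intZ: "integrable \<mu> Z" unfolding Z_def using integrable_lnN_\<mu> by simp
  have intZr: "integrable \<mu> (\<lambda>g. Z g powr r)"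
  proof (rule Bochner_Integration.integrable_bound)
    show "integrable \<mu> (\<lambda>g. 1 + Z g powr p)" using intZp by simp
    show "AE g in \<mu>. norm (Z g powr r) \<le> norm (1 + Z g powr p)"
    proof (rule AE_I2)
      fix g assume "g \<in> space \<mu>"
      then have g: "Z g \<ge> 0" by (simp add: Z0)
      show "norm (Z g powr r) \<le> norm (1 + Z g powr p)"
      proof (cases "Z g \<le> 1")
        case True
        then have "Z g powr r \<le> 1" using g r by (simp add: powr_le1)
        then show ?thesis by (simp add: add_increasing2)
      next
        case False
        then have "Z g powr r \<le> Z g powr p" by (intro powr_mono) (auto simp: r_def)
        then show ?thesis by simp
      qed
    qed
  qed simp
  have Mr: "Mr \<ge> 0" unfolding Mr_def by (rule integral_nonneg_AE) simp
  have "\<eta> \<longlonglongrightarrow> (\<integral>g. 0 \<partial>\<mu>)"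
    unfolding \<eta>_def
  proof (rule integral_dominated_convergence[where w = Z])
    show "AE g in \<mu>. (\<lambda>n. Z g * indicator {g. Z g > \<delta> * real n} g) \<longlonglongrightarrow> 0"
    proof (rule AE_I2)
      fix g
      obtain n0 :: nat where "Z g / \<delta> \<le> real n0" using real_arch_simple by blast
      then have n0: "Z g \<le> \<delta> * real n" if "n \<ge> n0" for n
        using \<delta> that by (simp add: field_simps) (meson mult_le_mono1 mult_left_mono of_nat_mono order_trans less_imp_le)
      then have "eventually (\<lambda>n. Z g * indicator {g. Z g > \<delta> * real n} g = 0) sequentially"
        unfolding eventually_sequentially by (intro exI[of _ n0]) (auto simp: indicator_def not_less)
      then show "(\<lambda>n. Z g * indicator {g. Z g > \<delta> * real n} g) \<longlonglongrightarrow> 0" by (rule tendsto_eventually)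
    qed
    show "AE g in \<mu>. norm (Z g * indicator {g. Z g > \<delta> * real n} g) \<le> Z g" for n
      by (rule AE_I2) (auto simp: indicator_def Z0)
    show "(\<lambda>g. Z g * indicator {g. Z g > \<delta> * real n} g) \<in> borel_measurable \<mu>" for n
    proof -
      have "(\<lambda>g. Z g * (if Z g > \<delta> * real n then 1 else 0)) \<in> borel_measurable \<mu>" by measurable
      then show ?thesis by (simp add: indicator_def)
    qed
  qed (simp_all add: intZ)
  then have \<eta>: "eventually (\<lambda>n. \<eta> n < \<epsilon> / 2) sequentially"
    using \<epsilon> by (intro order_tendstoD(2)[where y = 0]) auto
  define t where "t = (r - 1) / (2 * r)"
  have t: "t > 0" using r by (simp add: t_def)
  define B where "B = Mr * K powr r + 1"
  have B: "B \<ge> 1" using Mr by (simp add: B_def)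
  have ln0: "(\<lambda>n. ln (real n) / real n powr t) \<longlonglongrightarrow> 0" by (rule lim_ln_over_power[OF t])
  have lnB: "eventually (\<lambda>n. ln (real n) / real n powr t < 1 / B) sequentially"
    using B by (intro order_tendstoD(2)[OF ln0]) auto
  have "eventually (\<lambda>n. n \<ge> 2 \<and> \<eta> n < \<epsilon> / 2 \<and> ln (real n) / real n powr t < 1 / B) sequentially"
    by (intro eventually_conj eventually_ge_at_top \<eta> lnB)
  then obtain n0 where n0: "\<And>n. n \<ge> n0 \<Longrightarrow> n \<ge> 2 \<and> \<eta> n < \<epsilon> / 2 \<and> ln (real n) / real n powr t < 1 / B"
    by (auto simp: eventually_sequentially)
  define C0 where "C0 n = real n * measure \<mu> {g\<in>space \<mu>. Z g > \<delta> * real n} + exp 1 * real n powr (- p)" for n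
  define C where "C n = (if n < n0 then 1 else C0 n)" for n
  have rate: "summable_rate p C"
    unfolding C_def C0_def
    by (intro summable_rate_cong_eventually summable_rate_add summable_rate_powr \<mu>.summable_rate_tail p_gt_1 \<delta> intZp)
      (auto simp: Z0)
  have "measure (M n) {g\<in>GL. f (g *v v) - f v \<le> (b - \<epsilon>) * real n} \<le> C n" if v: "v \<in> D" for n v
  proof (cases "n < n0")
    case True
    then show ?thesis using prob_space.prob_le_1[OF prob_space_M] by (simp add: C_def)
  next
    case False
    then have n: "n \<ge> 2" "\<eta> n < \<epsilon> / 2" "ln (real n) / real n powr t < 1 / B" using n0[of n] by auto
    define s where "s = K * ln (real n) / real n"
    have ln_pos: "ln (real n) > 0" using n(1) by simp
    have s: "s > 0" using K n(1) ln_pos by (simp add: s_def)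
    define \<rho> where "\<rho> = exp (- s * b + s * \<eta> n + s powr r * exp (s * (\<delta> * real n)) * Mr)"
    have "emeasure (M n) {g\<in>GL. f (g *v v) - f v \<le> (b - \<epsilon>) * real n} \<le>
      of_nat n * emeasure \<mu> {g\<in>GL. Z g > \<delta> * real n} + ennreal (exp (s * ((b - \<epsilon>) * real n)) * \<rho> ^ n)"
    proof (rule exponential_bound)
      fix v assume "v \<in> D"
      then show "(\<integral>\<^sup>+g. ennreal (indicator {g. Z g \<le> \<delta> * real n} g * exp (- s * (f (g *v v) - f v))) \<partial>\<mu>) \<le> ennreal \<rho>"
        unfolding \<rho>_def \<eta>_def Mr_def Z_def using s r b intZr
        by (intro truncated_exponential_moment) (auto simp: Z_def)
    qed (use s v in \<open>auto simp: \<rho>_def\<close>)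
    also have "of_nat n * emeasure \<mu> {g\<in>GL. Z g > \<delta> * real n} = ennreal (real n * measure \<mu> {g\<in>space \<mu>. Z g > \<delta> * real n})"
      by (simp add: \<mu>.emeasure_eq_measure ennreal_mult ennreal_of_nat_eq_real_of_nat)
    also have "exp (s * ((b - \<epsilon>) * real n)) * \<rho> ^ n
        = exp (- (s * real n * \<epsilon>) + s * real n * \<eta> n + real n * (s powr r * exp (s * (\<delta> * real n)) * Mr))"
      unfolding \<rho>_def by (simp add: algebra_simps flip: exp_of_nat_mult exp_add)
    also have "\<dots> \<le> exp (1 + - p * ln (real n))"
    proof -
      have sn: "s * real n = K * ln (real n)" using n(1) by (simp add: s_def)
      have 1: "- (s * real n * \<epsilon>) + s * real n * \<eta> n \<le> - p * ln (real n)"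
      proof -
        have "s * real n * \<eta> n \<le> s * real n * (\<epsilon> / 2)" using s n by (intro mult_left_mono) auto
        then have "- (s * real n * \<epsilon>) + s * real n * \<eta> n \<le> - (s * real n * (\<epsilon> / 2))" by (simp add: field_simps)
        also have "\<dots> = - p * ln (real n)" unfolding sn using \<epsilon> by (simp add: K_def)
        finally show ?thesis .
      qed
      have 2: "real n * (s powr r * exp (s * (\<delta> * real n)) * Mr) \<le> 1"
      proof -
        let ?x = "ln (real n) / real n powr t"
        have x: "0 \<le> ?x" "?x \<le> 1" using n(3) ln_pos B
          by (auto intro: order_trans[OF less_imp_le[OF n(3)]])
        have "exp (s * (\<delta> * real n)) = exp ((r - 1) / 2 * ln (real n))"
          using sn K by (simp add: \<delta>_def field_simps)
        also have "\<dots> = real n powr ((r - 1) / 2)" using n(1) by (simp add: powr_def)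
        finally have e: "exp (s * (\<delta> * real n)) = real n powr ((r - 1) / 2)" .
        have "s powr r = K powr r * ln (real n) powr r * real n powr (- r)"
          using K ln_pos n(1) by (simp add: s_def powr_mult powr_divide powr_minus_divide)
        then have "real n * (s powr r * exp (s * (\<delta> * real n)) * Mr)
            = Mr * K powr r * (ln (real n) powr r * (real n powr 1 * real n powr (- r) * real n powr ((r - 1) / 2)))"
          using n(1) unfolding e by (simp add: algebra_simps)
        also have "real n powr 1 * real n powr (- r) * real n powr ((r - 1) / 2) = real n powr (- (t * r))"
        proof -
          have "- (t * r) = 1 + - r + (r - 1) / 2" using r by (simp add: t_def field_simps)
          then show ?thesis by (simp only: powr_add)
        qed
        also have "ln (real n) powr r * real n powr (- (t * r)) = ?x powr r"
          using ln_pos by (simp add: powr_divide powr_powr powr_minus_divide)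
        also have "Mr * K powr r * ?x powr r \<le> B * ?x"
        proof (intro mult_mono)
          have "?x powr r \<le> ?x powr 1" using x r by (intro powr_mono') auto
          then show "?x powr r \<le> ?x" using x by simp
        qed (use Mr B in \<open>auto simp: B_def\<close>)
        also have "\<dots> \<le> 1" using n(3) B by (simp add: field_simps)
        finally show ?thesis .
      qed
      show ?thesis using 1 2 by simp
    qed
    also have "exp (1 + - p * ln (real n)) = exp 1 * real n powr (- p)"
      using n(1) by (subst exp_add) (simp add: powr_def)
    finally have "ennreal (measure (M n) {g\<in>GL. f (g *v v) - f v \<le> (b - \<epsilon>) * real n}) \<le> ennreal (C0 n)"
      using finite_measure.emeasure_eq_measure[OF prob_space.finite_measure[OF prob_space_M]]
      by (simp add: C0_def add_left_mono ennreal_leI flip: ennreal_plus)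
    then show ?thesis using False by (subst (asm) ennreal_le_iff) (auto simp: C_def C0_def)
  qed
  then show ?thesis using that rate by blast
qed

lemma measurable_increment_set [measurable]: "{g\<in>GL. f (g *v v) - f v \<le> a} \<in> sets borel_GL"
  by (rule sets_GL_Collect) measurable

text \<open>Averaging \<open>f\<close> over the first \<open>m\<close> steps of the walk changes it by a bounded amount, and the
  one-step drift of the average is \<open>drift m v / m\<close> by telescoping. So a lower bound for the drift over
  \<open>m\<close> steps is as good as one over a single step.\<close>
lemma lower_deviation:
  assumes m: "m \<ge> 1" and \<epsilon>: "\<epsilon> > 0" and b: "\<And>v. v \<in> D \<Longrightarrow> real m * b \<le> drift m v"
  obtains C where "summable_rate p C"
    "\<And>n v. v \<in> D \<Longrightarrow> measure (M n) {g\<in>GL. f (g *v v) - f v \<le> (b - \<epsilon>) * real n} \<le> C n"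
proof -
  define F where "F v = (\<Sum>k<m. \<integral>g. f (g *v v) \<partial>M k) / real m" for v
  define B where "B = real m * mean_lnN + c"
  have B: "B \<ge> 0" using mean_lnN_nonneg c_nonneg by (simp add: B_def)
  have F: "F v = f v + (\<Sum>k<m. drift k v) / real m" if v: "v \<in> D" for v
  proof -
    have "(\<integral>g. f (g *v v) \<partial>M k) = f v + drift k v" for k
    proof -
      have "(\<integral>g. f (g *v v) \<partial>M k) = (\<integral>g. (f (g *v v) - f v) + f v \<partial>M k)" by simp
      also have "\<dots> = drift k v + f v"
        unfolding drift_def using integrable_increment[OF v, of k]
        by (subst Bochner_Integration.integral_add) (auto intro: finite_measure.integrable_const prob_space.finite_measure prob_space_M)
      finally show ?thesis by simp
    qed
    then show ?thesis using m by (simp add: F_def sum.distrib field_simps)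
  qed
  have F_close: "\<bar>F v - f v\<bar> \<le> B" if v: "v \<in> D" for v
  proof -
    have "\<bar>\<Sum>k<m. drift k v\<bar> \<le> (\<Sum>k<m. B)"
    proof (rule order_trans[OF sum_abs sum_mono])
      fix k assume "k \<in> {..<m}"
      then have "real k * mean_lnN \<le> real m * mean_lnN" using mean_lnN_nonneg by (intro mult_right_mono) auto
      then show "\<bar>drift k v\<bar> \<le> B" using abs_drift_le[OF v, of k] by (simp add: B_def)
    qed
    then show ?thesis using m by (simp add: F[OF v] abs_divide field_simps)
  qed
  have F_measurable [measurable]: "F \<in> borel_measurable borel"
  proof -
    have "(\<lambda>v. \<integral>g. f (g *v v) \<partial>M k) \<in> borel_measurable borel" for k
    proof -
      interpret Mk: prob_space "M k" by (rule prob_space_M)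
      show ?thesis by measurable
    qed
    then show ?thesis unfolding F_def by measurable
  qed
  interpret F: walk_function \<mu> p F D S "c + 2 * B"
  proof
    fix g v assume gv: "g \<in> S" "v \<in> D"
    show "\<bar>F (g *v v) - F v\<bar> \<le> lnN g + (c + 2 * B)"
      using F_close[OF gv(2)] F_close[OF D_invariant[OF gv]] increment_le[OF gv] by linarith
  qed (use S_id S_mult S_AE D_invariant c_nonneg B in auto)
  have driftF: "F.drift (Suc 0) v = drift m v / real m" if v: "v \<in> D" for v
  proof -
    have int: "integrable \<mu> (\<lambda>g. drift k (g *v v) - drift k v)" for k
      using integrable_drift[OF v, of "Suc 0" k] unfolding M_1 by simp
    have E: "(\<integral>g. drift k (g *v v) - drift k v \<partial>\<mu>) = drift (Suc k) v - drift (Suc 0) v - drift k v" for k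
      using drift_add[OF v, of k "Suc 0"] integrable_drift[OF v, of "Suc 0" k] unfolding M_1 by simp
    have "F.drift (Suc 0) v = (\<integral>g. F (g *v v) - F v \<partial>\<mu>)" unfolding F.drift_def M_1 ..
    also have "\<dots> = (\<integral>g. (f (g *v v) - f v) + (\<Sum>k<m. drift k (g *v v) - drift k v) / real m \<partial>\<mu>)"
    proof (rule integral_cong_AE)
      show "AE g in \<mu>. F (g *v v) - F v = (f (g *v v) - f v) + (\<Sum>k<m. drift k (g *v v) - drift k v) / real m"
        using S_AE by eventually_elim
          (simp add: F v D_invariant sum_subtractf diff_divide_distrib)
      have "(\<lambda>g. \<Sum>k<m. drift k (g *v v) - drift k v) \<in> borel_measurable \<mu>"
        using borel_measurable_integrable[OF int] by measurable
      then show "(\<lambda>g. (f (g *v v) - f v) + (\<Sum>k<m. drift k (g *v v) - drift k v) / real m) \<in> borel_measurable \<mu>"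
        by measurable
    qed measurable
    also have "\<dots> = drift (Suc 0) v + (\<Sum>k<m. drift (Suc k) v - drift (Suc 0) v - drift k v) / real m"
    proof -
      have "integrable \<mu> (\<lambda>g. (\<Sum>k<m. drift k (g *v v) - drift k v) / real m)" using int by simp
      moreover have "integrable \<mu> (\<lambda>g. f (g *v v) - f v)"
        using integrable_increment[OF v, of "Suc 0"] unfolding M_1 .
      moreover have "(\<integral>g. (\<Sum>k<m. drift k (g *v v) - drift k v) \<partial>\<mu>) = (\<Sum>k<m. drift (Suc k) v - drift (Suc 0) v - drift k v)"
        unfolding E[symmetric] by (rule Bochner_Integration.integral_sum) (rule int)
      ultimately show ?thesis
        by (subst Bochner_Integration.integral_add) (auto simp: drift_def M_1 simp del: conv_power.simps)
    qed
    also have "(\<Sum>k<m. drift (Suc k) v - drift (Suc 0) v - drift k v) = drift m v - real m * drift (Suc 0) v"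
      using sum_lessThan_telescope[of "\<lambda>k. drift k v" m] by (simp add: sum_subtractf)
    finally show ?thesis using m by (simp add: field_simps)
  qed
  have "b \<le> F.drift (Suc 0) v" if "v \<in> D" for v
    using b[OF that] m by (simp add: driftF[OF that] field_simps)
  then obtain C where C: "summable_rate p C"
    "\<And>n v. v \<in> D \<Longrightarrow> measure (M n) {g\<in>GL. F (g *v v) - F v \<le> (b - \<epsilon> / 2) * real n} \<le> C n"
    using F.lower_deviation_one_step[of "\<epsilon> / 2" b] \<epsilon> by auto
  obtain n0 :: nat where n0: "4 * B / \<epsilon> \<le> real n0" using real_arch_simple by blast
  define C' where "C' n = (if n < n0 then 1 else C n)" for n
  have "measure (M n) {g\<in>GL. f (g *v v) - f v \<le> (b - \<epsilon>) * real n} \<le> C' n" if v: "v \<in> D" for n v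
  proof (cases "n < n0")
    case True
    then show ?thesis using prob_space.prob_le_1[OF prob_space_M] by (simp add: C'_def)
  next
    case False
    then have "4 * B / \<epsilon> \<le> real n" using n0 by simp
    then have n: "2 * B \<le> \<epsilon> / 2 * real n" using \<epsilon> by (simp add: field_simps)
    interpret Mn: prob_space "M n" by (rule prob_space_M)
    have "measure (M n) {g\<in>GL. f (g *v v) - f v \<le> (b - \<epsilon>) * real n}
        \<le> measure (M n) {g\<in>GL. F (g *v v) - F v \<le> (b - \<epsilon> / 2) * real n}"
    proof (rule Mn.finite_measure_mono_AE)
      show "AE g in M n. g \<in> {g\<in>GL. f (g *v v) - f v \<le> (b - \<epsilon>) * real n} \<longrightarrow>
          g \<in> {g\<in>GL. F (g *v v) - F v \<le> (b - \<epsilon> / 2) * real n}"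
        using AE_S[of n]
      proof eventually_elim
        case (elim g)
        show ?case using F_close[OF v] F_close[OF D_invariant[OF elim v]] n
          by (auto simp: algebra_simps)
      qed
      show "{g\<in>GL. F (g *v v) - F v \<le> (b - \<epsilon> / 2) * real n} \<in> sets (M n)"
        unfolding sets_M by (rule F.measurable_increment_set)
    qed
    also have "\<dots> \<le> C n" by (rule C(2)[OF v])
    finally show ?thesis using False by (simp add: C'_def)
  qed
  moreover have "summable_rate p C'" unfolding C'_def by (rule summable_rate_cong_eventually[OF C(1)])
  ultimately show ?thesis using that by blast
qed

text \<open>Uniform integrability turns the small probability of a deviation below the drift into a small mean.\<close>
lemma lower_deviation_mean:
  assumes b: "\<And>\<eta>. \<eta> > 0 \<Longrightarrow> \<exists>m\<ge>1. \<forall>v\<in>D. real m * (b - \<eta>) \<le> drift m v" and \<eta>: "\<eta> > 0"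
  obtains n0 where "\<And>n v. n \<ge> n0 \<Longrightarrow> v \<in> D \<Longrightarrow>
    (\<integral>g. max 0 (b * real n - (f (g *v v) - f v)) \<partial>M n) \<le> \<eta> * real n"
proof -
  obtain m where m: "m \<ge> 1" "\<And>v. v \<in> D \<Longrightarrow> real m * (b - \<eta> / 4) \<le> drift m v"
    using b[of "\<eta> / 4"] \<eta> by auto
  obtain C where C: "summable_rate p C"
    "\<And>n v. v \<in> D \<Longrightarrow> measure (M n) {g\<in>GL. f (g *v v) - f v \<le> (b - \<eta> / 4 - \<eta> / 4) * real n} \<le> C n"
    using lower_deviation[of m "\<eta> / 4" "b - \<eta> / 4"] m \<eta> by auto
  obtain \<kappa> where \<kappa>: "\<kappa> > 0"
    and mean: "\<forall>n B F c. B \<in> sets borel_GL \<longrightarrow> measure (M n) B \<le> \<kappa> \<longrightarrow> integrable (M n) F \<longrightarrow>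
      (AE g in M n. F g \<le> \<bar>b\<bar> * real n + c + lnN g) \<longrightarrow> (AE g in M n. g \<notin> B \<longrightarrow> F g \<le> \<eta> / 2 * real n + c) \<longrightarrow>
      (\<integral>g. F g \<partial>M n) \<le> (\<eta> / 2 + \<eta> / 4) * real n + c"
    using mean_le_of_probable_bound[of "\<eta> / 4" "\<bar>b\<bar>" "\<eta> / 2"] \<eta> by auto
  have "eventually (\<lambda>n. C n < \<kappa>) sequentially"
    using C(1) \<kappa> by (auto simp: summable_rate_def intro: order_tendstoD(2))
  then obtain n1 where n1: "\<And>n. n \<ge> n1 \<Longrightarrow> C n < \<kappa>" by (auto simp: eventually_sequentially)
  obtain n2 :: nat where n2: "4 * c / \<eta> \<le> real n2" using real_arch_simple by blast
  show ?thesis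
  proof (rule that[of "max n1 n2"])
    fix n v assume n: "n \<ge> max n1 n2" and v: "v \<in> D"
    interpret Mn: prob_space "M n" by (rule prob_space_M)
    let ?F = "\<lambda>g. max 0 (b * real n - (f (g *v v) - f v))"
    define B where "B = {g\<in>GL. f (g *v v) - f v \<le> (b - \<eta> / 4 - \<eta> / 4) * real n}"
    have B: "B \<in> sets borel_GL" unfolding B_def by (rule measurable_increment_set)
    have PB: "measure (M n) B \<le> \<kappa>" using C(2)[OF v, of n] n1[of n] n by (simp add: B_def)
    have \<eta>n: "\<eta> / 2 * real n \<ge> 0" using \<eta> by simp
    have "(\<integral>g. ?F g \<partial>M n) \<le> (\<eta> / 2 + \<eta> / 4) * real n + c"
    proof (rule mean[rule_format, OF B PB])
      show "integrable (M n) ?F" using integrable_increment[OF v, of n] by (intro integrable_max) auto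
      show "AE g in M n. ?F g \<le> \<bar>b\<bar> * real n + c + lnN g"
        using AE_S[of n]
      proof eventually_elim
        case (elim g)
        have "b * real n \<le> \<bar>b\<bar> * real n" by (intro mult_right_mono) auto
        moreover have "\<bar>b\<bar> * real n \<ge> 0" by simp
        ultimately show ?case
          using increment_le[OF elim v] lnN_nonneg[OF S_GL[OF elim]] c_nonneg by (intro max.boundedI) linarith+
      qed
      show "AE g in M n. g \<notin> B \<longrightarrow> ?F g \<le> \<eta> / 2 * real n + c"
        using AE_S[of n]
      proof eventually_elim
        case (elim g)
        have "?F g \<le> \<eta> / 2 * real n + c" if "g \<notin> B"
        proof (rule max.boundedI)
        have "f (g *v v) - f v > (b - \<eta> / 4 - \<eta> / 4) * real n" using S_GL[OF elim] that by (simp add: B_def)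
        then have "b * real n - (f (g *v v) - f v) \<le> \<eta> / 2 * real n" by (simp add: field_simps)
        then show "b * real n - (f (g *v v) - f v) \<le> \<eta> / 2 * real n + c" using c_nonneg by linarith
        qed (use \<eta>n c_nonneg in simp)
        then show ?case ..
      qed
    qed
    moreover have "c \<le> \<eta> / 4 * real n"
    proof -
      have "4 * c / \<eta> \<le> real n" using n2 n by simp
      then show ?thesis using \<eta> by (simp add: field_simps)
    qed
    ultimately show "(\<integral>g. ?F g \<partial>M n) \<le> \<eta> * real n" by (simp add: algebra_simps)
  qed
qed

end

section \<open>Invariant subspaces\<close>

lemma exists_projection:
  fixes U :: "('k::field^'d) set"
  assumes "vec.subspace U"
  obtains Q :: "'k^'d^'d" where "\<And>v. Q *v v \<in> U" "\<And>u. u \<in> U \<Longrightarrow> Q *v u = u"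
proof -
  obtain h where h: "range h \<subseteq> U" "Vector_Spaces.linear (*s) (*s) h" "\<forall>v\<in>U. h v = (v :: 'k^'d)"
    using vec.linear_exists_left_inverse_on[OF vec.linear_id assms] by auto
  show ?thesis
    by (rule that[of "matrix h"]) (use h in \<open>auto simp: matrix_works\<close>)
qed

lemma closed_subspace:
  fixes U :: "('k::local_field^'d) set"
  assumes "vec.subspace U" shows "closed U"
proof -
  obtain Q :: "'k^'d^'d" where Q: "\<And>v. Q *v v \<in> U" "\<And>u. u \<in> U \<Longrightarrow> Q *v u = u"
    using exists_projection[OF assms] by blast
  then have "U = {v. Q *v v = v}" by (metis (mono_tags) Collect_mem_eq Collect_cong)
  moreover have "closed {v. Q *v v = v}" by (intro closed_Collect_eq continuous_intros)
  ultimately show ?thesis by simp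
qed

definition stab :: "('k::local_field^'d) set \<Rightarrow> ('k^'d^'d) set" where
  "stab U = {g\<in>GL. \<forall>u\<in>U. g *v u \<in> U}"

lemma stab_closed:
  assumes "vec.subspace (U :: ('k::local_field^'d) set)"
  obtains F where "closed F" "stab U = GL \<inter> F"
proof -
  have "closed {g :: 'k^'d^'d. g *v u \<in> U}" for u
  proof -
    have "{g :: 'k^'d^'d. g *v u \<in> U} = (\<lambda>g. g *v u) -` U" by auto
    then show ?thesis using closed_subspace[OF assms] by (auto intro!: closed_vimage continuous_intros)
  qed
  then have "closed (\<Inter>u\<in>U. {g :: 'k^'d^'d. g *v u \<in> U})" by blast
  moreover have "stab U = GL \<inter> (\<Inter>u\<in>U. {g. g *v u \<in> U})" by (auto simp: stab_def)
  ultimately show ?thesis using that by blast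
qed

lemma sets_stab:
  assumes "vec.subspace (U :: ('k::local_field^'d) set)" shows "stab U \<in> sets borel_GL"
proof -
  obtain F where "closed F" "stab U = GL \<inter> F" by (rule stab_closed[OF assms])
  then show ?thesis by (auto simp: borel_GL_def sets_restrict_space)
qed

lemma stab_GL: "g \<in> stab U \<Longrightarrow> g \<in> GL" by (simp add: stab_def)

lemma stab_id: "mat 1 \<in> stab U" by (simp add: stab_def)

lemma stab_mult: "g \<in> stab U \<Longrightarrow> h \<in> stab U \<Longrightarrow> g ** h \<in> stab U"
  by (auto simp: stab_def GL_mult simp flip: matrix_vector_mul_assoc)

text \<open>An injective endomorphism of a finite-dimensional space is onto.\<close>
lemma stab_inv:
  assumes U: "vec.subspace U" and g: "g \<in> stab U" shows "matrix_inv g \<in> stab U"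
proof -
  have gGL: "g \<in> GL" and gU: "\<And>u. u \<in> U \<Longrightarrow> g *v u \<in> U" using g by (auto simp: stab_def)
  have inj: "inj_on ((*v) g) (vec.span U)"
    by (rule inj_onI) (metis GL_mult_inv(1) gGL)
  have "vec.dim ((*v) g ` U) = vec.dim U"
    by (rule vec.dim_image_eq[OF matrix_vector_mul_linear_gen inj])
  then have im: "(*v) g ` U = U"
    using gU U by (intro vec.subspace_dim_equal vec.subspace_image) (auto simp: matrix_vector_mul_linear_gen)
  have "matrix_inv g *v u \<in> U" if u: "u \<in> U" for u
  proof -
    obtain w where "w \<in> U" "u = g *v w" using u im by blast
    then show ?thesis by (simp add: GL_mult_inv(1)[OF gGL])
  qed
  then show ?thesis using GL_inv[OF gGL] by (simp add: stab_def)
qed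

lemma stab_notin:
  assumes "vec.subspace U" "g \<in> stab U" "v \<notin> U" shows "g *v v \<notin> U"
  using stab_inv[OF assms(1,2)] assms(3) GL_mult_inv(1)[OF stab_GL[OF assms(2)], of v]
  by (force simp: stab_def)

lemma lnN_inv: "g \<in> GL \<Longrightarrow> lnN (matrix_inv g) = lnN g"
proof -
  assume g: "g \<in> GL"
  then have "matrix_inv (matrix_inv g) = g"
    by (intro matrix_inv_eqI) (auto simp: GL_def invertible_matrix_inv)
  then show ?thesis by (simp add: lnN_def Nsize_def max.commute)
qed

context random_walk
begin

definition invariant :: "('k^'d) set \<Rightarrow> bool" where
  "invariant U \<longleftrightarrow> vec.subspace U \<and> (AE g in \<mu>. g \<in> stab U)"

text \<open>Almost every matrix maps a finite spanning set of \<open>W\<close> into \<open>W\<close>.\<close>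
lemma invariantI:
  assumes W: "vec.subspace W" and AE: "\<And>w. w \<in> W \<Longrightarrow> AE g in \<mu>. g *v w \<in> W"
  shows "invariant W"
proof -
  obtain B where B: "B \<subseteq> W" "vec.independent B" "W \<subseteq> vec.span B"
    by (rule vec.maximal_independent_subset)
  have "finite B" using B(2) by (rule vec.finiteI_independent)
  then have "AE g in \<mu>. \<forall>w\<in>B. g *v w \<in> W" using AE B(1) by (intro AE_finite_allI) auto
  then have "AE g in \<mu>. g \<in> stab W" using AE_space
  proof eventually_elim
    case (elim g)
    have "g *v w \<in> W" if "w \<in> W" for w
    proof -
      have "(*v) g ` vec.span B = vec.span ((*v) g ` B)"
        by (rule vec.linear_span_image[OF matrix_vector_mul_linear_gen, symmetric])
      also have "\<dots> \<subseteq> W" using elim W by (intro vec.span_minimal) auto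
      finally show ?thesis using that B(3) by blast
    qed
    then show ?case using elim by (simp add: stab_def)
  qed
  then show ?thesis using W by (simp add: invariant_def)
qed

lemma AE_stab: "invariant U \<Longrightarrow> AE g in M n. g \<in> stab U"
  unfolding invariant_def by (intro AE_M sets_stab stab_id stab_mult) auto

text \<open>Since almost every matrix preserves \<open>U\<close>, so does every matrix in the support: the stabiliser is
  closed in the group.\<close>
lemma generated_semigroup_stab:
  assumes "invariant U" shows "generated_semigroup \<mu> \<subseteq> stab U"
proof
  fix g assume "g \<in> generated_semigroup \<mu>"
  then show "g \<in> stab U"
  proof induction
    case (supp g)
    have U: "vec.subspace U" using assms by (simp add: invariant_def)
    obtain F where F: "closed F" "stab U = GL \<inter> F" by (rule stab_closed[OF U])
    show "g \<in> stab U"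
    proof (rule ccontr)
      assume "g \<notin> stab U"
      then have "g \<in> - F" "g \<in> GL" using supp F by (auto simp: supp_def)
      then have "0 < emeasure \<mu> (- F \<inter> GL)" using supp F by (auto simp: supp_def)
      moreover have "emeasure \<mu> (- F \<inter> GL) = 0"
      proof (rule AE_iff_measurable[THEN iffD1])
        show "- F \<inter> GL \<in> sets \<mu>" using F(1) by (auto simp: borel_GL_def sets_restrict_space)
        show "{x \<in> space \<mu>. \<not> x \<in> stab U} = - F \<inter> GL" using F(2) by auto
        show "AE x in \<mu>. x \<in> stab U" using assms by (simp add: invariant_def)
      qed
      ultimately show False by simp
    qed
  qed (rule stab_mult)
qed

text \<open>The increments of \<open>ln q\<close> are bounded below by applying the upper bound to the inverse matrix, which
  has the same \<open>lnN\<close>.\<close>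
lemma walk_function_ln:
  assumes q: "q \<in> borel_measurable borel" and S: "S \<in> sets borel_GL" "mat 1 \<in> S"
    "\<And>g h. g \<in> S \<Longrightarrow> h \<in> S \<Longrightarrow> g ** h \<in> S" "\<And>g. g \<in> S \<Longrightarrow> matrix_inv g \<in> S" "AE g in \<mu>. g \<in> S"
    and D: "\<And>g v. g \<in> S \<Longrightarrow> v \<in> D \<Longrightarrow> g *v v \<in> D" and pos: "\<And>v. v \<in> D \<Longrightarrow> q v > 0"
    and K: "K \<ge> 1" "\<And>g v. g \<in> S \<Longrightarrow> v \<in> D \<Longrightarrow> q (g *v v) \<le> K * exp (lnN g) * q v"
  shows "walk_function \<mu> p (\<lambda>v. ln (q v)) D S (ln K)"
proof
  have up: "ln (q (g *v v)) - ln (q v) \<le> lnN g + ln K" if "g \<in> S" "v \<in> D" for g v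
  proof -
    have "ln (q (g *v v)) \<le> ln (K * exp (lnN g) * q v)"
      using K that pos[of v] pos[OF D[OF that]] by (intro ln_mono) auto
    also have "\<dots> = ln K + lnN g + ln (q v)" using K pos[OF that(2)] by (simp add: ln_mult_pos)
    finally show ?thesis by simp
  qed
  fix g v assume gv: "g \<in> S" "v \<in> D"
  have g: "g \<in> GL" using sets.sets_into_space[OF S(1)] gv by auto
  have "ln (q v) - ln (q (g *v v)) \<le> lnN g + ln K"
    using up[OF S(4)[OF gv(1)] D[OF gv]] by (simp add: GL_mult_inv(1)[OF g] lnN_inv[OF g])
  then show "\<bar>ln (q (g *v v)) - ln (q v)\<bar> \<le> lnN g + ln K" using up[OF gv] by linarith
qed (use assms in auto)

end

lemma (in walk_function) walk_function_minus: "walk_function \<mu> p (\<lambda>v. - f v) D S c"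
proof
  fix g v assume "g \<in> S" "v \<in> D"
  then show "\<bar>- f (g *v v) - - f v\<bar> \<le> lnN g + c" using increment_le[of g v] by (simp add: abs_minus_commute)
qed (use S_id S_mult S_AE D_invariant c_nonneg in auto)

lemma (in walk_function) drift_minus: "walk_function.drift \<mu> (\<lambda>v. - f v) n v = - drift n v"
proof -
  interpret m: walk_function \<mu> p "\<lambda>v. - f v" D S c by (rule walk_function_minus)
  have "m.drift n v = (\<integral>g. - (f (g *v v) - f v) \<partial>M n)" by (simp add: m.drift_def)
  also have "\<dots> = - drift n v" unfolding drift_def by (rule Bochner_Integration.integral_minus)
  finally show ?thesis .
qed

text \<open>The truncated logarithm has the value \<open>0\<close> at \<open>0\<close>, so that no case distinction is needed for vectors
  in the kernel of a seminorm.\<close>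
definition lnplus :: "real \<Rightarrow> real" where "lnplus x = ln (max 1 x)"

lemma lnplus_nonneg [simp]: "lnplus x \<ge> 0" by (simp add: lnplus_def)

lemma lnplus_0 [simp]: "lnplus 0 = 0" by (simp add: lnplus_def)

lemma lnplus_mono: "x \<le> y \<Longrightarrow> lnplus x \<le> lnplus y"
  by (simp add: lnplus_def)

lemma lnplus_eq: "x > 0 \<Longrightarrow> lnplus x = max 0 (ln x)"
  by (auto simp: lnplus_def max_def)

lemma lnplus_mult: "x \<ge> 0 \<Longrightarrow> y \<ge> 0 \<Longrightarrow> lnplus (x * y) \<le> lnplus x + lnplus y"
proof -
  assume xy: "x \<ge> 0" "y \<ge> 0"
  have "x * y \<le> max 1 x * max 1 y" using xy by (intro mult_mono) auto
  moreover have "1 * 1 \<le> max 1 x * max 1 y" by (intro mult_mono) auto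
  ultimately have "lnplus (x * y) \<le> ln (max 1 x * max 1 y)" by (auto simp: lnplus_def intro!: ln_mono)
  also have "\<dots> = lnplus x + lnplus y" by (simp add: lnplus_def ln_mult_pos)
  finally show ?thesis .
qed

lemma lnplus_add: "x \<ge> 0 \<Longrightarrow> y \<ge> 0 \<Longrightarrow> lnplus (x + y) \<le> ln 2 + lnplus x + lnplus y"
proof -
  assume xy: "x \<ge> 0" "y \<ge> 0"
  have "lnplus (x + y) \<le> lnplus (2 * max x y)" by (rule lnplus_mono) auto
  also have "\<dots> \<le> lnplus 2 + lnplus (max x y)" using xy by (intro lnplus_mult) auto
  also have "lnplus 2 = ln 2" by (simp add: lnplus_def)
  also have "lnplus (max x y) \<le> lnplus x + lnplus y"
    by (simp add: max_def add_increasing add_increasing2)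
  finally show ?thesis by simp
qed

lemma borel_measurable_lnplus [measurable]: "lnplus \<in> borel_measurable borel"
  unfolding lnplus_def by measurable

section \<open>Directions of slow growth\<close>

text \<open>The quotient by \<open>U\<close> is realised as the range of \<open>1 - Q\<close> for a linear projection \<open>Q\<close> onto \<open>U\<close>, with
  the seminorm \<open>q\<close> defined below as the quotient norm.\<close>
locale invariant_quotient = random_walk \<mu> p
  for \<mu> :: "('k::local_field^'d^'d) measure" and p +
  fixes U :: "('k^'d) set" and Q :: "'k^'d^'d"
  assumes U: "invariant U" and Q_in: "\<And>v. Q *v v \<in> U" and Q_id: "\<And>u. u \<in> U \<Longrightarrow> Q *v u = u"
begin

definition P :: "'k^'d^'d" where "P = mat 1 - Q"

definition q :: "'k^'d \<Rightarrow> real" where "q v = vnorm (P *v v)"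

definition K :: real where "K = max 1 (opnorm P)"

lemma subspace_U: "vec.subspace U" using U by (simp add: invariant_def)

lemma P_eq: "P *v v = v - Q *v v"
  by (simp add: P_def matrix_vector_mult_diff_rdistrib)

lemma P_eq_0: "P *v v = 0 \<longleftrightarrow> v \<in> U"
  by (metis P_eq Q_id Q_in eq_iff_diff_eq_0)

lemma P_P: "P *v (P *v v) = P *v v"
  by (simp add: P_eq matrix_vector_mult_diff_distrib Q_id[OF Q_in])

lemma q_nonneg [simp]: "q v \<ge> 0" by (simp add: q_def)

lemma q_pos: "q v > 0 \<longleftrightarrow> v \<notin> U" by (simp add: q_def P_eq_0)

lemma q_eq_0: "v \<in> U \<Longrightarrow> q v = 0" by (simp add: q_def P_eq_0)

lemma q_scale: "q (a *s v) = absval a * q v"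
  by (simp add: q_def matrix_vector_mult_scaleR vec.scale vnorm_scale)

lemma q_add_le: "q (v + w) \<le> real CARD('d) * (q v + q w)"
  by (simp add: q_def vec.add vnorm_add_le)

lemma q_P: "q (P *v v) = q v" by (simp add: q_def P_P)

lemma q_le: "q v \<le> K * vnorm v"
  unfolding q_def K_def
  by (rule order_trans[OF vnorm_le_opnorm mult_right_mono]) auto

lemma q_stab_P: "g \<in> stab U \<Longrightarrow> q (g *v (P *v v)) = q (g *v v)"
proof -
  assume g: "g \<in> stab U"
  have "P *v (g *v (P *v v)) = P *v (g *v v) - P *v (g *v (Q *v v))"
    by (simp add: P_eq[of v] matrix_vector_mult_diff_distrib)
  also have "P *v (g *v (Q *v v)) = 0" using g Q_in by (simp add: P_eq_0 stab_def)
  finally show ?thesis by (simp add: q_def)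
qed

lemma continuous_on_q [continuous_intros]: "continuous_on S f \<Longrightarrow> continuous_on S (\<lambda>x. q (f x))"
  unfolding q_def by (intro continuous_intros)

lemma q_measurable [measurable]: "q \<in> borel_measurable borel"
  by (intro borel_measurable_continuous_onI continuous_intros)

lemma q_mult_le: "g \<in> stab U \<Longrightarrow> q (g *v v) \<le> K * exp (lnN g) * q v"
proof -
  assume g: "g \<in> stab U"
  have "q (g *v v) = q (g *v (P *v v))" by (simp add: q_stab_P[OF g])
  also have "\<dots> \<le> K * vnorm (g *v (P *v v))" by (rule q_le)
  also have "\<dots> \<le> K * (exp (lnN g) * vnorm (P *v v))"
    by (intro mult_left_mono vnorm_le_Nsize stab_GL[OF g]) (simp add: K_def)
  finally show ?thesis by (simp add: q_def mult.assoc)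
qed

sublocale walk_function \<mu> p "\<lambda>v. ln (q v)" "- U" "stab U" "ln K"
proof (rule walk_function_ln)
  show "AE g in \<mu>. g \<in> stab U" using U by (simp add: invariant_def)
qed (auto simp: K_def q_pos sets_stab subspace_U stab_id stab_mult stab_inv stab_notin intro: q_mult_le[unfolded K_def])

lemma drift_scale:
  assumes a: "a \<noteq> 0" and v: "v \<notin> U" shows "drift n (a *s v) = drift n v"
proof -
  have "ln (q (g *v (a *s v))) - ln (q (a *s v)) = ln (q (g *v v)) - ln (q v)" if "g \<in> stab U" for g
  proof -
    have "q (g *v v) > 0" using v that stab_notin[OF subspace_U that v] by (simp add: q_pos)
    moreover have "q v > 0" using v by (simp add: q_pos)
    ultimately show ?thesis using a by (simp add: vec.scale q_scale ln_mult_pos)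
  qed
  then show ?thesis
    unfolding drift_def by (intro integral_cong_AE) (use AE_S[of n] in \<open>auto elim: eventually_mono\<close>)
qed

lemma drift_P:
  assumes v: "v \<notin> U" shows "drift n (P *v v) = drift n v"
  unfolding drift_def q_P
  by (intro integral_cong_AE) (use AE_S[of n] in \<open>auto elim: eventually_mono simp: q_stab_P\<close>)

lemma drift_tendsto:
  assumes u: "\<And>i. u i \<notin> U" "w \<notin> U" and lim: "u \<longlonglongrightarrow> w"
  shows "(\<lambda>i. drift n (u i)) \<longlonglongrightarrow> drift n w"
  unfolding drift_def
proof (rule integral_dominated_convergence[where w = "\<lambda>g. lnN g + ln K"])
  interpret Mn: prob_space "M n" by (rule prob_space_M)
  show "integrable (M n) (\<lambda>g. lnN g + ln K)" using integrable_lnN[of n] by simp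
  show "AE g in M n. norm (ln (q (g *v u i)) - ln (q (u i))) \<le> lnN g + ln K" for i
    using AE_S[of n] by eventually_elim (use increment_le[of _ "u i"] u in auto)
  show "AE g in M n. (\<lambda>i. ln (q (g *v u i)) - ln (q (u i))) \<longlonglongrightarrow> ln (q (g *v w)) - ln (q w)"
    using AE_S[of n]
  proof eventually_elim
    case (elim g)
    have c: "(\<lambda>i. q (h *v u i)) \<longlonglongrightarrow> q (h *v w)" for h
    proof -
      have "continuous_on UNIV (\<lambda>v. q (h *v v))" by (intro continuous_intros)
      then show ?thesis by (rule continuous_on_tendsto_compose[OF _ lim]) auto
    qed
    have "q (g *v w) > 0" "q w > 0" using u stab_notin[OF subspace_U elim] by (auto simp: q_pos)
    then show ?case using c[of g] c[of "mat 1"] by (intro tendsto_diff tendsto_ln) auto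
  qed
qed measurable

text \<open>For compactness arguments in the quotient. Multiplication by a power of a fixed scalar normalises \<open>q\<close>
  up to a bounded factor, also if the absolute value takes discrete values only; and \<open>P\<close> replaces a
  vector by one whose norm is \<open>q\<close>.\<close>
lemma normalised_representative:
  "\<exists>R. \<forall>v. v \<notin> U \<longrightarrow> (\<exists>u. u \<notin> U \<and> q u \<ge> 1 \<and> vnorm u \<le> R \<and> (\<forall>n. drift n u = drift n v))"
proof -
  obtain x :: 'k where x: "0 < absval x" "absval x < 1" using exists_absval_between_0_1 by blast
  define \<beta> where "\<beta> = 1 / absval x"
  have \<beta>: "\<beta> > 1" using x by (simp add: \<beta>_def)
  have "\<exists>u. u \<notin> U \<and> q u \<ge> 1 \<and> vnorm u \<le> \<beta> \<and> (\<forall>n. drift n u = drift n v)" if v: "v \<notin> U" for v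
  proof -
    have qv: "q v > 0" using v by (simp add: q_pos)
    \<comment> \<open>The powers of \<open>\<beta>\<close> are values of the absolute value, so
      \<open>q v\<close> can be scaled into the interval from \<open>1\<close> to
      \<open>\<beta>\<close>.\<close>
  define k where "k = \<lceil>- log \<beta> (q v)\<rceil>"
    define a where "a = inverse x powi k"
    have a: "a \<noteq> 0" using x by (auto simp: a_def)
    have "absval a = \<beta> powi k"
      using x by (cases k rule: int_cases2)
        (auto simp: a_def \<beta>_def power_int_minus absval_inverse absval_power divide_inverse power_inverse)
    also have "\<dots> = \<beta> powr real_of_int k" using \<beta> by (simp add: powr_real_of_int')
    finally have abs_a: "absval a * q v = \<beta> powr (real_of_int k + log \<beta> (q v))"
      using \<beta> qv by (simp add: powr_add)
    have "\<beta> powr 0 \<le> \<beta> powr (real_of_int k + log \<beta> (q v))"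
      using \<beta> by (intro powr_mono) (auto simp: k_def, linarith)
    then have ge1: "1 \<le> absval a * q v" using abs_a \<beta> by simp
    have "\<beta> powr (real_of_int k + log \<beta> (q v)) \<le> \<beta> powr 1"
      using \<beta> by (intro powr_mono) (auto simp: k_def, linarith)
    then have le: "absval a * q v \<le> \<beta>" using abs_a \<beta> by simp
    have Pv: "P *v v \<notin> U" using v by (simp add: P_eq_0[symmetric] P_P)
    show ?thesis
    proof (intro exI[of _ "a *s (P *v v)"] conjI allI)
      show "q (a *s (P *v v)) \<ge> 1" using ge1 by (simp add: q_scale q_P)
      then show "a *s (P *v v) \<notin> U" using q_pos[of "a *s (P *v v)"] by simp
      show "vnorm (a *s (P *v v)) \<le> \<beta>" using le by (simp add: vnorm_scale q_def)
      show "drift n (a *s (P *v v)) = drift n v" for n by (simp add: drift_scale[OF a Pv] drift_P[OF v])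
    qed
  qed
  then show ?thesis by blast
qed

end

lemma sum_shift_telescope:
  fixes d :: "nat \<Rightarrow> real"
  shows "(\<Sum>k<T. d (n + k) - d k) = (\<Sum>i<n. d (T + i) - d i)"
proof (induction n)
  case (Suc n)
  have "(\<Sum>k<T. d (Suc n + k) - d k) = (\<Sum>k<T. d (n + k) - d k) + (\<Sum>k<T. d (n + Suc k) - d (n + k))"
    by (simp add: sum.distrib[symmetric])
  also have "(\<Sum>k<T. d (n + Suc k) - d (n + k)) = d (n + T) - d n"
    using sum_lessThan_telescope[of "\<lambda>k. d (n + k)" T] by simp
  finally show ?case using Suc by (simp add: add.commute)
qed simp

lemma sum_half_powers_le: "(\<Sum>j<J. (1 / 2 :: real) ^ j) \<le> 2"
proof -
  have "(\<Sum>j<J. (1 / 2 :: real) ^ j) = 2 - 2 * (1 / 2) ^ J" by (induction J) (auto simp: field_simps)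
  then show ?thesis by simp
qed

context invariant_quotient
begin

text \<open>Along the trajectory started at a point \<open>x\<close> that nearly minimises the drift over a long time
  \<open>T\<close>, the drift over any fixed shorter time \<open>n\<close> is on average close to \<open>n a\<close>. The average over the
  trajectory of the sum below is therefore less than \<open>3\<close>, so that some point of it is as claimed.\<close>
lemma finitely_many_slow_times:
  fixes N :: "nat \<Rightarrow> nat"
  assumes N: "\<And>j. N j \<ge> 1"
    and inf: "\<And>\<eta> n. \<eta> > 0 \<Longrightarrow> \<exists>x. x \<notin> U \<and> drift n x \<le> real n * (a + \<eta>)"
  shows "\<exists>v. v \<notin> U \<and> (\<Sum>j<J. drift (N j) v / real (N j) - a + (1 / 2) ^ j) \<le> 3"
proof (rule ccontr)
  assume neg: "\<not> ?thesis"
  define H where "H v = (\<Sum>j<J. drift (N j) v / real (N j) - a + (1 / 2) ^ j)" for v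
  have H: "H v > 3" if "v \<notin> U" for v using neg that by (auto simp: H_def not_le)
  define A where "A = (\<Sum>j<J. 2 * (real (N j) * mean_lnN + ln K))"
  obtain T :: nat where T: "2 * \<bar>A\<bar> + 1 \<le> real T" using real_arch_simple by blast
  then have T0: "T > 0" by (cases T) auto
  \<comment> \<open>The \<open>J\<close> errors \<open>\<eta>\<close> add up to less than one
    half.\<close>
  define \<eta> where "\<eta> = 1 / (2 * (real J + 1))"
  have \<eta>: "\<eta> > 0" by (simp add: \<eta>_def)
  obtain x where x: "x \<notin> U" "drift T x \<le> real T * (a + \<eta>)" using inf[OF \<eta>, of T] by blast
  have avg: "(\<Sum>k<T. \<integral>h. drift n (h *v x) \<partial>M k) \<le> real n * (drift T x + 2 * (real n * mean_lnN + ln K))" for n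
  proof -
    have "(\<Sum>k<T. \<integral>h. drift n (h *v x) \<partial>M k) = (\<Sum>k<T. drift (n + k) x - drift k x)"
      using x(1) by (intro sum.cong refl) (simp add: drift_add)
    also have "\<dots> = (\<Sum>i<n. drift (T + i) x - drift i x)" by (rule sum_shift_telescope)
    also have "\<dots> \<le> (\<Sum>i<n. drift T x + 2 * (real n * mean_lnN + ln K))"
    proof (intro sum_mono)
      fix i assume i: "i \<in> {..<n}"
      interpret MT: prob_space "M T" by (rule prob_space_M)
      have le: "real i * mean_lnN \<le> real n * mean_lnN" using i mean_lnN_nonneg by (intro mult_right_mono) auto
      have "(\<integral>h. drift i (h *v x) \<partial>M T) \<le> (\<integral>h. real n * mean_lnN + ln K \<partial>M T)"
      proof (rule integral_mono_AE)
        show "AE h in M T. drift i (h *v x) \<le> real n * mean_lnN + ln K"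
          using AE_S[of T]
        proof eventually_elim
          case (elim h)
          then have "h *v x \<in> - U" using D_invariant x(1) by simp
          then show ?case using abs_drift_le[of "h *v x" i] le by linarith
        qed
      qed (use integrable_drift[of x T i] x(1) in auto)
      also have "\<dots> = real n * mean_lnN + ln K" by simp
      finally have "drift (T + i) x \<le> drift T x + (real n * mean_lnN + ln K)"
        using drift_add[of x i T] x(1) by (simp add: add.commute)
      moreover have "- (real n * mean_lnN + ln K) \<le> drift i x"
        using abs_drift_le[of x i] x(1) le by simp
      ultimately have "drift (T + i) x - drift i x \<le> drift T x + (real n * mean_lnN + ln K) - - (real n * mean_lnN + ln K)"
        by (rule diff_mono)
      then show "drift (T + i) x - drift i x \<le> drift T x + 2 * (real n * mean_lnN + ln K)" by simp
    qed
    finally show ?thesis by simp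
  qed
  have "3 * real T = (\<Sum>k<T. 3)" by simp
  also have "\<dots> \<le> (\<Sum>k<T. \<Sum>j<J. (\<integral>h. drift (N j) (h *v x) \<partial>M k) / real (N j) - a + (1 / 2) ^ j)"
  proof (intro sum_mono)
    fix k
    interpret Mk: prob_space "M k" by (rule prob_space_M)
    have int: "integrable (M k) (\<lambda>h. drift (N j) (h *v x) / real (N j) - a + (1 / 2) ^ j)" for j
      using integrable_drift[of x k "N j"] x(1) by simp
    have "(3 :: real) = (\<integral>h. 3 \<partial>M k)" by simp
    also have "\<dots> \<le> (\<integral>h. H (h *v x) \<partial>M k)"
    proof (rule integral_mono_AE)
      show "integrable (M k) (\<lambda>h. H (h *v x))" unfolding H_def using int by simp
      show "AE h in M k. 3 \<le> H (h *v x)"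
        using AE_S[of k] by eventually_elim (use H D_invariant x(1) in \<open>force intro: less_imp_le\<close>)
    qed simp
    also have "\<dots> = (\<Sum>j<J. \<integral>h. drift (N j) (h *v x) / real (N j) - a + (1 / 2) ^ j \<partial>M k)"
      unfolding H_def by (rule Bochner_Integration.integral_sum) (rule int)
    also have "\<dots> = (\<Sum>j<J. (\<integral>h. drift (N j) (h *v x) \<partial>M k) / real (N j) - a + (1 / 2) ^ j)"
      using integrable_drift[of x k] x(1) by (intro sum.cong refl) simp
    finally show "3 \<le> (\<Sum>j<J. (\<integral>h. drift (N j) (h *v x) \<partial>M k) / real (N j) - a + (1 / 2) ^ j)" .
  qed
  also have "\<dots> = (\<Sum>j<J. \<Sum>k<T. (\<integral>h. drift (N j) (h *v x) \<partial>M k) / real (N j) - a + (1 / 2) ^ j)"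
    by (rule sum.swap)
  also have "\<dots> \<le> (\<Sum>j<J. real T * \<eta> + 2 * (real (N j) * mean_lnN + ln K) + real T * (1 / 2) ^ j)"
  proof (intro sum_mono)
    fix j
    have "(\<Sum>k<T. (\<integral>h. drift (N j) (h *v x) \<partial>M k) / real (N j) - a + (1 / 2) ^ j)
        = (\<Sum>k<T. \<integral>h. drift (N j) (h *v x) \<partial>M k) / real (N j) - real T * a + real T * (1 / 2) ^ j"
      by (simp add: sum.distrib sum_subtractf sum_divide_distrib)
    also have "(\<Sum>k<T. \<integral>h. drift (N j) (h *v x) \<partial>M k) / real (N j) \<le> drift T x + 2 * (real (N j) * mean_lnN + ln K)"
      using avg[of "N j"] N[of j] by (simp add: divide_le_eq mult.commute)
    also have "drift T x \<le> real T * (a + \<eta>)" by (rule x(2))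
    finally show "(\<Sum>k<T. (\<integral>h. drift (N j) (h *v x) \<partial>M k) / real (N j) - a + (1 / 2) ^ j)
        \<le> real T * \<eta> + 2 * (real (N j) * mean_lnN + ln K) + real T * (1 / 2) ^ j" by (simp add: algebra_simps)
  qed
  also have "\<dots> = real J * (real T * \<eta>) + A + real T * (\<Sum>j<J. (1 / 2) ^ j)"
    by (simp add: sum.distrib A_def sum_distrib_left)
  also have "\<dots> \<le> real J * (real T * \<eta>) + A + real T * 2"
    by (intro add_left_mono mult_left_mono sum_half_powers_le) simp
  also have "real J * (real T * \<eta>) < real T / 2" using T0 by (simp add: \<eta>_def field_simps)
  finally show False using T by linarith
qed

lemma bounded_vnorm: "bounded {u :: 'k^'d. vnorm u \<le> R}"
proof -
  have "dist 0 u \<le> real CARD('d) * R" if "vnorm u \<le> R" for u :: "'k^'d"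
  proof -
    have "dist 0 u \<le> (\<Sum>i\<in>UNIV. dist (0 $ i) (u $ i))" unfolding dist_vec_def
      by (rule L2_set_le_sum) simp
    also have "\<dots> \<le> (\<Sum>i\<in>(UNIV :: 'd set). R)"
      by (intro sum_mono) (use order_trans[OF vnorm_ge_coord that] in \<open>simp add: dist_absval\<close>)
    finally show ?thesis by simp
  qed
  then show ?thesis unfolding bounded_any_center[of _ 0] by blast
qed

text \<open>Compactness turns the finitely many conditions of \<open>finitely_many_slow_times\<close> into infinitely
  many.\<close>
lemma infinitely_many_slow_times:
  fixes N :: "nat \<Rightarrow> nat"
  assumes N: "\<And>j. N j \<ge> 1"
    and inf: "\<And>\<eta> n. \<eta> > 0 \<Longrightarrow> \<exists>x. x \<notin> U \<and> drift n x \<le> real n * (a + \<eta>)"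
    and nonneg: "\<And>j v. v \<notin> U \<Longrightarrow> 0 \<le> drift (N j) v / real (N j) - a + (1 / 2) ^ j"
  obtains u where "u \<notin> U" "\<And>J. (\<Sum>j<J. drift (N j) u / real (N j) - a + (1 / 2) ^ j) \<le> 3"
proof -
  define G where "G j v = drift (N j) v / real (N j) - a + (1 / 2) ^ j" for j v
  obtain R where R: "\<And>v. v \<notin> U \<Longrightarrow> \<exists>u. u \<notin> U \<and> q u \<ge> 1 \<and> vnorm u \<le> R \<and> (\<forall>n. drift n u = drift n v)"
    using normalised_representative by blast
  have "\<exists>u. u \<notin> U \<and> q u \<ge> 1 \<and> vnorm u \<le> R \<and> (\<Sum>j<J. G j u) \<le> 3" for J
  proof -
    have "\<exists>v. v \<notin> U \<and> (\<Sum>j<J. G j v) \<le> 3"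
      unfolding G_def by (rule finitely_many_slow_times[OF N]) (rule inf)
    then obtain v where v: "v \<notin> U" "(\<Sum>j<J. G j v) \<le> 3" by blast
    obtain u where "u \<notin> U" "q u \<ge> 1" "vnorm u \<le> R" "\<forall>n. drift n u = drift n v" using R[OF v(1)] by blast
    then show ?thesis using v(2) by (intro exI[of _ u]) (simp add: G_def)
  qed
  then have "\<exists>u. \<forall>J. u J \<notin> U \<and> q (u J) \<ge> 1 \<and> vnorm (u J) \<le> R \<and> (\<Sum>j<J. G j (u J)) \<le> 3"
    by (intro choice allI)
  then obtain u where u: "\<And>J. u J \<notin> U" "\<And>J. q (u J) \<ge> 1" "\<And>J. vnorm (u J) \<le> R"
    "\<And>J. (\<Sum>j<J. G j (u J)) \<le> 3" by blast
  have "bounded (range u)" by (rule bounded_subset[OF bounded_vnorm[of R]]) (use u(3) in auto)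
  then obtain w r where r: "strict_mono (r :: nat \<Rightarrow> nat)" and w: "(u \<circ> r) \<longlonglongrightarrow> w"
    using bounded_imp_convergent_subsequence by blast
  have "(\<lambda>i. q ((u \<circ> r) i)) \<longlonglongrightarrow> q w"
  proof -
    have "continuous_on UNIV (\<lambda>v. q v)" by (intro continuous_intros)
    then show ?thesis by (rule continuous_on_tendsto_compose[OF _ w]) auto
  qed
  then have "1 \<le> q w" using u(2) by (intro LIMSEQ_le_const) auto
  then have wU: "w \<notin> U" using q_pos[of w] by simp
  have "(\<Sum>j<J. G j w) \<le> 3" for J
  proof (rule LIMSEQ_le_const2)
    show "(\<lambda>i. \<Sum>j<J. G j ((u \<circ> r) i)) \<longlonglongrightarrow> (\<Sum>j<J. G j w)"
      unfolding G_def using u(1) wU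
      by (intro tendsto_sum tendsto_add tendsto_diff tendsto_divide tendsto_const drift_tendsto w)
        (use N in \<open>auto simp: Suc_le_eq\<close>)
    have "(\<Sum>j<J. G j ((u \<circ> r) i)) \<le> 3" if "i \<ge> J" for i
    proof -
      have "J \<le> r i" using seq_suble[OF r, of i] that by simp
      then have "(\<Sum>j<J. G j ((u \<circ> r) i)) \<le> (\<Sum>j<r i. G j ((u \<circ> r) i))"
        using nonneg[OF u(1)] by (intro sum_mono2) (auto simp: G_def)
      also have "\<dots> \<le> 3" using u(4)[of "r i"] by simp
      finally show ?thesis .
    qed
    then show "\<exists>N. \<forall>i\<ge>N. (\<Sum>j<J. G j ((u \<circ> r) i)) \<le> 3" by blast
  qed
  then show ?thesis using that[of w] wU by (simp add: G_def)
qed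

text \<open>Let \<open>a\<close> be the asymptotic least drift per step on the quotient by \<open>U\<close>. Then the vectors whose
  growth rates exceed \<open>a\<close> by summable amounts in mean, along a sequence \<open>N\<close> of times, form an
  invariant subspace. Summability over the sequence makes the invariance a statement about almost every
  matrix, rather than about a subsequence depending on the matrix. The deviations below the drift are
  small in mean; this allows passing from the mean of the growth rate, which can be made small, to the
  mean of its positive part, which is subadditive in the vector up to a constant.\<close>
lemma slow_extension:
  assumes low: "\<And>\<eta>. \<eta> > 0 \<Longrightarrow> \<exists>m\<ge>1. \<forall>v\<in>- U. real m * (a - \<eta>) \<le> drift m v"
    and inf: "\<And>\<eta> n. \<eta> > 0 \<Longrightarrow> \<exists>x. x \<notin> U \<and> drift n x \<le> real n * (a + \<eta>)"
  obtains W N where "invariant W" "U \<subset> W" "\<And>j. N j \<ge> (j :: nat)"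
    "\<And>w \<eta>. w \<in> W \<Longrightarrow> \<eta> > 0 \<Longrightarrow>
      (\<lambda>j. measure (M (N j)) {g\<in>GL. q (g *v w) > exp ((a + \<eta>) * real (N j))}) \<longlonglongrightarrow> 0"
proof -
  \<comment> \<open>The times grow so fast that errors of order \<open>1 / N j\<close> are
    summable.\<close>
  have "\<exists>n. n \<ge> 2 ^ j \<and> (\<forall>v\<in>- U. (\<integral>g. max 0 (a * real n - (ln (q (g *v v)) - ln (q v))) \<partial>M n) \<le> (1 / 2) ^ j * real n)" for j
  proof -
    obtain n0 where "\<And>n v. n \<ge> n0 \<Longrightarrow> v \<in> - U \<Longrightarrow>
      (\<integral>g. max 0 (a * real n - (ln (q (g *v v)) - ln (q v))) \<partial>M n) \<le> (1 / 2) ^ j * real n"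
      using lower_deviation_mean[OF low, of "(1 / 2) ^ j"] by auto
    then show ?thesis by (intro exI[of _ "max n0 (2 ^ j)"]) auto
  qed
  then obtain N where N2: "\<And>j. N j \<ge> 2 ^ j"
    and N: "\<And>j v. v \<notin> U \<Longrightarrow> (\<integral>g. max 0 (a * real (N j) - (ln (q (g *v v)) - ln (q v))) \<partial>M (N j)) \<le> (1 / 2) ^ j * real (N j)"
    by (metis ComplI)
  have N1: "N j \<ge> 1" for j using N2[of j] by (meson one_le_numeral one_le_power order_trans)
  have Npos: "real (N j) > 0" for j using N1[of j] by simp
  have N_large: "N j \<ge> j" for j using N2[of j] less_exp[of j] by linarith
  have inv_N: "1 / real (N j) \<le> (1 / 2) ^ j" for j
  proof -
    have "real (2 ^ j) \<le> real (N j)" using N2[of j] by (rule of_nat_mono)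
    then show ?thesis by (simp add: power_one_over frac_le)
  qed
  have summable_const: "(\<Sum>j. ennreal (C / real (N j))) < \<infinity>" if "C \<ge> 0" for C :: real
  proof -
    have s: "summable (\<lambda>j. C * (1 / 2 :: real) ^ j)" by (intro summable_mult summable_geometric) simp
    have "(\<Sum>j. ennreal (C / real (N j))) \<le> (\<Sum>j. ennreal (C * (1 / 2) ^ j))"
    proof (intro suminf_le ennreal_leI)
      show "C / real (N j) \<le> C * (1 / 2) ^ j" for j using mult_left_mono[OF inv_N that, of j] by simp
    qed auto
    also have "\<dots> = ennreal (\<Sum>j. C * (1 / 2) ^ j)" using that by (intro suminf_ennreal2 s) auto
    finally show ?thesis by (simp add: le_less_trans)
  qed
  define \<Lambda> where "\<Lambda> j g w = lnplus (exp (- a * real (N j)) * q (g *v w))" for j and g :: "'k^'d^'d" and w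
  define t where "t j w = (\<integral>\<^sup>+g. ennreal (\<Lambda> j g w / real (N j)) \<partial>M (N j))" for j w
  \<comment> \<open>The sums bound the positive parts of the deviations of the growth rates from
    \<open>a\<close>.\<close>
  define W where "W = {w. (\<Sum>j. t j w) < \<infinity>}"
  have \<Lambda>_measurable [measurable]: "(\<lambda>g. \<Lambda> j g w) \<in> borel_measurable borel_GL" for j w
    unfolding \<Lambda>_def by measurable
  have t_measurable [measurable]: "t j \<in> borel_measurable borel" for j
  proof -
    interpret MN: prob_space "M (N j)" by (rule prob_space_M)
    have "(\<lambda>w. \<integral>\<^sup>+g. ennreal (lnplus (exp (- a * real (N j)) * q (g *v w)) / real (N j)) \<partial>M (N j)) \<in> borel_measurable borel"
      by measurable
    moreover have "t j = (\<lambda>w. \<integral>\<^sup>+g. ennreal (lnplus (exp (- a * real (N j)) * q (g *v w)) / real (N j)) \<partial>M (N j))"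
      by (rule ext) (simp add: t_def \<Lambda>_def)
    ultimately show ?thesis by (simp only:)
  qed
  have t_const: "(\<integral>\<^sup>+g. ennreal (C / real (N j)) + F g \<partial>M (N j)) = ennreal (C / real (N j)) + (\<integral>\<^sup>+g. F g \<partial>M (N j))"
    if [measurable]: "F \<in> borel_measurable borel_GL" for C j F
    using prob_space.emeasure_space_1[OF prob_space_M, of "N j"] by (subst nn_integral_add) auto
  have W_I: "x \<in> W" if "y \<in> W" "z \<in> W" and C: "C \<ge> 0" and le: "\<And>j g. \<Lambda> j g x \<le> C + (\<Lambda> j g y + \<Lambda> j g z)" for x y z C
  proof -
    have "t j x \<le> ennreal (C / real (N j)) + (t j y + t j z)" for j
    proof -
      have "t j x \<le> (\<integral>\<^sup>+g. ennreal (C / real (N j)) + (ennreal (\<Lambda> j g y / real (N j)) + ennreal (\<Lambda> j g z / real (N j))) \<partial>M (N j))"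
        unfolding t_def
      proof (intro nn_integral_mono)
        fix g
        have "\<Lambda> j g x / real (N j) \<le> C / real (N j) + (\<Lambda> j g y / real (N j) + \<Lambda> j g z / real (N j))"
          using divide_right_mono[OF le[of j g], of "real (N j)"] by (simp add: add_divide_distrib)
        then have "ennreal (\<Lambda> j g x / real (N j)) \<le> ennreal (C / real (N j) + (\<Lambda> j g y / real (N j) + \<Lambda> j g z / real (N j)))"
          by (rule ennreal_leI)
        then show "ennreal (\<Lambda> j g x / real (N j)) \<le> ennreal (C / real (N j)) + (ennreal (\<Lambda> j g y / real (N j)) + ennreal (\<Lambda> j g z / real (N j)))"
          using C by (simp add: \<Lambda>_def ennreal_plus)
      qed
      also have "\<dots> = ennreal (C / real (N j)) + (t j y + t j z)"
        unfolding t_def by (subst t_const) (auto simp: nn_integral_add)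
      finally show ?thesis .
    qed
    then have "(\<Sum>j. t j x) \<le> (\<Sum>j. ennreal (C / real (N j)) + (t j y + t j z))" by (intro suminf_le) auto
    also have "\<dots> = (\<Sum>j. ennreal (C / real (N j))) + ((\<Sum>j. t j y) + (\<Sum>j. t j z))"
      by (simp add: suminf_add)
    also have "\<dots> < \<infinity>" using that(1,2) summable_const[OF C] by (simp add: W_def)
    finally show ?thesis by (simp add: W_def)
  qed
  have \<Lambda>_0: "\<Lambda> j g 0 = 0" for j g by (simp add: \<Lambda>_def q_def)
  then have zero: "0 \<in> W" by (simp add: W_def t_def)
  have sub: "vec.subspace W"
    unfolding vec.subspace_def
  proof (intro conjI ballI allI zero)
    fix v w assume v: "v \<in> W" and w: "w \<in> W"
    let ?d = "real CARD('d)"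
    have "\<Lambda> j g (v + w) \<le> ln 2 + 2 * lnplus ?d + (\<Lambda> j g v + \<Lambda> j g w)" for j g
    proof -
      let ?e = "exp (- a * real (N j))"
      have "\<Lambda> j g (v + w) \<le> lnplus (?d * (?e * q (g *v v)) + ?d * (?e * q (g *v w)))"
        unfolding \<Lambda>_def using mult_left_mono[OF q_add_le[of "g *v v" "g *v w"], of ?e]
        by (intro lnplus_mono) (simp add: vec.add algebra_simps)
      also have "\<dots> \<le> ln 2 + lnplus (?d * (?e * q (g *v v))) + lnplus (?d * (?e * q (g *v w)))"
        by (intro lnplus_add) auto
      also have "\<dots> \<le> ln 2 + (lnplus ?d + \<Lambda> j g v) + (lnplus ?d + \<Lambda> j g w)"
        unfolding \<Lambda>_def by (intro add_mono order_refl lnplus_mult) auto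
      finally show ?thesis by simp
    qed
    then show "v + w \<in> W" by (rule W_I[OF v w, rotated]) simp
  next
    fix b :: 'k and w assume w: "w \<in> W"
    have "\<Lambda> j g (b *s w) \<le> lnplus (absval b) + (\<Lambda> j g w + \<Lambda> j g 0)" for j g
    proof -
      have "\<Lambda> j g (b *s w) = lnplus (absval b * (exp (- a * real (N j)) * q (g *v w)))"
        by (simp add: \<Lambda>_def vec.scale q_scale algebra_simps)
      also have "\<dots> \<le> lnplus (absval b) + \<Lambda> j g w" unfolding \<Lambda>_def by (rule lnplus_mult) auto
      finally show ?thesis by (simp add: \<Lambda>_0)
    qed
    then show "b *s w \<in> W" by (rule W_I[OF w zero, rotated]) simp
  qed
  have invariant: "invariant W"
  proof (rule invariantI[OF sub])
    fix w assume w: "w \<in> W"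
    define C where "C = mean_lnN + ln K"
    have lnK: "ln K \<ge> 0" by (rule c_nonneg)
    have C: "C \<ge> 0" using mean_lnN_nonneg lnK by (simp add: C_def)
    have "(\<integral>\<^sup>+h. t j (h *v w) \<partial>\<mu>) \<le> ennreal (C / real (N j)) + t j w" for j
    proof -
      have "(\<integral>\<^sup>+h. t j (h *v w) \<partial>\<mu>) = (\<integral>\<^sup>+h. \<integral>\<^sup>+g. ennreal (\<Lambda> j (g ** h) w / real (N j)) \<partial>M (N j) \<partial>M (Suc 0))"
        by (simp add: t_def \<Lambda>_def M_1 matrix_vector_mul_assoc del: conv_power.simps)
      also have "\<dots> = (\<integral>\<^sup>+g. ennreal (\<Lambda> j g w / real (N j)) \<partial>M (N j + Suc 0))"
        by (rule nn_integral_M_add[symmetric]) measurable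
      also have "\<dots> = (\<integral>\<^sup>+g. ennreal (\<Lambda> j g w / real (N j)) \<partial>M (Suc 0 + N j))" by (simp add: add.commute)
      also have "\<dots> = (\<integral>\<^sup>+h. \<integral>\<^sup>+g. ennreal (\<Lambda> j (g ** h) w / real (N j)) \<partial>M (Suc 0) \<partial>M (N j))"
        by (rule nn_integral_M_add) measurable
      also have "\<dots> \<le> (\<integral>\<^sup>+h. ennreal (C / real (N j)) + ennreal (\<Lambda> j h w / real (N j)) \<partial>M (N j))"
      proof (rule nn_integral_mono_AE)
        show "AE h in M (N j). (\<integral>\<^sup>+g. ennreal (\<Lambda> j (g ** h) w / real (N j)) \<partial>M (Suc 0))
            \<le> ennreal (C / real (N j)) + ennreal (\<Lambda> j h w / real (N j))"
        proof (rule AE_I2)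
          fix h
          have le: "\<Lambda> j (g ** h) w \<le> (lnN g + ln K) + \<Lambda> j h w" if g: "g \<in> stab U" for g
          proof -
            let ?e = "exp (- a * real (N j))"
            have K: "K > 0" by (simp add: K_def)
            have "\<Lambda> j (g ** h) w \<le> lnplus (K * exp (lnN g) * (?e * q (h *v w)))"
              unfolding \<Lambda>_def using mult_left_mono[OF q_mult_le[OF g, of "h *v w"], of ?e]
              by (intro lnplus_mono) (simp add: matrix_vector_mul_assoc[symmetric] algebra_simps)
            also have "\<dots> \<le> lnplus (K * exp (lnN g)) + \<Lambda> j h w"
              unfolding \<Lambda>_def using K by (intro lnplus_mult) auto
            also have "lnplus (K * exp (lnN g)) = lnN g + ln K"
              using K lnK lnN_nonneg[OF stab_GL[OF g]] by (simp add: lnplus_eq ln_mult_pos)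
            finally show ?thesis .
          qed
          have int: "integrable \<mu> (\<lambda>g. ((lnN g + ln K) + \<Lambda> j h w) / real (N j))" using integrable_lnN_\<mu> by simp
          have "(\<integral>\<^sup>+g. ennreal (\<Lambda> j (g ** h) w / real (N j)) \<partial>M (Suc 0))
              \<le> (\<integral>\<^sup>+g. ennreal (((lnN g + ln K) + \<Lambda> j h w) / real (N j)) \<partial>\<mu>)"
            unfolding M_1 by (rule nn_integral_mono_AE)
              (use S_AE in eventually_elim, intro ennreal_leI divide_right_mono le, simp_all)
          also have "\<dots> = ennreal (\<integral>g. ((lnN g + ln K) + \<Lambda> j h w) / real (N j) \<partial>\<mu>)"
            by (rule nn_integral_eq_integral[OF int], rule AE_I2) (use lnK in \<open>simp add: lnN_nonneg \<Lambda>_def\<close>)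
          also have "(\<integral>g. ((lnN g + ln K) + \<Lambda> j h w) / real (N j) \<partial>\<mu>) = C / real (N j) + \<Lambda> j h w / real (N j)"
            using integrable_lnN_\<mu> by (simp add: C_def mean_lnN_def add_divide_distrib)
          also have "ennreal \<dots> = ennreal (C / real (N j)) + ennreal (\<Lambda> j h w / real (N j))"
            using C by (simp add: \<Lambda>_def ennreal_plus)
          finally show "(\<integral>\<^sup>+g. ennreal (\<Lambda> j (g ** h) w / real (N j)) \<partial>M (Suc 0))
            \<le> ennreal (C / real (N j)) + ennreal (\<Lambda> j h w / real (N j))" .
        qed
      qed
      also have "\<dots> = ennreal (C / real (N j)) + t j w" unfolding t_def by (subst t_const) auto
      finally show ?thesis .
    qed
    then have "(\<Sum>j. \<integral>\<^sup>+h. t j (h *v w) \<partial>\<mu>) \<le> (\<Sum>j. ennreal (C / real (N j)) + t j w)" by (intro suminf_le) auto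
    also have "\<dots> = (\<Sum>j. ennreal (C / real (N j))) + (\<Sum>j. t j w)" by (simp add: suminf_add)
    also have "\<dots> < \<infinity>" using w summable_const[OF C] by (simp add: W_def)
    finally have fin: "(\<integral>\<^sup>+h. (\<Sum>j. t j (h *v w)) \<partial>\<mu>) < \<infinity>" by (subst nn_integral_suminf) auto
    have "AE h in \<mu>. (\<Sum>j. t j (h *v w)) \<noteq> \<infinity>"
      by (rule nn_integral_noteq_infinite) (use fin in auto)
    then show "AE h in \<mu>. h *v w \<in> W" by eventually_elim (auto simp: W_def less_top)
  qed
  have U_sub: "U \<subseteq> W"
  proof
    fix u assume u: "u \<in> U"
    have "t j u = 0" for j
    proof -
      have "AE g in M (N j). ennreal (\<Lambda> j g u / real (N j)) = 0"
        using AE_S[of "N j"] by eventually_elim (use u in \<open>auto simp: \<Lambda>_def q_eq_0 stab_def\<close>)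
      then have "t j u = (\<integral>\<^sup>+g. 0 \<partial>M (N j))" unfolding t_def by (rule nn_integral_cong_AE)
      then show ?thesis by simp
    qed
    then show "u \<in> W" by (simp add: W_def)
  qed
  have mean_le: "t j v \<le> ennreal (drift (N j) v / real (N j) - a + (1 / 2) ^ j + \<bar>ln (q v)\<bar> / real (N j))"
    and nonneg: "0 \<le> drift (N j) v / real (N j) - a + (1 / 2) ^ j" if v: "v \<notin> U" for j v
  proof -
    interpret MN: prob_space "M (N j)" by (rule prob_space_M)
    let ?X = "\<lambda>g. ln (q (g *v v)) - ln (q v)"
    let ?m = "\<lambda>g. max 0 (a * real (N j) - ?X g)"
    have X: "integrable (M (N j)) ?X" using v by (intro integrable_increment) simp
    have m: "integrable (M (N j)) ?m" using X by (intro integrable_max) auto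
    have "a * real (N j) - drift (N j) v = (\<integral>g. a * real (N j) - ?X g \<partial>M (N j))"
      using X by (simp add: drift_def)
    also have "\<dots> \<le> (\<integral>g. ?m g \<partial>M (N j))" using X m by (intro integral_mono) auto
    also have "\<dots> \<le> (1 / 2) ^ j * real (N j)" by (rule N[OF v])
    finally have "(a - (1 / 2) ^ j) * real (N j) \<le> drift (N j) v" by (simp add: algebra_simps)
    then show "0 \<le> drift (N j) v / real (N j) - a + (1 / 2) ^ j" using Npos[of j] by (simp add: field_simps)
    let ?B = "\<lambda>g. (?X g - a * real (N j) + ?m g + \<bar>ln (q v)\<bar>) / real (N j)"
    have B: "integrable (M (N j)) ?B" using X m by simp
    have "AE g in M (N j). ennreal (\<Lambda> j g v / real (N j)) \<le> ennreal (?B g)"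
      using AE_S[of "N j"]
    proof eventually_elim
      case (elim g)
      have "q (g *v v) > 0" using stab_notin[OF subspace_U elim v] by (simp add: q_pos)
      then have "\<Lambda> j g v = max 0 (ln (q (g *v v)) - a * real (N j))"
        by (simp add: \<Lambda>_def lnplus_eq ln_mult_pos)
      also have "\<dots> \<le> ?X g - a * real (N j) + ?m g + \<bar>ln (q v)\<bar>" by (auto simp: max_def)
      finally show ?case by (intro ennreal_leI divide_right_mono) auto
    qed
    then have "t j v \<le> (\<integral>\<^sup>+g. ennreal (?B g) \<partial>M (N j))" unfolding t_def by (rule nn_integral_mono_AE)
    also have "\<dots> = ennreal (\<integral>g. ?B g \<partial>M (N j))"
      by (rule nn_integral_eq_integral[OF B]) (auto simp: max_def)
    also have "(\<integral>g. ?B g \<partial>M (N j)) = (drift (N j) v - a * real (N j) + (\<integral>g. ?m g \<partial>M (N j)) + \<bar>ln (q v)\<bar>) / real (N j)"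
      using X m by (simp add: drift_def)
    also have "\<dots> \<le> (drift (N j) v - a * real (N j) + (1 / 2) ^ j * real (N j) + \<bar>ln (q v)\<bar>) / real (N j)"
      using N[OF v, of j] by (intro divide_right_mono) auto
    also have "\<dots> = drift (N j) v / real (N j) - a + (1 / 2) ^ j + \<bar>ln (q v)\<bar> / real (N j)"
      using Npos[of j] by (simp add: field_simps)
    finally show "t j v \<le> ennreal (drift (N j) v / real (N j) - a + (1 / 2) ^ j + \<bar>ln (q v)\<bar> / real (N j))"
      by (simp add: ennreal_leI)
  qed
  obtain u where u: "u \<notin> U" "\<And>J. (\<Sum>j<J. drift (N j) u / real (N j) - a + (1 / 2) ^ j) \<le> 3"
    using infinitely_many_slow_times[of N a, OF N1 inf nonneg] by blast
  have "u \<in> W"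
  proof -
    let ?G = "\<lambda>j. drift (N j) u / real (N j) - a + (1 / 2) ^ j"
    have sG: "summable ?G" by (rule summableI_nonneg_bounded[where x = 3]) (use nonneg[OF u(1)] u(2) in auto)
    have "(\<Sum>j. t j u) \<le> (\<Sum>j. ennreal (?G j) + ennreal (\<bar>ln (q u)\<bar> / real (N j)))"
    proof (intro suminf_le)
      show "t j u \<le> ennreal (?G j) + ennreal (\<bar>ln (q u)\<bar> / real (N j))" for j
        using mean_le[OF u(1), of j] nonneg[OF u(1), of j] by (simp flip: ennreal_plus)
    qed auto
    also have "\<dots> = ennreal (\<Sum>j. ?G j) + (\<Sum>j. ennreal (\<bar>ln (q u)\<bar> / real (N j)))"
      using suminf_ennreal2[OF nonneg[OF u(1)] sG] by (simp add: suminf_add[symmetric])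
    also have "\<dots> < \<infinity>" using summable_const[OF abs_ge_zero[of "ln (q u)"]]
      by (simp only: infinity_ennreal_def ennreal_add_less_top ennreal_less_top simp_thms)
    finally show ?thesis by (simp add: W_def)
  qed
  then have "U \<subset> W" using U_sub u(1) by blast
  moreover have "(\<lambda>j. measure (M (N j)) {g\<in>GL. q (g *v w) > exp ((a + \<eta>) * real (N j))}) \<longlonglongrightarrow> 0"
    if w: "w \<in> W" and \<eta>: "\<eta> > 0" for w \<eta>
  proof -
    let ?A = "\<lambda>j. {g\<in>GL. q (g *v w) > exp ((a + \<eta>) * real (N j))}"
    have A [measurable]: "?A j \<in> sets borel_GL" for j
      by (rule sets_GL_Collect) measurable
    have le: "ennreal (\<eta> * measure (M (N j)) (?A j)) \<le> t j w" for j
    proof -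
      interpret MN: prob_space "M (N j)" by (rule prob_space_M)
      have "ennreal (\<eta> * measure (M (N j)) (?A j)) = (\<integral>\<^sup>+g. ennreal \<eta> * indicator (?A j) g \<partial>M (N j))"
        using \<eta> by (subst nn_integral_cmult_indicator) (auto simp: MN.emeasure_eq_measure ennreal_mult)
      also have "\<dots> \<le> t j w" unfolding t_def
      proof (rule nn_integral_mono)
        fix g
        show "ennreal \<eta> * indicator (?A j) g \<le> ennreal (\<Lambda> j g w / real (N j))"
        proof (cases "g \<in> ?A j")
          case True
          have "exp (\<eta> * real (N j)) = exp (- a * real (N j)) * exp ((a + \<eta>) * real (N j))"
            by (simp add: algebra_simps flip: exp_add)
          also have "\<dots> \<le> exp (- a * real (N j)) * q (g *v w)" using True by (intro mult_left_mono) auto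
          finally have "lnplus (exp (\<eta> * real (N j))) \<le> \<Lambda> j g w" unfolding \<Lambda>_def by (rule lnplus_mono)
          then have "\<eta> * real (N j) \<le> \<Lambda> j g w" by (simp add: lnplus_eq)
          then have "\<eta> \<le> \<Lambda> j g w / real (N j)" using Npos[of j] by (simp add: field_simps)
          then show ?thesis using True by (simp add: ennreal_leI)
        qed simp
      qed
      finally show ?thesis .
    qed
    have "(\<Sum>j. ennreal (\<eta> * measure (M (N j)) (?A j))) \<le> (\<Sum>j. t j w)" by (intro suminf_le le) auto
    then have "(\<Sum>j. ennreal (\<eta> * measure (M (N j)) (?A j))) \<noteq> top" using w by (auto simp: W_def top_unique)
    then have "summable (\<lambda>j. \<eta> * measure (M (N j)) (?A j))" using \<eta> by (intro summable_suminf_not_top) auto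
    then have "(\<lambda>j. \<eta> * measure (M (N j)) (?A j)) \<longlonglongrightarrow> 0" by (rule summable_LIMSEQ_zero)
    then have "(\<lambda>j. inverse \<eta> * (\<eta> * measure (M (N j)) (?A j))) \<longlonglongrightarrow> inverse \<eta> * 0" by (intro tendsto_mult_left)
    then show ?thesis using \<eta> by (simp add: field_simps)
  qed
  ultimately show ?thesis using that[OF invariant _ N_large] by blast
qed

end

section \<open>The Lyapunov exponent\<close>

text \<open>Fekete's lemma: division with remainder compares \<open>u n\<close> with a multiple of \<open>u m\<close>.\<close>
lemma subadditive_converges:
  fixes u :: "nat \<Rightarrow> real"
  assumes sub: "\<And>m n. u (m + n) \<le> u m + u n" and low: "\<And>n. - C * real n \<le> u n"
  shows "\<exists>L. (\<lambda>n. u n / real n) \<longlonglongrightarrow> L \<and> (\<forall>n\<ge>1. L \<le> u n / real n)"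
proof -
  let ?S = "(\<lambda>n. u n / real n) ` {1..}"
  have "- C \<le> u n / real n" if "n \<ge> 1" for n
    using low[of n] that by (simp add: field_simps)
  then have bdd: "bdd_below ?S" by (auto intro!: bdd_belowI)
  define L where "L = Inf ?S"
  have L: "L \<le> u n / real n" if "n \<ge> 1" for n
    unfolding L_def using that by (intro cInf_lower[OF _ bdd]) auto
  have mult: "u (q * m + r) \<le> real q * u m + u r" for q m r
  proof (induction q)
    case (Suc q)
    have "u (Suc q * m + r) \<le> u m + u (q * m + r)" using sub[of m "q * m + r"] by (simp add: add.assoc)
    then show ?case using Suc by (simp add: algebra_simps)
  qed simp
  have "(\<lambda>n. u n / real n) \<longlonglongrightarrow> L"
  proof (rule LIMSEQ_I)
    fix e :: real assume e: "e > 0"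
    have "\<exists>x\<in>?S. x < L + e / 2" unfolding L_def using e by (intro cInf_lessD[of ?S]) auto
    then obtain m where m: "m \<ge> 1" "u m / real m < L + e / 2" by auto
    define K where "K = \<bar>u m\<bar> + (\<Sum>r<m. \<bar>u r\<bar>)"
    have K: "u n \<le> real n * (u m / real m) + K" for n
    proof -
      have "u n \<le> real (n div m) * u m + u (n mod m)"
        using mult[of "n div m" m "n mod m"] by simp
      also have "real (n div m) * u m = real n * (u m / real m) - real (n mod m) / real m * u m"
      proof -
        have "real n = real (n div m) * real m + real (n mod m)"
          by (metis div_mult_mod_eq of_nat_add of_nat_mult)
        then show ?thesis using m(1) by (simp add: field_simps)
      qed
      finally have "u n \<le> real n * (u m / real m) - real (n mod m) / real m * u m + u (n mod m)" .
      moreover have "- (real (n mod m) / real m * u m) \<le> \<bar>u m\<bar>"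
      proof -
        have "\<bar>real (n mod m) / real m * u m\<bar> \<le> 1 * \<bar>u m\<bar>"
          unfolding abs_mult using m(1) by (intro mult_right_mono) (auto simp: less_imp_le)
        then show ?thesis by linarith
      qed
      ultimately have "u n \<le> real n * (u m / real m) + \<bar>u m\<bar> + u (n mod m)" by simp
      moreover have "\<bar>u (n mod m)\<bar> \<le> (\<Sum>r<m. \<bar>u r\<bar>)"
        using m(1) by (intro member_le_sum[where f = "\<lambda>r. \<bar>u r\<bar>"]) auto
      ultimately show ?thesis by (simp add: K_def)
    qed
    have "(\<lambda>n. K / real n) \<longlonglongrightarrow> 0" by (rule lim_const_over_n)
    then have "eventually (\<lambda>n. K / real n < e / 2) sequentially"
      using e by (intro order_tendstoD(2)[of _ 0]) auto
    then obtain N where N: "\<And>n. n \<ge> N \<Longrightarrow> K / real n < e / 2" by (auto simp: eventually_sequentially)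
    show "\<exists>N. \<forall>n\<ge>N. norm (u n / real n - L) < e"
    proof (intro exI allI impI)
      fix n assume n: "max 1 N \<le> n"
      then have "u n / real n \<le> u m / real m + K / real n"
        using K[of n] by (simp add: field_simps)
      then have "u n / real n < L + e" using N[of n] n m(2) by linarith
      then show "norm (u n / real n - L) < e" using L[of n] n e by simp
    qed
  qed
  then show ?thesis using L by blast
qed

context random_walk
begin

lemma measurable_ln_opnorm [measurable]: "(\<lambda>g. ln (opnorm g)) \<in> borel_measurable (borel_GL :: ('k^'d^'d) measure)"
  by measurable

lemma integrable_ln_opnorm: "integrable (M n) (\<lambda>g. ln (opnorm g))"
proof (rule Bochner_Integration.integrable_bound[OF integrable_lnN[of n]])
  show "AE g in M n. norm (ln (opnorm g)) \<le> norm (lnN g)"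
    by (rule AE_I2) (use abs_ln_opnorm in force)
qed simp

definition mean_ln_opnorm :: "nat \<Rightarrow> real" where "mean_ln_opnorm n = (\<integral>g. ln (opnorm g) \<partial>M n)"

lemma mean_ln_opnorm_subadditive: "mean_ln_opnorm (m + n) \<le> mean_ln_opnorm m + mean_ln_opnorm n"
proof -
  interpret Mm: prob_space "M m" by (rule prob_space_M)
  interpret Mn: prob_space "M n" by (rule prob_space_M)
  have "mean_ln_opnorm (m + n) = (\<integral>h. \<integral>g. ln (opnorm (g ** h)) \<partial>M m \<partial>M n)"
    unfolding mean_ln_opnorm_def by (rule integral_M_add(1)[OF integrable_ln_opnorm])
  also have "\<dots> \<le> (\<integral>h. mean_ln_opnorm m + ln (opnorm h) \<partial>M n)"
  proof (rule integral_mono)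
    show "integrable (M n) (\<lambda>h. \<integral>g. ln (opnorm (g ** h)) \<partial>M m)"
      by (rule integral_M_add(2)[OF integrable_ln_opnorm])
    show "integrable (M n) (\<lambda>h. mean_ln_opnorm m + ln (opnorm h))" using integrable_ln_opnorm[of n] by simp
    fix h :: "'k^'d^'d" assume "h \<in> space (M n)"
    then have h: "h \<in> GL" by simp
    show "(\<integral>g. ln (opnorm (g ** h)) \<partial>M m) \<le> mean_ln_opnorm m + ln (opnorm h)"
    proof -
      have "(\<integral>g. ln (opnorm (g ** h)) \<partial>M m) \<le> (\<integral>g. ln (opnorm g) + ln (opnorm h) \<partial>M m)"
      proof (rule integral_mono)
        have m: "(\<lambda>g. g ** h) \<in> borel_GL \<rightarrow>\<^sub>M borel_GL" by (rule measurable_matrix_mult) (auto simp: h)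
        show "integrable (M m) (\<lambda>g. ln (opnorm (g ** h)))"
        proof (rule Bochner_Integration.integrable_bound)
          show "integrable (M m) (\<lambda>g. lnN g + lnN h)" using integrable_lnN[of m] by simp
          show "AE g in M m. norm (ln (opnorm (g ** h))) \<le> norm (lnN g + lnN h)"
          proof (rule AE_I2)
            fix g :: "'k^'d^'d" assume "g \<in> space (M m)"
            then have g: "g \<in> GL" by simp
            have "\<bar>ln (opnorm (g ** h))\<bar> \<le> lnN g + lnN h"
              using abs_ln_opnorm[OF GL_mult[OF g h]] lnN_mult[OF g h] by linarith
            then show "norm (ln (opnorm (g ** h))) \<le> norm (lnN g + lnN h)" by simp
          qed
          show "(\<lambda>g. ln (opnorm (g ** h))) \<in> borel_measurable (M m)"
            using measurable_compose[OF m measurable_ln_opnorm] by simp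
        qed
        show "integrable (M m) (\<lambda>g. ln (opnorm g) + ln (opnorm h))" using integrable_ln_opnorm[of m] by simp
        fix g :: "'k^'d^'d" assume "g \<in> space (M m)"
        then have g: "g \<in> GL" by simp
        have "ln (opnorm (g ** h)) \<le> ln (opnorm g * opnorm h)"
          using opnorm_pos[OF GL_mult[OF g h]] opnorm_mult[of g h] by (intro ln_mono) auto
        then show "ln (opnorm (g ** h)) \<le> ln (opnorm g) + ln (opnorm h)"
          using opnorm_pos[OF g] opnorm_pos[OF h] by (simp add: ln_mult_pos)
      qed
      also have "\<dots> = mean_ln_opnorm m + ln (opnorm h)" using integrable_ln_opnorm[of m] by (simp add: mean_ln_opnorm_def)
      finally show ?thesis .
    qed
  qed
  also have "\<dots> = mean_ln_opnorm m + mean_ln_opnorm n" using integrable_ln_opnorm[of n] by (simp add: mean_ln_opnorm_def)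
  finally show ?thesis .
qed

lemma abs_mean_ln_opnorm_le: "\<bar>mean_ln_opnorm n\<bar> \<le> mean_lnN * real n"
proof -
  have "\<bar>mean_ln_opnorm n\<bar> \<le> (\<integral>g. norm (ln (opnorm g)) \<partial>M n)"
    unfolding mean_ln_opnorm_def using integral_norm_bound[of "M n" "\<lambda>g. ln (opnorm g)"] by simp
  also have "\<dots> \<le> (\<integral>g. lnN g \<partial>M n)"
    using integrable_ln_opnorm[of n] integrable_lnN[of n] abs_ln_opnorm by (intro integral_mono) auto
  also have "\<dots> \<le> real n * mean_lnN" by (rule integral_lnN_le)
  finally show ?thesis by (simp add: mult.commute)
qed

lemma lyapunov1_tendsto: "(\<lambda>n. mean_ln_opnorm n / real n) \<longlonglongrightarrow> lyapunov1 \<mu>"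
  and lyapunov1_le: "n \<ge> 1 \<Longrightarrow> lyapunov1 \<mu> \<le> mean_ln_opnorm n / real n"
proof -
  have "- mean_lnN * real n \<le> mean_ln_opnorm n" for n using abs_mean_ln_opnorm_le[of n] by linarith
  then obtain L where L: "(\<lambda>n. mean_ln_opnorm n / real n) \<longlonglongrightarrow> L" "\<forall>n\<ge>1. L \<le> mean_ln_opnorm n / real n"
    using subadditive_converges[of mean_ln_opnorm mean_lnN, OF mean_ln_opnorm_subadditive] by blast
  have "lyapunov1 \<mu> = lim (\<lambda>n. mean_ln_opnorm n / real n)" by (simp add: lyapunov1_def mean_ln_opnorm_def)
  also have "\<dots> = L" by (rule limI[OF L(1)])
  finally have "lyapunov1 \<mu> = L" .
  then show "(\<lambda>n. mean_ln_opnorm n / real n) \<longlonglongrightarrow> lyapunov1 \<mu>" "n \<ge> 1 \<Longrightarrow> lyapunov1 \<mu> \<le> mean_ln_opnorm n / real n"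
    using L by auto
qed

lemma walk_function_vnorm: "walk_function \<mu> p (\<lambda>v. ln (vnorm v)) (- {0}) GL (ln 1)"
proof (rule walk_function_ln)
  show "GL \<in> sets (borel_GL :: ('k^'d^'d) measure)" using sets.top[of "borel_GL :: ('k^'d^'d) measure"] by simp
  show "AE g in \<mu>. g \<in> GL" by (rule AE_I2) simp
qed (auto simp: GL_mult GL_inv GL_mult_eq_0 vnorm_le_Nsize)

text \<open>The drift of \<open>ln vnorm\<close> over \<open>m\<close> steps is at most the mean of \<open>ln (opnorm g)\<close> from every starting
  point, so that \<open>lower_deviation\<close> applies to \<open>- ln vnorm\<close>.\<close>
lemma upper_deviation:
  assumes \<epsilon>: "\<epsilon> > 0"
  obtains C where "summable_rate p C"
    "\<And>n v. v \<noteq> 0 \<Longrightarrow> measure (M n) {g\<in>GL. ln (vnorm (g *v v)) - ln (vnorm v) \<ge> (lyapunov1 \<mu> + \<epsilon>) * real n} \<le> C n"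
proof -
  interpret V: walk_function \<mu> p "\<lambda>v. ln (vnorm v)" "- {0}" GL "ln 1" by (rule walk_function_vnorm)
  interpret m: walk_function \<mu> p "\<lambda>v. - ln (vnorm v)" "- {0}" GL "ln 1" by (rule V.walk_function_minus)
  have "eventually (\<lambda>n. n \<ge> 1 \<and> mean_ln_opnorm n / real n < lyapunov1 \<mu> + \<epsilon> / 2) sequentially"
    using \<epsilon> by (intro eventually_conj eventually_ge_at_top order_tendstoD(2)[OF lyapunov1_tendsto]) auto
  then obtain m where m: "m \<ge> 1" "mean_ln_opnorm m / real m < lyapunov1 \<mu> + \<epsilon> / 2" by (auto simp: eventually_sequentially)
  have low: "real m * - (lyapunov1 \<mu> + \<epsilon> / 2) \<le> m.drift m v" if v: "v \<in> - {0}" for v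
  proof -
    have "V.drift m v \<le> mean_ln_opnorm m"
      unfolding V.drift_def mean_ln_opnorm_def
    proof (rule integral_mono[OF V.integrable_increment[OF v] integrable_ln_opnorm])
      fix g :: "'k^'d^'d" assume "g \<in> space (M m)"
      then have g: "g \<in> GL" by simp
      have "ln (vnorm (g *v v)) \<le> ln (opnorm g * vnorm v)"
        using v g by (intro ln_mono vnorm_le_opnorm) (auto simp: GL_mult_eq_0)
      then show "ln (vnorm (g *v v)) - ln (vnorm v) \<le> ln (opnorm g)"
        using v opnorm_pos[OF g] by (simp add: ln_mult_pos)
    qed
    moreover have "mean_ln_opnorm m \<le> real m * (lyapunov1 \<mu> + \<epsilon> / 2)" using m by (simp add: field_simps)
    ultimately show ?thesis by (simp add: V.drift_minus algebra_simps)
  qed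
  obtain C where C: "summable_rate p C"
    "\<And>n v. v \<in> - {0} \<Longrightarrow> measure (M n) {g\<in>GL. - ln (vnorm (g *v v)) - - ln (vnorm v) \<le> (- (lyapunov1 \<mu> + \<epsilon> / 2) - \<epsilon> / 2) * real n} \<le> C n"
    using m.lower_deviation[OF m(1) half_gt_zero[OF \<epsilon>] low] by blast
  have eq: "- x - - y \<le> (- (lyapunov1 \<mu> + \<epsilon> / 2) - \<epsilon> / 2) * real n \<longleftrightarrow> x - y \<ge> (lyapunov1 \<mu> + \<epsilon>) * real n" for x y n
    by (simp add: algebra_simps)
  show ?thesis
    by (rule that[OF C(1)]) (use C(2) in \<open>simp only: eq Compl_iff singleton_iff\<close>)
qed

text \<open>Growth is measured in probability and without logarithms, so that the zero vector is slow.\<close>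
definition slow_at :: "real \<Rightarrow> ('k^'d) set \<Rightarrow> bool" where
  "slow_at b U \<longleftrightarrow> (\<forall>w\<in>U. (\<lambda>n. measure (M n) {g\<in>GL. vnorm (g *v w) > exp (b * real n)}) \<longlonglongrightarrow> 0)"

lemma sets_vnorm_gt [measurable]: "{g\<in>GL. vnorm (g *v w) > a} \<in> sets (borel_GL :: ('k^'d^'d) measure)"
  by (rule sets_GL_Collect) measurable

lemma slow_at_0: "slow_at b {0}"
  by (simp add: slow_at_def not_less)

lemma slow_at_mono:
  assumes "slow_at b U" "b \<le> b'" shows "slow_at b' U"
  unfolding slow_at_def
proof
  fix w assume w: "w \<in> U"
  show "(\<lambda>n. measure (M n) {g\<in>GL. vnorm (g *v w) > exp (b' * real n)}) \<longlonglongrightarrow> 0"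
  proof (rule tendsto_sandwich[OF _ _ tendsto_const])
    show "(\<lambda>n. measure (M n) {g\<in>GL. vnorm (g *v w) > exp (b * real n)}) \<longlonglongrightarrow> 0"
      using assms(1) w by (simp add: slow_at_def)
    show "\<forall>\<^sub>F n in sequentially. measure (M n) {g\<in>GL. vnorm (g *v w) > exp (b' * real n)}
        \<le> measure (M n) {g\<in>GL. vnorm (g *v w) > exp (b * real n)}"
    proof (rule always_eventually, rule allI)
      fix n
      interpret Mn: prob_space "M n" by (rule prob_space_M)
      have e: "exp (b * real n) \<le> exp (b' * real n)" using assms(2) by (simp add: mult_right_mono)
      have "{g\<in>GL. vnorm (g *v w) > exp (b' * real n)} \<subseteq> {g\<in>GL. vnorm (g *v w) > exp (b * real n)}"
        by (auto intro: le_less_trans[OF e])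
      then show "measure (M n) {g\<in>GL. vnorm (g *v w) > exp (b' * real n)}
        \<le> measure (M n) {g\<in>GL. vnorm (g *v w) > exp (b * real n)}"
        by (rule Mn.finite_measure_mono) simp
    qed
  qed simp
qed

text \<open>If all standard basis vectors grow at rate at most \<open>b\<close>, then so does the operator norm, with
  probability close to one and hence in mean.\<close>
lemma slow_at_UNIV:
  assumes slow: "slow_at b UNIV" shows "lyapunov1 \<mu> \<le> b"
proof (rule field_le_epsilon)
  fix \<epsilon> :: real assume \<epsilon>: "\<epsilon> > 0"
  define c where "c = 2 * ln (real CARD('d))"
  have d: "real CARD('d) \<ge> 1" by (simp add: Suc_le_eq)
  have c: "c \<ge> 0" using d by (simp add: c_def)
  obtain \<delta> where \<delta>: "\<delta> > 0"
    and mean: "\<forall>n B F c. B \<in> sets borel_GL \<longrightarrow> measure (M n) B \<le> \<delta> \<longrightarrow> integrable (M n) F \<longrightarrow>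
      (AE g in M n. F g \<le> 0 * real n + c + lnN g) \<longrightarrow> (AE g in M n. g \<notin> B \<longrightarrow> F g \<le> b * real n + c) \<longrightarrow>
      (\<integral>g. F g \<partial>M n) \<le> (b + \<epsilon> / 2) * real n + c"
    using mean_le_of_probable_bound[OF half_gt_zero[OF \<epsilon>]] by blast
  define A where "A n i = {g\<in>GL. vnorm (g *v axis i (1 :: 'k)) > exp (b * real n)}" for n :: nat and i :: 'd
  have A [measurable]: "A n i \<in> sets borel_GL" for n i unfolding A_def by measurable
  have "(\<lambda>n. \<Sum>i\<in>UNIV. measure (M n) (A n i)) \<longlonglongrightarrow> (\<Sum>i\<in>(UNIV::'d set). 0)"
    using slow unfolding A_def slow_at_def by (intro tendsto_sum) blast
  then have ev: "eventually (\<lambda>n. (\<Sum>i\<in>UNIV. measure (M n) (A n i)) < \<delta>) sequentially"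
    using \<delta> by (intro order_tendstoD(2)) auto
  obtain n1 :: nat where n1: "2 * c / \<epsilon> \<le> real n1" using real_arch_simple by blast
  obtain n where n: "n \<ge> max 1 n1" "(\<Sum>i\<in>UNIV. measure (M n) (A n i)) < \<delta>"
    using eventually_conj[OF eventually_ge_at_top[of "max 1 n1"] ev] by (auto simp: eventually_sequentially)
  interpret Mn: prob_space "M n" by (rule prob_space_M)
  have "mean_ln_opnorm n \<le> (b + \<epsilon> / 2) * real n + c"
    unfolding mean_ln_opnorm_def
  proof (rule mean[rule_format, of "\<Union>i. A n i"])
    show "measure (M n) (\<Union>i. A n i) \<le> \<delta>"
      using Mn.finite_measure_subadditive_finite[of UNIV "A n"] n(2) by (auto simp: image_subset_iff)
    show "AE g in M n. ln (opnorm g) \<le> 0 * real n + c + lnN g"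
      by (rule AE_I2) (use abs_ln_opnorm c in force)
    show "AE g in M n. g \<notin> (\<Union>i. A n i) \<longrightarrow> ln (opnorm g) \<le> b * real n + c"
    proof (rule AE_I2, rule impI)
      fix g :: "'k^'d^'d" assume "g \<in> space (M n)" and B: "g \<notin> (\<Union>i. A n i)"
      then have g: "g \<in> GL" by simp
      have "opnorm g \<le> real CARD('d) * (\<Sum>i\<in>UNIV. vnorm (g *v axis i 1))" by (rule opnorm_le_basis)
      also have "\<dots> \<le> real CARD('d) * (\<Sum>i\<in>(UNIV::'d set). exp (b * real n))"
        using B g by (intro mult_left_mono sum_mono) (auto simp: A_def not_less)
      also have "\<dots> = real CARD('d) * real CARD('d) * exp (b * real n)" by simp
      finally have "ln (opnorm g) \<le> ln (real CARD('d) * real CARD('d) * exp (b * real n))"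
        using opnorm_pos[OF g] by (intro ln_mono) auto
      also have "\<dots> = b * real n + c" using d by (simp add: c_def ln_mult_pos)
      finally show "ln (opnorm g) \<le> b * real n + c" .
    qed
  qed (auto intro: integrable_ln_opnorm)
  moreover have "c \<le> \<epsilon> / 2 * real n"
  proof -
    have "2 * c / \<epsilon> \<le> real n" using n1 n(1) by simp
    then show ?thesis using \<epsilon> by (simp add: field_simps)
  qed
  ultimately have "mean_ln_opnorm n \<le> (b + \<epsilon>) * real n" by (simp add: algebra_simps)
  then have "mean_ln_opnorm n / real n \<le> b + \<epsilon>" using n(1) by (simp add: field_simps)
  then show "lyapunov1 \<mu> \<le> b + \<epsilon>" using lyapunov1_le[of n] n(1) by simp
qed

end

section \<open>The largest slow subspace\<close>

context invariant_quotient
begin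

text \<open>An extension of slow by slow is slow. In the norm \<open>max (vnorm (Q *v v)) (t * q v)\<close> with \<open>t\<close> large,
  the off-diagonal block of a product of \<open>m\<close> matrices becomes negligible, while the diagonal blocks are
  the actions on \<open>U\<close> and on \<open>W / U\<close>. Hence, at some fixed time \<open>m\<close>, the drift of this norm is small
  uniformly on \<open>W\<close>.\<close>
lemma slow_at_extension:
  assumes slow_U: "slow_at b U" and W: "invariant W" and UW: "U \<subseteq> W" and N: "\<And>j. N j \<ge> (j :: nat)"
    and slow_W: "\<And>w. w \<in> W \<Longrightarrow> (\<lambda>j. measure (M (N j)) {g\<in>GL. q (g *v w) > exp (b * real (N j))}) \<longlonglongrightarrow> 0"
    and bb': "b < b'"
  shows "slow_at b' W"
proof -
  define d where "d = real CARD('d)"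
  have d: "d \<ge> 1" by (simp add: d_def Suc_le_eq)
  have sub_W: "vec.subspace W" using W by (simp add: invariant_def)
  obtain R :: "'k^'d^'d" where R: "\<And>v. R *v v \<in> W" "\<And>w. w \<in> W \<Longrightarrow> R *v w = w"
    using exists_projection[OF sub_W] by blast
  define \<alpha> where "\<alpha> g = (\<Sum>i\<in>UNIV. vnorm (g *v (Q *v axis i 1)))" for g :: "'k^'d^'d"
  define \<beta> where "\<beta> g = (\<Sum>i\<in>UNIV. q (g *v (R *v axis i 1)))" for g :: "'k^'d^'d"
  define \<gamma> where "\<gamma> = opnorm Q"
  have nonneg: "\<alpha> g \<ge> 0" "\<beta> g \<ge> 0" "\<gamma> \<ge> 0" for g by (auto simp: \<alpha>_def \<beta>_def \<gamma>_def intro: sum_nonneg)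
  have split: "v = Q *v v + P *v v" for v by (simp add: P_eq)
  have PW: "P *v w \<in> W" if "w \<in> W" for w
    unfolding P_eq using sub_W that UW Q_in by (intro vec.subspace_diff) auto
  have block_U: "vnorm (Q *v (g *v (Q *v w))) \<le> d * \<alpha> g * vnorm (Q *v w)" if g: "g \<in> stab U" for g w
  proof -
    have "Q *v (g *v (Q *v w)) = (g ** Q) *v (Q *v w)"
      using g Q_in by (simp add: Q_id stab_def flip: matrix_vector_mul_assoc)
    then show ?thesis
      using vnorm_mult_le_basis[of "g ** Q" "Q *v w"] by (simp add: d_def \<alpha>_def flip: matrix_vector_mul_assoc)
  qed
  have block_off: "vnorm (Q *v (g *v (P *v w))) \<le> \<gamma> * exp (lnN g) * q w" if g: "g \<in> stab U" for g w
  proof -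
    have "vnorm (Q *v (g *v (P *v w))) \<le> \<gamma> * vnorm (g *v (P *v w))" unfolding \<gamma>_def by (rule vnorm_le_opnorm)
    also have "\<dots> \<le> \<gamma> * (exp (lnN g) * vnorm (P *v w))"
      using nonneg by (intro mult_left_mono vnorm_le_Nsize stab_GL[OF g])
    finally show ?thesis by (simp add: q_def mult.assoc)
  qed
  have block_quot: "q (g *v w) \<le> d * \<beta> g * q w" if g: "g \<in> stab U" and w: "w \<in> W" for g w
  proof -
    have "q (g *v w) = q (g *v (P *v w))" by (simp add: q_stab_P[OF g])
    also have "\<dots> = vnorm ((P ** g ** R) *v (P *v w))"
      by (simp add: q_def R(2)[OF PW[OF w]] flip: matrix_vector_mul_assoc)
    also have "\<dots> \<le> d * (\<Sum>i\<in>UNIV. vnorm ((P ** g ** R) *v axis i 1)) * vnorm (P *v w)"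
      unfolding d_def by (rule vnorm_mult_le_basis)
    finally show ?thesis by (simp add: \<beta>_def q_def flip: matrix_vector_mul_assoc)
  qed
  define C1 where "C1 = d * (\<Sum>i\<in>UNIV. vnorm (Q *v axis i (1::'k))) + \<gamma> + d * (\<Sum>i\<in>UNIV. K * q (R *v axis i 1)) + 1"
  define C2 where "C2 = d * d + \<gamma> + d * d + 1"
  define C0 where "C0 = max 1 (d * max C1 C2)"
  have Kpos: "K \<ge> 0" by (simp add: K_def)
  have C1: "C1 \<ge> 0" using d nonneg Kpos by (auto simp: C1_def intro!: add_nonneg_nonneg mult_nonneg_nonneg sum_nonneg)
  have \<alpha>_le: "\<alpha> g \<le> exp (lnN g) * (\<Sum>i\<in>UNIV. vnorm (Q *v axis i (1::'k)))" if "g \<in> stab U" for g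
    unfolding \<alpha>_def sum_distrib_left by (intro sum_mono vnorm_le_Nsize stab_GL[OF that])
  have \<beta>_le: "\<beta> g \<le> exp (lnN g) * (\<Sum>i\<in>UNIV. K * q (R *v axis i 1))" if "g \<in> stab U" for g
    unfolding \<beta>_def sum_distrib_left
    by (intro sum_mono order_trans[OF q_mult_le[OF that]]) (simp add: algebra_simps)
  define \<eta> where "\<eta> = (b' - b) / 4"
  have \<eta>: "\<eta> > 0" using bb' by (simp add: \<eta>_def)
  define c where "c = ln C0"
  have C0: "C0 \<ge> 1" by (simp add: C0_def)
  have c: "c \<ge> 0" using C0 by (simp add: c_def)
  obtain \<delta> where \<delta>: "\<delta> > 0"
    and mean: "\<forall>n B F c. B \<in> sets borel_GL \<longrightarrow> measure (M n) B \<le> \<delta> \<longrightarrow> integrable (M n) F \<longrightarrow>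
      (AE g in M n. F g \<le> 0 * real n + c + lnN g) \<longrightarrow> (AE g in M n. g \<notin> B \<longrightarrow> F g \<le> b * real n + c) \<longrightarrow>
      (\<integral>g. F g \<partial>M n) \<le> (b + \<eta>) * real n + c"
    using mean_le_of_probable_bound[OF \<eta>] by blast
  define AU where "AU n i = {g\<in>GL. vnorm (g *v (Q *v axis i (1 :: 'k))) > exp (b * real n)}" for n :: nat and i :: 'd
  define AW where "AW n i = {g\<in>GL. q (g *v (R *v axis i (1 :: 'k))) > exp (b * real n)}" for n :: nat and i :: 'd
  have AU_sets [measurable]: "AU n i \<in> sets borel_GL" for n i unfolding AU_def by measurable
  have AW_sets [measurable]: "AW n i \<in> sets borel_GL" for n i
    unfolding AW_def by (rule sets_GL_Collect) measurable
  have N_at_top: "filterlim N at_top sequentially"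
    by (rule filterlim_at_top_mono[OF filterlim_ident]) (use N in auto)
  have limU: "(\<lambda>j. measure (M (N j)) (AU (N j) i)) \<longlonglongrightarrow> 0" for i
  proof -
    have "(\<lambda>n. measure (M n) (AU n i)) \<longlonglongrightarrow> 0"
      using slow_U Q_in unfolding AU_def slow_at_def by blast
    then show ?thesis by (rule filterlim_compose[OF _ N_at_top])
  qed
  have limW: "(\<lambda>j. measure (M (N j)) (AW (N j) i)) \<longlonglongrightarrow> 0" for i
    unfolding AW_def by (rule slow_W) (rule R(1))
  have "(\<lambda>j. (\<Sum>i\<in>UNIV. measure (M (N j)) (AU (N j) i)) + (\<Sum>i\<in>UNIV. measure (M (N j)) (AW (N j) i)))
      \<longlonglongrightarrow> (\<Sum>i\<in>(UNIV::'d set). 0) + (\<Sum>i\<in>(UNIV::'d set). 0)"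
    by (intro tendsto_add tendsto_sum limU limW)
  then have ev: "eventually (\<lambda>j. (\<Sum>i\<in>UNIV. measure (M (N j)) (AU (N j) i)) + (\<Sum>i\<in>UNIV. measure (M (N j)) (AW (N j) i)) < \<delta> / 2) sequentially"
    using \<delta> by (intro order_tendstoD(2)) auto
  obtain n1 :: nat where n1: "c / \<eta> \<le> real n1" using real_arch_simple by blast
  obtain j where j: "j \<ge> max 1 n1"
    "(\<Sum>i\<in>UNIV. measure (M (N j)) (AU (N j) i)) + (\<Sum>i\<in>UNIV. measure (M (N j)) (AW (N j) i)) < \<delta> / 2"
    using eventually_conj[OF eventually_ge_at_top[of "max 1 n1"] ev] by (auto simp: eventually_sequentially)
  \<comment> \<open>A time at which \<open>U\<close> and \<open>W / U\<close> are both slow with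
    high probability. Only then \<open>t\<close> is chosen, depending on \<open>m\<close>; the
    constant \<open>C0\<close> must not depend on \<open>t\<close>.\<close>
  define m where "m = N j"
  have m: "m \<ge> 1" "m \<ge> n1" using j(1) N[of j] by (auto simp: m_def)
  interpret Mm: prob_space "M m" by (rule prob_space_M)
  define s0 where "s0 = 2 * (real m * mean_lnN) / \<delta> + 1"
  have s0: "s0 > 0" using mean_lnN_nonneg \<delta> by (simp add: s0_def add_nonneg_pos)
  define t where "t = max 1 (exp (s0 - b * real m))"
  have t: "t \<ge> 1" by (simp add: t_def)
  define B0 where "B0 = {g\<in>GL. s0 \<le> lnN (g :: 'k^'d^'d)}"
  have B0_sets [measurable]: "B0 \<in> sets (borel_GL :: ('k^'d^'d) measure)"
    unfolding B0_def by (rule sets_GL_Collect) measurable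
  have B0: "measure (M m) B0 \<le> \<delta> / 2"
  proof -
    have "measure (M m) {g\<in>space (M m). lnN g \<ge> s0} \<le> (\<integral>g. lnN g \<partial>M m) / s0"
      by (rule integral_Markov_inequality_measure[OF integrable_lnN, where A = "{}"])
        (use s0 in \<open>auto simp: lnN_nonneg\<close>)
    also have "\<dots> \<le> real m * mean_lnN / s0" using s0 integral_lnN_le[of m] by (intro divide_right_mono) auto
    also have "\<dots> \<le> \<delta> / 2" using s0 \<delta> by (simp add: s0_def field_simps)
    finally show ?thesis by (simp add: B0_def)
  qed
  define B where "B = (\<Union>i. AU m i) \<union> (\<Union>i. AW m i) \<union> B0"
  have B_sets: "B \<in> sets borel_GL" unfolding B_def by measurable
  have PB: "measure (M m) B \<le> \<delta>"
  proof -
    have "measure (M m) (\<Union>i. AU m i) \<le> (\<Sum>i\<in>UNIV. measure (M m) (AU m i))"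
      by (rule Mm.finite_measure_subadditive_finite) (auto simp: image_subset_iff)
    moreover have "measure (M m) (\<Union>i. AW m i) \<le> (\<Sum>i\<in>UNIV. measure (M m) (AW m i))"
      by (rule Mm.finite_measure_subadditive_finite) (auto simp: image_subset_iff)
    moreover have "measure (M m) B \<le> measure (M m) (\<Union>i. AU m i) + measure (M m) (\<Union>i. AW m i) + measure (M m) B0"
      unfolding B_def by (intro order_trans[OF measure_Un_le add_right_mono[OF measure_Un_le]]) auto
    ultimately show ?thesis using j(2) B0 by (simp add: m_def)
  qed
  define nt where "nt v = max (vnorm (Q *v v)) (t * q v)" for v
  have nt_pos: "nt v > 0" if "v \<noteq> 0" for v
  proof (rule ccontr)
    assume "\<not> ?thesis"
    then have "vnorm (Q *v v) \<le> 0" "t * q v \<le> 0" by (auto simp: nt_def)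
    then have "vnorm (Q *v v) = 0" "q v = 0"
      using t vnorm_nonneg[of "Q *v v"] q_nonneg[of v] by (auto simp: mult_le_0_iff)
    then show False using split[of v] that by (simp add: q_def)
  qed
  have nt_nonneg: "nt v \<ge> 0" for v by (simp add: nt_def le_max_iff_disj)
  define \<tau> where "\<tau> g = d * \<alpha> g + \<gamma> * exp (lnN g) / t + d * \<beta> g" for g
  have step: "nt (g *v w) \<le> d * \<tau> g * nt w" if g: "g \<in> stab U" and w: "w \<in> W" for g w
  proof -
    have n1: "vnorm (Q *v w) \<le> nt w" and n2: "q w \<le> nt w / t"
      using t by (auto simp: nt_def field_simps le_max_iff_disj)
    have e: "\<gamma> * exp (lnN g) \<ge> 0" using nonneg by simp
    have "vnorm (Q *v (g *v w)) = vnorm (Q *v (g *v (Q *v w)) + Q *v (g *v (P *v w)))"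
      by (subst (1) split[of w]) (simp add: vec.add)
    also have "\<dots> \<le> d * (vnorm (Q *v (g *v (Q *v w))) + vnorm (Q *v (g *v (P *v w))))"
      unfolding d_def by (rule vnorm_add_le)
    also have "\<dots> \<le> d * (d * \<alpha> g * nt w + \<gamma> * exp (lnN g) * (nt w / t))"
    proof (intro mult_left_mono add_mono)
      show "vnorm (Q *v (g *v (Q *v w))) \<le> d * \<alpha> g * nt w"
        using d nonneg by (intro order_trans[OF block_U[OF g]] mult_left_mono n1) auto
      show "vnorm (Q *v (g *v (P *v w))) \<le> \<gamma> * exp (lnN g) * (nt w / t)"
        by (intro order_trans[OF block_off[OF g]] mult_left_mono n2 e)
    qed (use d in simp)
    also have "\<dots> \<le> d * \<tau> g * nt w"
    proof -
      have "0 \<le> d * (d * \<beta> g) * nt w" using d nonneg nt_nonneg by simp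
      then show ?thesis by (simp add: \<tau>_def algebra_simps)
    qed
    finally have 1: "vnorm (Q *v (g *v w)) \<le> d * \<tau> g * nt w" .
    have "t * q (g *v w) \<le> t * (d * \<beta> g * q w)" using t by (intro mult_left_mono block_quot[OF g w]) auto
    also have "\<dots> = d * \<beta> g * (t * q w)" by simp
    also have "\<dots> \<le> d * \<beta> g * nt w" using d nonneg by (intro mult_left_mono) (auto simp: nt_def)
    also have "\<dots> \<le> d * \<tau> g * nt w"
    proof (intro mult_right_mono nt_nonneg)
      have "\<beta> g \<le> d * \<beta> g" using d nonneg mult_right_mono[of 1 d "\<beta> g"] by simp
      also have "\<dots> \<le> \<tau> g" using d nonneg t e by (simp add: \<tau>_def)
      finally show "d * \<beta> g \<le> d * \<tau> g" using d by (intro mult_left_mono) auto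
    qed
    finally show ?thesis using 1 by (simp add: nt_def)
  qed
  \<comment> \<open>A bound for all matrices, which controls the contribution of the exceptional
    set \<open>B\<close> to the mean.\<close>
  have \<tau>_all: "d * \<tau> g \<le> C0 * exp (lnN g)" if g: "g \<in> stab U" for g
  proof -
    have "\<gamma> * exp (lnN g) / t \<le> \<gamma> * exp (lnN g) / 1" using t nonneg by (intro divide_left_mono) auto
    moreover have "d * \<alpha> g \<le> d * (exp (lnN g) * (\<Sum>i\<in>UNIV. vnorm (Q *v axis i (1::'k))))"
      using d by (intro mult_left_mono \<alpha>_le[OF g]) auto
    moreover have "d * \<beta> g \<le> d * (exp (lnN g) * (\<Sum>i\<in>UNIV. K * q (R *v axis i 1)))"
      using d by (intro mult_left_mono \<beta>_le[OF g]) auto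
    moreover have "C1 * exp (lnN g) = d * (exp (lnN g) * (\<Sum>i\<in>UNIV. vnorm (Q *v axis i (1::'k))))
        + \<gamma> * exp (lnN g) / 1 + d * (exp (lnN g) * (\<Sum>i\<in>UNIV. K * q (R *v axis i 1))) + exp (lnN g)"
      by (simp add: C1_def algebra_simps)
    ultimately have "\<tau> g \<le> C1 * exp (lnN g)" unfolding \<tau>_def using exp_gt_zero[of "lnN g"] by linarith
    then have "d * \<tau> g \<le> d * (C1 * exp (lnN g))" using d by (intro mult_left_mono) auto
    also have "\<dots> = (d * C1) * exp (lnN g)" by simp
    also have "\<dots> \<le> C0 * exp (lnN g)"
    proof (rule mult_right_mono)
      have "d * C1 \<le> d * max C1 C2" using d by (intro mult_left_mono) auto
      then show "d * C1 \<le> C0" by (simp add: C0_def)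
    qed simp
    finally show ?thesis .
  qed
  have \<tau>_good: "d * \<tau> g \<le> C0 * exp (b * real m)" if g: "g \<in> stab U" and gB: "g \<notin> B" for g
  proof -
    have gGL: "g \<in> GL" by (rule stab_GL[OF g])
    have "\<alpha> g \<le> (\<Sum>i\<in>(UNIV::'d set). exp (b * real m))" unfolding \<alpha>_def
      using gB gGL by (intro sum_mono) (auto simp: B_def AU_def not_less)
    then have 1: "d * \<alpha> g \<le> d * (d * exp (b * real m))" using d by (intro mult_left_mono) (auto simp: d_def)
    have "\<beta> g \<le> (\<Sum>i\<in>(UNIV::'d set). exp (b * real m))" unfolding \<beta>_def
      using gB gGL by (intro sum_mono) (auto simp: B_def AW_def not_less)
    then have 2: "d * \<beta> g \<le> d * (d * exp (b * real m))" using d by (intro mult_left_mono) (auto simp: d_def)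
    have "exp (lnN g) / t \<le> exp (b * real m)"
    proof -
      have "lnN g < s0" using gB gGL by (auto simp: B_def B0_def not_le)
      then have "exp (lnN g) \<le> exp s0" by simp
      also have "\<dots> = exp (s0 - b * real m) * exp (b * real m)" by (simp flip: exp_add)
      also have "\<dots> \<le> t * exp (b * real m)" by (intro mult_right_mono) (auto simp: t_def)
      finally show ?thesis using t by (simp add: field_simps)
    qed
    then have 3: "\<gamma> * exp (lnN g) / t \<le> \<gamma> * exp (b * real m)"
      using nonneg(3) mult_left_mono[of "exp (lnN g) / t" "exp (b * real m)" \<gamma>] by simp
    have "C2 * exp (b * real m) = d * (d * exp (b * real m)) + \<gamma> * exp (b * real m) + d * (d * exp (b * real m)) + exp (b * real m)"
      by (simp add: C2_def algebra_simps)
    then have "\<tau> g \<le> C2 * exp (b * real m)"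
      unfolding \<tau>_def using 1 2 3 exp_gt_zero[of "b * real m"] by linarith
    then have "d * \<tau> g \<le> d * (C2 * exp (b * real m))" using d by (intro mult_left_mono) auto
    also have "\<dots> = (d * C2) * exp (b * real m)" by simp
    also have "\<dots> \<le> C0 * exp (b * real m)"
    proof (rule mult_right_mono)
      have "d * C2 \<le> d * max C1 C2" using d by (intro mult_left_mono) auto
      then show "d * C2 \<le> C0" by (simp add: C0_def)
    qed simp
    finally show ?thesis .
  qed
  define S' where "S' = stab W \<inter> stab U"
  have S'_AE: "AE g in M n. g \<in> S'" for n
    using AE_stab[OF W, of n] AE_stab[OF U, of n] by eventually_elim (simp add: S'_def)
  have Wmove: "g *v v \<in> W - {0}" if "g \<in> S'" "v \<in> W - {0}" for g v
    using that by (auto simp: S'_def stab_def GL_mult_eq_0)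
  interpret F: walk_function \<mu> p "\<lambda>v. ln (nt v)" "W - {0}" S' "ln C0"
  proof (rule walk_function_ln)
    show "nt \<in> borel_measurable borel" unfolding nt_def
      by (intro borel_measurable_continuous_onI continuous_intros)
    show "AE g in \<mu>. g \<in> S'" using S'_AE[of "Suc 0"] unfolding M_1 .
    show "nt (g *v v) \<le> C0 * exp (lnN g) * nt v" if "g \<in> S'" "v \<in> W - {0}" for g v
      using that by (intro order_trans[OF step mult_right_mono[OF \<tau>_all]]) (auto simp: S'_def nt_nonneg)
  qed (use C0 nt_pos Wmove in \<open>auto simp: S'_def sets_stab sub_W subspace_U stab_id stab_mult stab_inv\<close>)
  interpret F': walk_function \<mu> p "\<lambda>v. - ln (nt v)" "W - {0}" S' "ln C0" by (rule F.walk_function_minus)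
  have "F.drift m v \<le> (b + \<eta>) * real m + c" if v: "v \<in> W - {0}" for v
    unfolding F.drift_def
  proof (rule mean[rule_format, OF B_sets PB F.integrable_increment[OF v]])
    have ln_step: "ln (nt (g *v v)) - ln (nt v) \<le> x + c" if g: "g \<in> S'" and le: "d * \<tau> g \<le> C0 * exp x" for g x
    proof -
      have "nt (g *v v) \<le> d * \<tau> g * nt v" using g v by (intro step) (auto simp: S'_def)
      also have "\<dots> \<le> C0 * exp x * nt v" by (intro mult_right_mono le nt_nonneg)
      finally have "ln (nt (g *v v)) \<le> ln (C0 * exp x * nt v)"
        using nt_pos Wmove[OF g v] by (intro ln_mono) auto
      also have "\<dots> = c + x + ln (nt v)" using C0 nt_pos[of v] v by (simp add: c_def ln_mult_pos)
      finally show ?thesis by simp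
    qed
    show "AE g in M m. ln (nt (g *v v)) - ln (nt v) \<le> 0 * real m + c + lnN g"
      using S'_AE[of m]
    proof eventually_elim
      case (elim g)
      then have "d * \<tau> g \<le> C0 * exp (lnN g)" by (intro \<tau>_all) (simp add: S'_def)
      from ln_step[OF elim this] show ?case by simp
    qed
    show "AE g in M m. g \<notin> B \<longrightarrow> ln (nt (g *v v)) - ln (nt v) \<le> b * real m + c"
      using S'_AE[of m] by eventually_elim (intro impI ln_step, auto simp: S'_def \<tau>_good)
  qed
  moreover have "c \<le> \<eta> * real m"
  proof -
    have "c / \<eta> \<le> real m" using n1 m(2) by simp
    then show ?thesis using \<eta> by (simp add: field_simps)
  qed
  ultimately have low: "real m * - (b + 2 * \<eta>) \<le> F'.drift m v" if "v \<in> W - {0}" for v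
    using that by (fastforce simp: F.drift_minus algebra_simps)
  obtain C where C: "summable_rate p C"
    "\<And>n v. v \<in> W - {0} \<Longrightarrow> measure (M n) {g\<in>GL. - ln (nt (g *v v)) - - ln (nt v) \<le> (- (b + 2 * \<eta>) - \<eta>) * real n} \<le> C n"
    using F'.lower_deviation[OF m(1) \<eta> low] by blast
  show ?thesis
    unfolding slow_at_def
  proof
    fix w assume w: "w \<in> W"
    show "(\<lambda>n. measure (M n) {g\<in>GL. vnorm (g *v w) > exp (b' * real n)}) \<longlonglongrightarrow> 0"
    proof (cases "w = 0")
      case True
      then show ?thesis by (simp add: not_less)
    next
      case False
      then have w0: "w \<in> W - {0}" using w by simp
      obtain n2 :: nat where n2: "(ln (2 * d) + ln (nt w)) / \<eta> \<le> real n2" using real_arch_simple by blast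
      show ?thesis
      proof (rule tendsto_sandwich[OF _ _ tendsto_const])
        show "C \<longlonglongrightarrow> 0" using C(1) by (simp add: summable_rate_def)
        show "\<forall>\<^sub>F n in sequentially. measure (M n) {g\<in>GL. vnorm (g *v w) > exp (b' * real n)} \<le> C n"
          using eventually_ge_at_top[of n2]
        proof eventually_elim
          case (elim n)
          interpret Mn: prob_space "M n" by (rule prob_space_M)
          have "(ln (2 * d) + ln (nt w)) / \<eta> \<le> real n" using n2 elim by simp
          then have n: "ln (2 * d) + ln (nt w) \<le> \<eta> * real n" using \<eta> by (simp add: field_simps)
          have "measure (M n) {g\<in>GL. vnorm (g *v w) > exp (b' * real n)}
              \<le> measure (M n) {g\<in>GL. - ln (nt (g *v w)) - - ln (nt w) \<le> (- (b + 2 * \<eta>) - \<eta>) * real n}"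
          proof (rule Mn.finite_measure_mono)
            show "{g\<in>GL. - ln (nt (g *v w)) - - ln (nt w) \<le> (- (b + 2 * \<eta>) - \<eta>) * real n} \<in> sets (M n)"
              unfolding sets_M by (rule F'.measurable_increment_set)
            show "{g\<in>GL. vnorm (g *v w) > exp (b' * real n)}
              \<subseteq> {g\<in>GL. - ln (nt (g *v w)) - - ln (nt w) \<le> (- (b + 2 * \<eta>) - \<eta>) * real n}"
            proof safe
              fix g :: "'k^'d^'d" assume g: "g \<in> GL" and gt: "vnorm (g *v w) > exp (b' * real n)"
              have gw: "g *v w \<noteq> 0" using g False by (simp add: GL_mult_eq_0)
              have "vnorm (g *v w) \<le> d * (vnorm (Q *v (g *v w)) + vnorm (P *v (g *v w)))"
                using vnorm_add_le[of "Q *v (g *v w)" "P *v (g *v w)"] split[of "g *v w"] by (simp add: d_def)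
              also have "\<dots> \<le> d * (nt (g *v w) + nt (g *v w))"
              proof (intro mult_left_mono add_mono)
                have "q (g *v w) \<le> t * q (g *v w)" using t mult_right_mono[of 1 t "q (g *v w)"] by simp
                then show "vnorm (P *v (g *v w)) \<le> nt (g *v w)" by (simp add: nt_def q_def)
              qed (use d in \<open>auto simp: nt_def\<close>)
              finally have "exp (b' * real n) \<le> 2 * d * nt (g *v w)" using gt by simp
              then have "ln (exp (b' * real n)) \<le> ln (2 * d * nt (g *v w))" by (intro ln_mono) auto
              also have "\<dots> = ln (2 * d) + ln (nt (g *v w))"
                using d nt_pos[OF gw] by (simp add: ln_mult_pos)
              finally have "b' * real n \<le> ln (2 * d) + ln (nt (g *v w))" by simp
              moreover have "b' * real n = (b + 3 * \<eta>) * real n + \<eta> * real n"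
              proof -
                have "b' = b + 3 * \<eta> + \<eta>" by (simp add: \<eta>_def field_simps)
                then show ?thesis by (simp add: algebra_simps)
              qed
              ultimately have "(b + 3 * \<eta>) * real n \<le> ln (nt (g *v w)) - ln (nt w)" using n by linarith
              then show "- ln (nt (g *v w)) - - ln (nt w) \<le> (- (b + 2 * \<eta>) - \<eta>) * real n"
                by (simp add: algebra_simps)
            qed
          qed
          also have "\<dots> \<le> C n" by (rule C(2)[OF w0])
          finally show ?case .
        qed
      qed simp
    qed
  qed
qed

end

context random_walk
begin

text \<open>The slow invariant subspaces have a member \<open>U\<close> of largest dimension. If the drift on the quotient
  by \<open>U\<close> were not at least \<open>lyapunov1 \<mu>\<close> asymptotically, then \<open>slow_extension\<close> and
  \<open>slow_at_extension\<close> would produce a larger slow invariant subspace.\<close>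
lemma exists_fast_quotient:
  obtains U Q where "invariant_quotient \<mu> p U Q" "U \<noteq> UNIV"
    "\<And>\<eta>. \<eta> > 0 \<Longrightarrow> \<exists>m\<ge>1. \<forall>v\<in>- U. real m * (lyapunov1 \<mu> - \<eta>) \<le> walk_function.drift \<mu> (\<lambda>v. ln (invariant_quotient.q Q v)) m v"
proof -
  let ?L = "lyapunov1 \<mu>"
  define slow where "slow U \<longleftrightarrow> invariant U \<and> (\<exists>b<?L. slow_at b U)" for U
  have "invariant {0}" by (rule invariantI) (auto simp: vec.subspace_0)
  then have slow_0: "slow {0}"
    unfolding slow_def using slow_at_0 by (intro conjI exI[of _ "?L - 1"]) auto
  define dims where "dims = vec.dim ` {U :: ('k^'d) set. slow U}"
  have "finite dims"
    by (rule finite_subset[of _ "{..CARD('d)}"]) (auto simp: dims_def dim_subset_UNIV_cart_gen)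
  moreover have "dims \<noteq> {}" using slow_0 by (auto simp: dims_def)
  ultimately have "Max dims \<in> dims" by (rule Max_in)
  then obtain U where U: "slow U" "vec.dim U = Max dims" by (auto simp: dims_def)
  have maximal: "vec.dim W \<le> vec.dim U" if "slow W" for W
    unfolding U(2) using \<open>finite dims\<close> that by (intro Max_ge) (auto simp: dims_def)
  have inv_U: "invariant U" and sub_U: "vec.subspace U" using U(1) by (auto simp: slow_def invariant_def)
  obtain b1 where b1: "b1 < ?L" "slow_at b1 U" using U(1) by (auto simp: slow_def)
  have U_proper: "U \<noteq> UNIV" using slow_at_UNIV[of b1] b1 by auto
  obtain Q :: "'k^'d^'d" where Q: "\<And>v. Q *v v \<in> U" "\<And>u. u \<in> U \<Longrightarrow> Q *v u = u"
    using exists_projection[OF sub_U] by blast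
  interpret quot: invariant_quotient \<mu> p U Q by standard (use inv_U Q in auto)
  have "\<exists>m\<ge>1. \<forall>v\<in>- U. real m * (?L - \<eta>) \<le> quot.drift m v" if \<eta>: "\<eta> > 0" for \<eta>
  proof (rule ccontr)
    assume neg: "\<not> ?thesis"
    define low where "low m = (INF v\<in>- U. quot.drift m v)" for m
    have bdd: "bdd_below (quot.drift m ` (- U))" for m
    proof (rule bdd_belowI2)
      show "- (real m * mean_lnN + ln quot.K) \<le> quot.drift m v" if "v \<in> - U" for v
        using quot.abs_drift_le[OF that, of m] by linarith
    qed
    have low_le: "low m \<le> quot.drift m v" if "v \<notin> U" for m v
      unfolding low_def using that by (intro cINF_lower[OF bdd]) auto
    have low_lt: "low m \<le> real m * (?L - \<eta>)" if "m \<ge> 1" for m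
    proof -
      have "\<not> (\<forall>v\<in>- U. real m * (?L - \<eta>) \<le> quot.drift m v)" using neg that by blast
      then obtain v where "v \<in> - U" "quot.drift m v < real m * (?L - \<eta>)" by (auto simp: not_le)
      then show ?thesis using low_le[of v m] by simp
    qed
    \<comment> \<open>Thus \<open>low n \<le> n * a\<close> at all times \<open>n\<close>, while
      \<open>low m\<close> is at least \<open>m * (a - \<epsilon>)\<close> for some
      \<open>m\<close>.\<close>
    define a where "a = (SUP m\<in>{1..}. low m / real m)"
    have quot_le: "low m / real m \<le> ?L - \<eta>" if "m \<in> {1..}" for m
      using low_lt[of m] that by (simp add: field_simps)
    then have bdd_a: "bdd_above ((\<lambda>m. low m / real m) ` {1..})" by (rule bdd_aboveI2)
    have a_le: "a \<le> ?L - \<eta>" unfolding a_def by (rule cSUP_least) (use quot_le in auto)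
    have le_a: "low m / real m \<le> a" if "m \<ge> 1" for m
      unfolding a_def using that by (intro cSUP_upper[OF _ bdd_a]) auto
    have h1: "\<exists>m\<ge>1. \<forall>v\<in>- U. real m * (a - \<epsilon>) \<le> quot.drift m v" if \<epsilon>: "\<epsilon> > 0" for \<epsilon>
    proof -
      have "\<exists>x\<in>(\<lambda>m. low m / real m) ` {1..}. a - \<epsilon> < x"
        unfolding a_def by (rule less_cSupD) (use \<epsilon> in auto)
      then obtain m where m: "m \<ge> 1" "a - \<epsilon> < low m / real m" by auto
      then have "real m * (a - \<epsilon>) \<le> low m" by (simp add: field_simps)
      then show ?thesis using low_le m(1) by (intro exI[of _ m]) (auto intro: order_trans)
    qed
    have h2: "\<exists>x. x \<notin> U \<and> quot.drift n x \<le> real n * (a + \<epsilon>)" if \<epsilon>: "\<epsilon> > 0" for \<epsilon> n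
    proof (cases "n \<ge> 1")
      case False
      then have "n = 0" by simp
      moreover obtain x where "x \<notin> U" using U_proper by blast
      ultimately show ?thesis by (intro exI[of _ x]) simp
    next
      case True
      then have "low n \<le> real n * a" using le_a[of n] by (simp add: field_simps)
      also have "\<dots> < real n * (a + \<epsilon>)" using True \<epsilon> by simp
      finally have "Inf (quot.drift n ` (- U)) < real n * (a + \<epsilon>)" by (simp add: low_def)
      then obtain y where "y \<in> quot.drift n ` (- U)" "y < real n * (a + \<epsilon>)"
        using cInf_lessD[of "quot.drift n ` (- U)"] U_proper by blast
      then show ?thesis by (auto intro: less_imp_le)
    qed
    obtain W N where W: "invariant W" "U \<subset> W" "\<And>j. N j \<ge> (j :: nat)"
      "\<And>w \<eta>. w \<in> W \<Longrightarrow> \<eta> > 0 \<Longrightarrow>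
        (\<lambda>j. measure (M (N j)) {g\<in>GL. quot.q (g *v w) > exp ((a + \<eta>) * real (N j))}) \<longlonglongrightarrow> 0"
      using quot.slow_extension[OF h1 h2] by blast
    define b where "b = max b1 (a + \<eta> / 2)"
    have b: "b < ?L" using b1 a_le \<eta> by (simp add: b_def)
    \<comment> \<open>Any rate strictly between \<open>b\<close> and \<open>lyapunov1
      \<mu>\<close> would do.\<close>
    have "slow_at ((b + ?L) / 2) W"
    proof (rule quot.slow_at_extension[OF slow_at_mono[OF b1(2)] W(1) _ W(3)])
      fix w assume w: "w \<in> W"
      have "b - a > 0" using \<eta> by (simp add: b_def max_def)
      from W(4)[OF w this] show "(\<lambda>j. measure (M (N j)) {g\<in>GL. quot.q (g *v w) > exp (b * real (N j))}) \<longlonglongrightarrow> 0"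
        by simp
    qed (use W(2) b in \<open>auto simp: b_def\<close>)
    then have "slow W" unfolding slow_def using W(1) b by (intro conjI exI[of _ "(b + ?L) / 2"]) auto
    moreover have "vec.dim U < vec.dim W"
    proof (rule vec.dim_psubset)
      have spans: "vec.span U = U" "vec.span W = W" using sub_U W(1) by (auto simp: invariant_def vec.span_eq_iff)
      show "vec.span U \<subset> vec.span W" unfolding spans by (rule W(2))
    qed
    ultimately show False using maximal[of W] by simp
  qed
  then show ?thesis using that[OF quot.invariant_quotient_axioms U_proper] by blast
qed

section \<open>Deviations from the Lyapunov exponent\<close>

text \<open>The same \<open>C\<close> serves for all starting vectors because \<open>upper_deviation\<close> and the lower deviation bound
  on the quotient are uniform in them.\<close>
lemma deviation_rates:
  assumes \<epsilon>: "\<epsilon> > 0"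
  shows "\<exists>C. summable_rate p C \<and>
    (\<forall>n. measure (M n) {g\<in>GL. \<bar>ln (opnorm g) - real n * lyapunov1 \<mu>\<bar> \<ge> \<epsilon> * real n} \<le> C n) \<and>
    (acts_irreducibly (generated_semigroup \<mu>) \<longrightarrow> (\<forall>v n. v \<noteq> 0 \<longrightarrow>
      measure (M n) {g\<in>GL. \<bar>ln (vnorm (g *v v) / vnorm v) - real n * lyapunov1 \<mu>\<bar> \<ge> \<epsilon> * real n} \<le> C n))"
proof -
  let ?L = "lyapunov1 \<mu>"
  have \<epsilon>2: "\<epsilon> / 2 > 0" and \<epsilon>4: "\<epsilon> / 4 > 0" using \<epsilon> by auto
  define d where "d = real CARD('d)"
  have d: "d \<ge> 1" by (simp add: d_def Suc_le_eq)
  obtain Cu where Cu: "summable_rate p Cu"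
    and up: "\<And>n v. v \<noteq> 0 \<Longrightarrow> measure (M n) {g\<in>GL. ln (vnorm (g *v v)) - ln (vnorm v) \<ge> (?L + \<epsilon> / 2) * real n} \<le> Cu n"
    using upper_deviation[OF \<epsilon>2] by blast
  obtain U Q where UQ: "invariant_quotient \<mu> p U Q" "U \<noteq> UNIV"
    and fast: "\<And>\<eta>. \<eta> > 0 \<Longrightarrow> \<exists>m\<ge>1. \<forall>v\<in>- U. real m * (?L - \<eta>) \<le> walk_function.drift \<mu> (\<lambda>v. ln (invariant_quotient.q Q v)) m v"
    using exists_fast_quotient by blast
  interpret quot: invariant_quotient \<mu> p U Q by (rule UQ(1))
  obtain m where m: "m \<ge> 1" and fast_m: "\<And>v. v \<in> - U \<Longrightarrow> real m * (?L - \<epsilon> / 4) \<le> quot.drift m v"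
    using fast[OF \<epsilon>4] by blast
  obtain Cl where Cl: "summable_rate p Cl"
    and low': "\<And>n v. v \<in> - U \<Longrightarrow> measure (M n) {g\<in>GL. ln (quot.q (g *v v)) - ln (quot.q v) \<le> (?L - \<epsilon> / 4 - \<epsilon> / 4) * real n} \<le> Cl n"
    using quot.lower_deviation[OF m \<epsilon>4 fast_m] by blast
  have half: "?L - \<epsilon> / 4 - \<epsilon> / 4 = ?L - \<epsilon> / 2" by simp
  note low = low'[unfolded half]
  obtain v0 where v0: "v0 \<notin> U" using UQ(2) by blast
  define c where "c = max (3 * ln d) (ln quot.K + ln (vnorm v0) - ln (quot.q v0))"
  have c1: "3 * ln d \<le> c" and c2: "ln quot.K + ln (vnorm v0) - ln (quot.q v0) \<le> c" by (simp_all add: c_def)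
  obtain n0 :: nat where n0: "2 * c / \<epsilon> \<le> real n0" using real_arch_simple by blast
  define C where "C n = (if n < n0 then 1 else (\<Sum>i\<in>(UNIV::'d set). Cu n) + Cu n + Cl n)" for n
  have C_pos: "Cu n \<ge> 0" "Cl n \<ge> 0" for n using Cu Cl by (auto simp: summable_rate_def)
  have rate: "summable_rate p C" unfolding C_def
    by (intro summable_rate_cong_eventually summable_rate_add summable_rate_sum Cu Cl) simp
  have sets_up [measurable]: "{g\<in>GL. ln (vnorm (g *v v)) - a \<ge> b} \<in> sets (borel_GL :: ('k^'d^'d) measure)" for v a b
    by (rule sets_GL_Collect) measurable
  have bound_op: "measure (M n) {g\<in>GL. \<bar>ln (opnorm g) - real n * ?L\<bar> \<ge> \<epsilon> * real n} \<le> C n" for n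
  proof (cases "n < n0")
    case True
    then show ?thesis using prob_space.prob_le_1[OF prob_space_M] by (simp add: C_def)
  next
    case False
    then have "2 * c / \<epsilon> \<le> real n" using n0 by simp
    then have n: "c \<le> \<epsilon> / 2 * real n" using \<epsilon> by (simp add: field_simps)
    interpret Mn: prob_space "M n" by (rule prob_space_M)
    define A where "A i = {g\<in>GL. ln (vnorm (g *v axis i (1::'k))) - ln (vnorm (axis i (1::'k) :: 'k^'d)) \<ge> (?L + \<epsilon> / 2) * real n}" for i :: 'd
    define B where "B = {g\<in>GL. ln (quot.q (g *v v0)) - ln (quot.q v0) \<le> (?L - \<epsilon> / 2) * real n}"
    have A_sets: "A i \<in> sets (M n)" for i unfolding A_def sets_M by (rule sets_up)
    have B_sets: "B \<in> sets (M n)" unfolding B_def sets_M by (rule quot.measurable_increment_set)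
    have UA_sets: "(\<Union>i. A i) \<in> sets (M n)" by (rule sets.finite_UN[OF finite_class.finite_UNIV A_sets])
    have "measure (M n) {g\<in>GL. \<bar>ln (opnorm g) - real n * ?L\<bar> \<ge> \<epsilon> * real n} \<le> measure (M n) ((\<Union>i. A i) \<union> B)"
    proof (rule Mn.finite_measure_mono_AE)
      show "(\<Union>i. A i) \<union> B \<in> sets (M n)" by (rule sets.Un[OF UA_sets B_sets])
      show "AE g in M n. g \<in> {g\<in>GL. \<bar>ln (opnorm g) - real n * ?L\<bar> \<ge> \<epsilon> * real n} \<longrightarrow> g \<in> (\<Union>i. A i) \<union> B"
        using quot.AE_S[of n]
      proof eventually_elim
        case (elim g)
        note gU = elim
        show ?case
        proof
          assume "g \<in> {g\<in>GL. \<bar>ln (opnorm g) - real n * ?L\<bar> \<ge> \<epsilon> * real n}"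
          then have g: "g \<in> GL" and dev: "\<bar>ln (opnorm g) - real n * ?L\<bar> \<ge> \<epsilon> * real n" by auto
          have op: "opnorm g > 0" by (rule opnorm_pos[OF g])
          consider "ln (opnorm g) \<ge> (?L + \<epsilon>) * real n" | "ln (opnorm g) \<le> (?L - \<epsilon>) * real n"
            using dev by (auto simp: algebra_simps abs_if split: if_splits)
          then show "g \<in> (\<Union>i. A i) \<union> B"
          proof cases
            case 1
            have "\<exists>i. opnorm g \<le> d * d * vnorm (g *v axis i (1::'k))"
            proof (rule ccontr)
              assume "\<not> ?thesis"
              then have "d * (\<Sum>i\<in>UNIV. vnorm (g *v axis i (1::'k))) < d * (\<Sum>i\<in>(UNIV::'d set). opnorm g / (d * d))"
                using d by (intro mult_strict_left_mono sum_strict_mono) (auto simp: field_simps not_le)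
              also have "\<dots> = opnorm g" using d by (simp add: d_def)
              finally show False using opnorm_le_basis[of g] by (simp add: d_def)
            qed
            then obtain i where i: "opnorm g \<le> d * d * vnorm (g *v axis i (1::'k))" by blast
            have ax: "axis i 1 \<noteq> (0 :: 'k^'d)" by (simp add: axis_eq_0_iff)
            have gax: "vnorm (g *v axis i (1::'k)) > 0" using g ax by (simp add: GL_mult_eq_0)
            have "ln (opnorm g) \<le> ln (d * d * vnorm (g *v axis i (1::'k)))" using op i by (intro ln_mono) auto
            also have "\<dots> = 2 * ln d + ln (vnorm (g *v axis i (1::'k)))" using d gax by (simp add: ln_mult_pos)
            finally have l: "ln (opnorm g) \<le> 2 * ln d + ln (vnorm (g *v axis i (1::'k)))" .
            have "ln (vnorm (axis i (1::'k) :: 'k^'d)) \<le> ln d"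
              using vnorm_axis_1[of i, where 'k = 'k] ax by (intro ln_mono) (auto simp: d_def)
            moreover have "3 * ln d \<le> \<epsilon> / 2 * real n" using n c1 by linarith
            moreover have "(?L + \<epsilon>) * real n = (?L + \<epsilon> / 2) * real n + \<epsilon> / 2 * real n" by (simp add: algebra_simps)
            ultimately have "ln (vnorm (g *v axis i (1::'k))) - ln (vnorm (axis i (1::'k) :: 'k^'d)) \<ge> (?L + \<epsilon> / 2) * real n"
              using 1 l by linarith
            then have "g \<in> A i" using g by (simp add: A_def)
            then show ?thesis by blast
          next
            case 2
            have v0': "v0 \<noteq> 0" using v0 quot.subspace_U by (auto simp: vec.subspace_0)
            have K: "quot.K > 0" by (simp add: quot.K_def)
            have qg: "quot.q (g *v v0) > 0" using stab_notin[OF quot.subspace_U gU v0] by (simp add: quot.q_pos)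
            have "quot.q (g *v v0) \<le> quot.K * vnorm (g *v v0)" by (rule quot.q_le)
            also have "\<dots> \<le> quot.K * (opnorm g * vnorm v0)" using K by (intro mult_left_mono vnorm_le_opnorm) auto
            finally have "ln (quot.q (g *v v0)) \<le> ln (quot.K * (opnorm g * vnorm v0))" using qg by (intro ln_mono) auto
            also have "\<dots> = ln quot.K + ln (opnorm g) + ln (vnorm v0)" using K op v0' by (simp add: ln_mult_pos)
            finally have "ln (quot.q (g *v v0)) - ln (quot.q v0) \<le> c + ln (opnorm g)" using c2 by linarith
            also have "\<dots> \<le> \<epsilon> / 2 * real n + (?L - \<epsilon>) * real n" using n 2 by linarith
            also have "\<dots> = (?L - \<epsilon> / 2) * real n" by (simp add: algebra_simps)
            finally have "g \<in> B" using g by (simp add: B_def)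
            then show ?thesis by blast
          qed
        qed
      qed
    qed
    also have "\<dots> \<le> measure (M n) (\<Union>i. A i) + measure (M n) B"
      by (rule measure_Un_le[OF UA_sets B_sets])
    also have "measure (M n) (\<Union>i. A i) \<le> (\<Sum>i\<in>UNIV. measure (M n) (A i))"
      by (rule Mn.finite_measure_subadditive_finite) (use A_sets in auto)
    also have "\<dots> \<le> (\<Sum>i\<in>(UNIV::'d set). Cu n)" unfolding A_def by (intro sum_mono up) (simp add: axis_eq_0_iff)
    also have "measure (M n) B \<le> Cl n" unfolding B_def by (rule low) (use v0 in simp)
    finally show ?thesis using False C_pos[of n] by (simp add: C_def)
  qed
  have bound_vec: "measure (M n) {g\<in>GL. \<bar>ln (vnorm (g *v v) / vnorm v) - real n * ?L\<bar> \<ge> \<epsilon> * real n} \<le> C n"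
    if irr: "acts_irreducibly (generated_semigroup \<mu>)" and v: "v \<noteq> 0" for n v
  proof (cases "n < n0")
    case True
    then show ?thesis using prob_space.prob_le_1[OF prob_space_M] by (simp add: C_def)
  next
    case False
    have "\<forall>g\<in>generated_semigroup \<mu>. \<forall>w\<in>U. g *v w \<in> U"
      using generated_semigroup_stab[OF quot.U] by (auto simp: stab_def)
    then have U0: "U = {0}" using irr UQ(2) quot.subspace_U by (auto simp: acts_irreducibly_def)
    then have "quot.q w = vnorm w" for w using quot.Q_in[of w] by (simp add: quot.q_def quot.P_eq)
    then have low0: "measure (M n) {g\<in>GL. ln (vnorm (g *v v)) - ln (vnorm v) \<le> (?L - \<epsilon> / 2) * real n} \<le> Cl n"
      using low[of v n] U0 v by simp
    interpret Mn: prob_space "M n" by (rule prob_space_M)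
    let ?A = "{g\<in>GL. ln (vnorm (g *v v)) - ln (vnorm v) \<ge> (?L + \<epsilon> / 2) * real n}"
    let ?B = "{g\<in>GL. ln (vnorm (g *v v)) - ln (vnorm v) \<le> (?L - \<epsilon> / 2) * real n}"
    have B_sets: "?B \<in> sets (borel_GL :: ('k^'d^'d) measure)"
      by (rule sets_GL_Collect) measurable
    have "measure (M n) {g\<in>GL. \<bar>ln (vnorm (g *v v) / vnorm v) - real n * ?L\<bar> \<ge> \<epsilon> * real n} \<le> measure (M n) (?A \<union> ?B)"
    proof (rule Mn.finite_measure_mono)
      show "?A \<union> ?B \<in> sets (M n)" unfolding sets_M by (rule sets.Un[OF sets_up B_sets])
      show "{g\<in>GL. \<bar>ln (vnorm (g *v v) / vnorm v) - real n * ?L\<bar> \<ge> \<epsilon> * real n} \<subseteq> ?A \<union> ?B"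
      proof
        fix g assume "g \<in> {g\<in>GL. \<bar>ln (vnorm (g *v v) / vnorm v) - real n * ?L\<bar> \<ge> \<epsilon> * real n}"
        then have g: "g \<in> GL" and dev: "\<bar>ln (vnorm (g *v v) / vnorm v) - real n * ?L\<bar> \<ge> \<epsilon> * real n" by auto
        define x where "x = ln (vnorm (g *v v)) - ln (vnorm v)"
        have "ln (vnorm (g *v v) / vnorm v) = x"
          unfolding x_def using g v by (intro ln_divide_pos) (auto simp: GL_mult_eq_0)
        then have dev': "\<bar>x - real n * ?L\<bar> \<ge> \<epsilon> * real n" using dev by simp
        have le: "\<epsilon> / 2 * real n \<le> \<epsilon> * real n" using \<epsilon> by (intro mult_right_mono) auto
        have eq: "(?L + \<epsilon> / 2) * real n = real n * ?L + \<epsilon> / 2 * real n"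
          "(?L - \<epsilon> / 2) * real n = real n * ?L - \<epsilon> / 2 * real n" by (simp_all add: algebra_simps)
        have "x \<ge> (?L + \<epsilon> / 2) * real n \<or> x \<le> (?L - \<epsilon> / 2) * real n"
        proof (cases "real n * ?L \<le> x")
          case True
          then have "x - real n * ?L \<ge> \<epsilon> * real n" using dev' by simp
          then have "x \<ge> (?L + \<epsilon> / 2) * real n" using le unfolding eq(1) by linarith
          then show ?thesis ..
        next
          case False
          then have "real n * ?L - x \<ge> \<epsilon> * real n" using dev' by simp
          then have "x \<le> (?L - \<epsilon> / 2) * real n" using le unfolding eq(2) by linarith
          then show ?thesis ..
        qed
        then show "g \<in> ?A \<union> ?B" using g unfolding x_def by blast
      qed
    qed
    also have "\<dots> \<le> measure (M n) ?A + measure (M n) ?B"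
      by (rule measure_Un_le) (unfold sets_M, rule sets_up, rule B_sets)
    also have "\<dots> \<le> Cu n + Cl n" by (rule add_mono[OF up[OF v] low0])
    also have "\<dots> \<le> C n" using False C_pos[of n] by (simp add: C_def)
    finally show ?thesis .
  qed
  show ?thesis by (intro exI[of _ C] conjI allI impI rate bound_op bound_vec)
qed

end

theorem proposition4p1:
  fixes \<mu> :: "('k::local_field^'d^'d) measure" and p :: real
  assumes "p > 1"
    and "prob_space \<mu>"
    and "sets \<mu> = sets borel_GL"
    and "integrable \<mu> (\<lambda>g. (ln (Nsize g)) powr p)"
  shows "\<forall>\<epsilon>>0. \<exists>C :: nat \<Rightarrow> real.
    (\<lambda>n. real n powr (p - 2) * C n) summable_on {1..} \<and>
    (\<forall>n\<ge>1. measure (conv_power \<mu> n)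
       {g \<in> GL. \<bar>ln (opnorm g) - real n * lyapunov1 \<mu>\<bar> \<ge> \<epsilon> * real n} \<le> C n) \<and>
    (acts_irreducibly (generated_semigroup \<mu>) \<longrightarrow>
      (\<forall>v. v \<noteq> 0 \<longrightarrow> (\<forall>n\<ge>1. measure (conv_power \<mu> n)
         {g \<in> GL. \<bar>ln (vnorm (g *v v) / vnorm v) - real n * lyapunov1 \<mu>\<bar> \<ge> \<epsilon> * real n} \<le> C n)))"
proof (intro allI impI)
  fix \<epsilon> :: real assume \<epsilon>: "\<epsilon> > 0"
  interpret random_walk \<mu> p
    using assms by (simp add: random_walk_def lnN_def)
  obtain C where C: "summable_rate p C"
    and op: "\<forall>n. measure (conv_power \<mu> n) {g\<in>GL. \<bar>ln (opnorm g) - real n * lyapunov1 \<mu>\<bar> \<ge> \<epsilon> * real n} \<le> C n"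
    and vec: "acts_irreducibly (generated_semigroup \<mu>) \<longrightarrow> (\<forall>v n. v \<noteq> 0 \<longrightarrow>
      measure (conv_power \<mu> n) {g\<in>GL. \<bar>ln (vnorm (g *v v) / vnorm v) - real n * lyapunov1 \<mu>\<bar> \<ge> \<epsilon> * real n} \<le> C n)"
    using deviation_rates[OF \<epsilon>] by blast
  have "(\<lambda>n. real n powr (p - 2) * C n) summable_on UNIV"
    using C by (intro summable_nonneg_imp_summable_on) (auto simp: summable_rate_def)
  then have "(\<lambda>n. real n powr (p - 2) * C n) summable_on {1..}"
    by (rule summable_on_subset_banach) simp
  then show "\<exists>C :: nat \<Rightarrow> real.
    (\<lambda>n. real n powr (p - 2) * C n) summable_on {1..} \<and>
    (\<forall>n\<ge>1. measure (conv_power \<mu> n)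
       {g \<in> GL. \<bar>ln (opnorm g) - real n * lyapunov1 \<mu>\<bar> \<ge> \<epsilon> * real n} \<le> C n) \<and>
    (acts_irreducibly (generated_semigroup \<mu>) \<longrightarrow>
      (\<forall>v. v \<noteq> 0 \<longrightarrow> (\<forall>n\<ge>1. measure (conv_power \<mu> n)
         {g \<in> GL. \<bar>ln (vnorm (g *v v) / vnorm v) - real n * lyapunov1 \<mu>\<bar> \<ge> \<epsilon> * real n} \<le> C n)))"
    by (intro exI[of _ C] conjI allI impI op[rule_format] vec[rule_format])
qed

end
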